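(* Let $R$ be a numerical semigroup ring with homogeneous (respectively, unique) maximal ideal $\mathfrak{m}$. Then the following are equivalent: (1) $\operatorname{tr}_R(M) \subseteq \operatorname{tr}_R(\Omega^1_R(M))$ for all finitely generated torsion-free $R$-modules $M$ having no nonzero free summand. (2) $\operatorname{tr}_R(M) \subseteq \operatorname{tr}_R(\Omega^1_R(M))$ for all finitely generated torsion-free $R$-modules $M$ having no nonzero free summand and for which $\operatorname{rank}(M)=\mu_R(M)-1$. (3) Either $e(R)\le 2$ or $\mathfrak{c}_R=\mathfrak{m}$.
   Context: A numerical semigroup ring is a ring $R=k[\![t^{a_1},\dots,t^{a_n}]\!]$ or $R=k[t^{a_1},\dots,t^{a_n}]$, where $k$ is a field and $a_1<\cdots<a_n$ are the minimal generators of a numerical semigroup (so $\gcd(a_1,\dots,a_n)=1$), with maximal ideal $\mathfrak{m}=(t^{a_1},\dots,t^{a_n})$. In the case $k[t^{a_1},\dots,t^{a_n}]$, $R$ is graded with $t$ in degree $1$ and all modules are assumed to be graded. $e(R)$ is the Hilbert-Samuel multiplicity of $R$ (it equals $a_1$). $\mu_R(M)=\dim_k(M/\mathfrak{m}M)$ is the minimal number of generators of $M$. $\mathfrak{c}_R=(R:_{Q(R)}\overline{R})$ is the conductor ideal, where $Q(R)$ is the total quotient ring of $R$ and $\overline{R}$ is the integral closure of $R$ in $Q(R)$. The trace ideal of an $R$-module $M$ is $\operatorname{tr}_R(M)=\langle f(x)\mid f\in\operatorname{Hom}_R(M,R),\ x\in M\rangle$. $\Omega^1_R(M)$ is the first syzygy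 of $M$, i.e. the kernel of a surjection $R^{\oplus \mu_R(M)}\to M$ given by a minimal (homogeneous, in the graded case) generating set. *)

theory Defs
  imports
    "HOL-Computational_Algebra.Computational_Algebra"
    "HOL-Algebra.Ideal_Product"
    "HOL-Library.Extended_Nat"
    "Jordan_Normal_Form.Missing_VectorSpace"
begin

section \<open>Numerical semigroups\<close>

definition semigroup_gen :: "nat set \<Rightarrow> nat set" where
  "semigroup_gen A = {\<Sum>a\<in>A. c a * a | c :: nat \<Rightarrow> nat. True}"

text \<open>\<open>A = {a\<^sub>1 < \<dots> < a\<^sub>n}\<close>. The conditions force \<open>A\<close> to be nonempty and \<open>0 \<notin> A\<close>.\<close>

definition minimal_semigroup_generators :: "nat set \<Rightarrow> bool" where
  "minimal_semigroup_generators A \<longleftrightarrow>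
     finite A \<and> Gcd A = 1 \<and> (\<forall>a\<in>A. a \<notin> semigroup_gen (A - {a}))"


section \<open>Subrings of a domain, and their conductor\<close>

definition subring_record :: "'a::idom set \<Rightarrow> 'a ring" where
  "subring_record S = \<lparr>carrier = S, mult = (*), one = 1, zero = 0, add = (+)\<rparr>"

text \<open>All subrings below are domains, so the nonzerodivisors are the nonzero elements.
  Everything lives in the fraction field of the ambient domain.\<close>

definition total_quotient_ring :: "'a::idom set \<Rightarrow> 'a fract set" where
  "total_quotient_ring S = {Fraction_Field.Fract a b | a b. a \<in> S \<and> b \<in> S \<and> b \<noteq> 0}"

definition integral_closure :: "'a::idom set \<Rightarrow> 'a fract set" where
  "integral_closure S = {q \<in> total_quotient_ring S.
     \<exists>p. lead_coeff p = 1 \<and> (\<forall>i. coeff p i \<in> to_fract ` S) \<and> poly p q = 0}"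

definition conductor :: "'a::idom set \<Rightarrow> 'a fract set" where
  "conductor S = {q \<in> total_quotient_ring S. \<forall>x\<in>integral_closure S. q * x \<in> to_fract ` S}"


section \<open>Modules\<close>

text \<open>The \<open>mult\<close> and \<open>one\<close> fields which the module record inherits from the ring record play no
  role for modules; they are filled in arbitrarily.\<close>

definition self_module :: "'a ring \<Rightarrow> ('a, 'a) module" where
  "self_module R = \<lparr>carrier = carrier R, mult = mult R, one = one R, zero = zero R, add = add R,
     smult = mult R\<rparr>"

definition quot_module :: "('a, 'm) module \<Rightarrow> 'm set \<Rightarrow> ('a, 'm set) module" where
  "quot_module M N = \<lparr>carrier = a_rcosets\<^bsub>M\<^esub> N, mult = (\<lambda>_ _. N), one = N, zero = N,
     add = set_add M, smult = (\<lambda>r X. N <+>\<^bsub>M\<^esub> ((\<lambda>x. r \<odot>\<^bsub>M\<^esub> x) ` X))\<rparr>"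

definition free_module :: "'a ring \<Rightarrow> nat \<Rightarrow> ('a, nat \<Rightarrow> 'a) module" where
  "free_module R n = \<lparr>carrier = {..<n} \<rightarrow>\<^sub>E carrier R,
     mult = (\<lambda>v w. \<lambda>i\<in>{..<n}. v i \<otimes>\<^bsub>R\<^esub> w i), one = (\<lambda>i\<in>{..<n}. \<one>\<^bsub>R\<^esub>),
     zero = (\<lambda>i\<in>{..<n}. \<zero>\<^bsub>R\<^esub>), add = (\<lambda>v w. \<lambda>i\<in>{..<n}. v i \<oplus>\<^bsub>R\<^esub> w i),
     smult = (\<lambda>r v. \<lambda>i\<in>{..<n}. r \<otimes>\<^bsub>R\<^esub> v i)\<rparr>"

definition finitely_generated :: "'a ring \<Rightarrow> ('a, 'm) module \<Rightarrow> bool" where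
  "finitely_generated R M \<longleftrightarrow>
     (\<exists>X. finite X \<and> X \<subseteq> carrier M \<and> LinearCombinations.module.span R M X = carrier M)"

definition torsion_free :: "'a ring \<Rightarrow> ('a, 'm) module \<Rightarrow> bool" where
  "torsion_free R M \<longleftrightarrow> (\<forall>r\<in>carrier R. \<forall>x\<in>carrier M.
     r \<odot>\<^bsub>M\<^esub> x = \<zero>\<^bsub>M\<^esub> \<longrightarrow> r = \<zero>\<^bsub>R\<^esub> \<or> x = \<zero>\<^bsub>M\<^esub>)"

definition is_internal_direct_sum ::
    "'a ring \<Rightarrow> ('a, 'm) module \<Rightarrow> 'm set \<Rightarrow> 'm set \<Rightarrow> bool" where
  "is_internal_direct_sum R M N N' \<longleftrightarrow>
     LinearCombinations.submodule R N M \<and> LinearCombinations.submodule R N' M \<and>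
     N <+>\<^bsub>M\<^esub> N' = carrier M \<and> N \<inter> N' = {\<zero>\<^bsub>M\<^esub>}"

definition is_basis_of :: "'a ring \<Rightarrow> ('a, 'm) module \<Rightarrow> 'm set \<Rightarrow> 'm set \<Rightarrow> bool" where
  "is_basis_of R M N B \<longleftrightarrow> B \<subseteq> N \<and> \<not> LinearCombinations.module.lin_dep R M B \<and>
     LinearCombinations.module.span R M B = N"

definition has_nonzero_free_summand :: "'a ring \<Rightarrow> ('a, 'm) module \<Rightarrow> bool" where
  "has_nonzero_free_summand R M \<longleftrightarrow> (\<exists>N N' B.
     is_internal_direct_sum R M N N' \<and> N \<noteq> {\<zero>\<^bsub>M\<^esub>} \<and> is_basis_of R M N B)"

text \<open>Rank of a module over a domain: the maximal number of linearly independent elements.\<close>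

definition module_rank :: "'a ring \<Rightarrow> ('a, 'm) module \<Rightarrow> nat" where
  "module_rank R M = (GREATEST n. \<exists>B \<subseteq> carrier M. finite B \<and> card B = n \<and>
     \<not> LinearCombinations.module.lin_dep R M B)"

definition trace_ideal :: "'a ring \<Rightarrow> ('a, 'm) module \<Rightarrow> 'a set" where
  "trace_ideal R M =
     genideal R {f x | f x. f \<in> module_hom R M (self_module R) \<and> x \<in> carrier M}"

text \<open>\<open>\<mu>\<^sub>R(M) = dim\<^sub>k(M/\<mm>M)\<close>. Here \<open>K\<close> is the coefficient field \<open>k \<subseteq> R\<close>, which maps isomorphically
  onto \<open>R/\<mm>\<close>.\<close>

definition ideal_times_module :: "'a ring \<Rightarrow> 'a set \<Rightarrow> ('a, 'm) module \<Rightarrow> 'm set" where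
  "ideal_times_module R I M =
     LinearCombinations.module.span R M {r \<odot>\<^bsub>M\<^esub> x | r x. r \<in> I \<and> x \<in> carrier M}"

definition mu :: "'a ring \<Rightarrow> 'a ring \<Rightarrow> 'a set \<Rightarrow> ('a, 'm) module \<Rightarrow> nat" where
  "mu R K \<mm> M = vectorspace.dim K (quot_module M (ideal_times_module R \<mm> M))"

text \<open>\<open>g 0, \<dots>, g (n - 1)\<close> generate \<open>M\<close>. It is a minimal generating system when \<open>n = \<mu>\<^sub>R(M)\<close>.\<close>

definition generates :: "'a ring \<Rightarrow> ('a, 'm) module \<Rightarrow> nat \<Rightarrow> (nat \<Rightarrow> 'm) \<Rightarrow> bool" where
  "generates R M n g \<longleftrightarrow>
     g ` {..<n} \<subseteq> carrier M \<and> LinearCombinations.module.span R M (g ` {..<n}) = carrier M"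

text \<open>Kernel of the map \<open>R\<^sup>n \<rightarrow> M\<close> sending the \<open>i\<close>-th basis vector to \<open>g i\<close>.\<close>

definition syzygy :: "'a ring \<Rightarrow> ('a, 'm) module \<Rightarrow> nat \<Rightarrow> (nat \<Rightarrow> 'm) \<Rightarrow> ('a, nat \<Rightarrow> 'a) module" where
  "syzygy R M n g = (free_module R n)
     \<lparr>carrier := {v \<in> carrier (free_module R n). (\<Oplus>\<^bsub>M\<^esub>i\<in>{..<n}. v i \<odot>\<^bsub>M\<^esub> g i) = \<zero>\<^bsub>M\<^esub>}\<rparr>"


section \<open>Length and Hilbert-Samuel multiplicity\<close>

definition module_length :: "'a ring \<Rightarrow> ('a, 'm) module \<Rightarrow> enat" where
  "module_length R M = Sup {enat l | l. \<exists>N.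
     (\<forall>i\<le>l. LinearCombinations.submodule R (N i) M) \<and> (\<forall>i<l. N i \<subset> N (Suc i))}"

text \<open>Multiplicity of a ring of Krull dimension \<open>d = 1\<close>: the limit of
  \<open>d! \<cdot> length (R/\<mm>\<^sup>n) / n\<^sup>d\<close>.\<close>

definition hs_multiplicity :: "'a ring \<Rightarrow> 'a set \<Rightarrow> real" where
  "hs_multiplicity R \<mm> = lim (\<lambda>n. real (the_enat (module_length R
     (quot_module (self_module R) (\<mm> [^]\<^bsub>ideals_set R\<^esub> n)))) / real n)"


section \<open>Numerical semigroup rings\<close>

subsection \<open>The complete local case\<close>

definition nsr_fps :: "nat set \<Rightarrow> 'k::field fps ring" where
  "nsr_fps A = subring_record {f. \<forall>n. fps_nth f n \<noteq> 0 \<longrightarrow> n \<in> semigroup_gen A}"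

definition coeff_field_fps :: "'k::field fps ring" where
  "coeff_field_fps = subring_record (range fps_const)"

definition max_ideal_fps :: "nat set \<Rightarrow> 'k::field fps set" where
  "max_ideal_fps A = genideal (nsr_fps A) ((\<lambda>a. fps_X ^ a) ` A)"

subsection \<open>The graded case\<close>

definition nsr_poly :: "nat set \<Rightarrow> 'k::field poly ring" where
  "nsr_poly A = subring_record {f. \<forall>n. coeff f n \<noteq> 0 \<longrightarrow> n \<in> semigroup_gen A}"

definition coeff_field_poly :: "'k::field poly ring" where
  "coeff_field_poly = subring_record (range (\<lambda>c. [:c:]))"

definition max_ideal_poly :: "nat set \<Rightarrow> 'k::field poly set" where
  "max_ideal_poly A = genideal (nsr_poly A) ((\<lambda>a. monom 1 a) ` A)"

text \<open>\<open>D d\<close> is the degree \<open>d\<close> part of \<open>M\<close>; the base ring is \<open>nsr_poly A\<close> with \<open>t\<close> in degree 1.\<close>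

definition is_grading :: "nat set \<Rightarrow> ('k::field poly, 'm) module \<Rightarrow> (int \<Rightarrow> 'm set) \<Rightarrow> bool" where
  "is_grading A M D \<longleftrightarrow>
     (\<forall>d. subgroup (D d) (add_monoid M)) \<and>
     (\<forall>x\<in>carrier M. \<exists>!u. (\<forall>d. u d \<in> D d) \<and> finite {d. u d \<noteq> \<zero>\<^bsub>M\<^esub>} \<and>
        x = (\<Oplus>\<^bsub>M\<^esub>d\<in>{d. u d \<noteq> \<zero>\<^bsub>M\<^esub>}. u d)) \<and>
     (\<forall>s\<in>semigroup_gen A. \<forall>c d. \<forall>x\<in>D d. monom c s \<odot>\<^bsub>M\<^esub> x \<in> D (d + int s))"

definition homogeneous_elements :: "(int \<Rightarrow> 'm set) \<Rightarrow> 'm set" where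
  "homogeneous_elements D = (\<Union>d. D d)"

definition is_graded_submodule ::
    "'a ring \<Rightarrow> ('a, 'm) module \<Rightarrow> (int \<Rightarrow> 'm set) \<Rightarrow> 'm set \<Rightarrow> bool" where
  "is_graded_submodule R M D N \<longleftrightarrow> LinearCombinations.submodule R N M \<and>
     LinearCombinations.module.span R M (N \<inter> homogeneous_elements D) = N"

definition has_nonzero_graded_free_summand ::
    "'a ring \<Rightarrow> ('a, 'm) module \<Rightarrow> (int \<Rightarrow> 'm set) \<Rightarrow> bool" where
  "has_nonzero_graded_free_summand R M D \<longleftrightarrow> (\<exists>N N' B.
     is_internal_direct_sum R M N N' \<and> is_graded_submodule R M D N \<and>
     is_graded_submodule R M D N' \<and> N \<noteq> {\<zero>\<^bsub>M\<^esub>} \<and>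
     is_basis_of R M N B \<and> B \<subseteq> homogeneous_elements D)"


section \<open>The condition on traces\<close>

text \<open>\<open>\<Omega>\<^sup>1\<^sub>R(M)\<close> depends on a minimal generating system only up to isomorphism; the inclusion is
  required for each choice.\<close>

definition trace_in_syzygy_trace :: "'a ring \<Rightarrow> 'a ring \<Rightarrow> 'a set \<Rightarrow> ('a, 'm) module \<Rightarrow> bool" where
  "trace_in_syzygy_trace R K \<mm> M \<longleftrightarrow> (\<forall>g. generates R M (mu R K \<mm> M) g \<longrightarrow>
     trace_ideal R M \<subseteq> trace_ideal R (syzygy R M (mu R K \<mm> M) g))"

definition graded_trace_in_syzygy_trace ::
    "'a ring \<Rightarrow> 'a ring \<Rightarrow> 'a set \<Rightarrow> ('a, 'm) module \<Rightarrow> (int \<Rightarrow> 'm set) \<Rightarrow> bool" where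
  "graded_trace_in_syzygy_trace R K \<mm> M D \<longleftrightarrow> (\<forall>g. generates R M (mu R K \<mm> M) g \<and>
     g ` {..<mu R K \<mm> M} \<subseteq> homogeneous_elements D \<longrightarrow>
     trace_ideal R M \<subseteq> trace_ideal R (syzygy R M (mu R K \<mm> M) g))"

text \<open>The modules \<open>M\<close> over which the conditions range are quantified at an element type \<open>'m\<close>. A
  finitely generated module over \<open>R\<close> has at most as many elements as \<open>R\<close>, so as soon as the ambient
  power series (polynomial) type injects into \<open>'m\<close>, every finitely generated module is isomorphic
  to one whose carrier is a subset of \<open>'m\<close>.\<close>

definition large_enough :: "'a itself \<Rightarrow> 'm itself \<Rightarrow> bool" where
  "large_enough TYPE('a) TYPE('m) \<longleftrightarrow> (\<exists>e :: 'a \<Rightarrow> 'm. inj e)"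

end

theory Submission
  imports Defs
begin

text \<open>Write \<open>V\<close> for \<open>k[[t]]\<close> or \<open>k[t]\<close>, \<open>R\<close> for the subring of elements supported on the semigroup
\<open>G\<close>, and \<open>con\<close> for the least number from which on \<open>G\<close> contains everything. The conductor of \<open>R\<close>
is \<open>t^con V\<close> (\<open>conductor_eq\<close>), and the multiplicity is the least positive element \<open>e\<close> of \<open>G\<close>
(\<open>hs_multiplicity_eq\<close>).

\<^emph>\<open>(3) implies (1).\<close> If \<open>M\<close> has no free summand, then every linear map \<open>M \<rightarrow> R\<close> has its values
in the maximal ideal, because a value with nonzero constant term splits off a copy of \<open>R\<close>
(\<open>local_free_summand\<close>, \<open>graded_free_summand\<close>). So the trace of \<open>M\<close> is contained in the maximal
ideal. If \<open>M \<noteq> 0\<close>, then \<open>M\<close> is not free, the syzygy is nonzero, and it has a nonzero coordinate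
map to \<open>R\<close>. The trace of any module with a nonzero map to \<open>R\<close> contains the conductor
(\<open>ge_con_subset_trace\<close>). This settles the case where the conductor contains the maximal ideal.

If \<open>e = 2\<close>, then \<open>R\<close> is free with basis \<open>1, y\<close> over its even elements, where \<open>y = t^(con+1)\<close>. That all
maps \<open>M \<rightarrow> R\<close> avoid units implies \<open>yM \<subseteq> t\<^sup>2M\<close> (\<open>y0_smult_divisible\<close>). Let \<open>i\<close> be maximal with
\<open>yM \<subseteq> t^(2i) M\<close>. Then all values of maps \<open>M \<rightarrow> R\<close> have order at least \<open>2i\<close>, and dividing \<open>y g\<^sub>a\<close> by
\<open>t^(2i)\<close> for a suitable generator \<open>g\<^sub>a\<close> yields a relation with a coefficient of order exactly \<open>2i\<close>
unless \<open>2i \<ge> con\<close>. Since the trace of the syzygy contains the conductor, below which only even orders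
occur, that coefficient suffices (\<open>trace_subset_multiplicity_two\<close>).

\<^emph>\<open>(2) implies (3).\<close> Let \<open>e \<ge> 3\<close> and let the conductor differ from the maximal ideal. Put
\<open>F = con - 1\<close>. For a suitable \<open>u \<in> G\<close> with \<open>u - e \<notin> G\<close> (\<open>pole_exponents_ex\<close>) let
\<open>M = R\<^sup>2 + R (t^(u-e), t^(F-e)) \<subseteq> V\<^sup>2\<close>. It is minimally generated by three elements and has rank two and
no free summand. Multiplying the first coordinate by \<open>t\<^sup>e\<close> is a map \<open>M \<rightarrow> R\<close>, so \<open>t\<^sup>e\<close> is in the
trace of \<open>M\<close>. The syzygy is isomorphic to the ideal of all \<open>w \<in> R\<close> for which \<open>t^(u-e) w\<close> and
\<open>t^(F-e) w\<close> are in \<open>R\<close>. This ideal contains the conductor, so that maps from it to \<open>R\<close> do not lower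
orders, and its elements have order above \<open>e\<close>, because \<open>u - e\<close> and \<open>F\<close> are not in \<open>G\<close>. Hence
\<open>t\<^sup>e\<close> is not in the trace of the syzygy (\<open>trace_not_subset\<close>).\<close>

section \<open>Power series and polynomials in common\<close>

text \<open>\<open>k[[t]]\<close> and \<open>k[t]\<close> enter the argument only through their coefficients \<open>cf x n\<close>, their monomials
\<open>mon c s\<close>, the possibility to select and to shift exponents, and the fact that their ideals are
principal. Working from these properties treats the complete and the graded case at the same time;
the two cases part only where unit values and gradings are used to split off free summands.\<close>

locale exponent_ring =
  fixes cf :: "'a::idom \<Rightarrow> nat \<Rightarrow> 'k::field" and mon :: "'k \<Rightarrow> nat \<Rightarrow> 'a"
  assumes cf_add [simp]: "cf (x + y) n = cf x n + cf y n"
    and cf_mult: "cf (x * y) n = (\<Sum>i\<le>n. cf x i * cf y (n - i))"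
    and cf_ext: "(\<And>n. cf x n = cf y n) \<Longrightarrow> x = y"
    and cf_mon: "cf (mon c s) n = (if n = s then c else 0)"
    and restrict_ex: "\<exists>y. \<forall>n. cf y n = (if n \<in> T then cf x n else 0)"
    and shift_ex: "\<exists>y. \<forall>n. cf y n = cf x (n + s)"
    and principal_ex: "\<lbrakk>\<And>x y. x \<in> J \<Longrightarrow> y \<in> J \<Longrightarrow> x + y \<in> J; \<And>v x. x \<in> J \<Longrightarrow> v * x \<in> J;
      x \<in> J; x \<noteq> 0\<rbrakk> \<Longrightarrow> \<exists>p\<in>J. p \<noteq> 0 \<and> (\<forall>y\<in>J. p dvd y)"
begin

lemma cf_0 [simp]: "cf 0 n = 0"
  using cf_add[of 0 0 n] by (metis add_0 add_right_cancel)

lemma cf_minus [simp]: "cf (- x) n = - cf x n"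
  using cf_add[of "- x" x n] by (simp add: eq_neg_iff_add_eq_0)

lemma cf_diff [simp]: "cf (x - y) n = cf x n - cf y n"
  using cf_add[of x "- y" n] by simp

lemma cf_sum: "cf (sum f I) n = (\<Sum>i\<in>I. cf (f i) n)"
  by (induction I rule: infinite_finite_induct) auto

lemma cf_mon_mult: "cf (mon c s * x) n = (if s \<le> n then c * cf x (n - s) else 0)"
proof -
  have "cf (mon c s * x) n = (\<Sum>i\<le>n. if i = s then c * cf x (n - s) else 0)"
    unfolding cf_mult by (intro sum.cong) (auto simp: cf_mon)
  then show ?thesis by simp
qed

lemma mon_mult: "mon c s * mon d u = mon (c * d) (s + u)"
  by (rule cf_ext) (auto simp: cf_mon_mult cf_mon)

lemma mon_1_0: "mon 1 0 = 1"
proof -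
  have "mon 1 0 * mon 1 0 = mon 1 0" by (simp add: mon_mult)
  moreover have "mon 1 0 \<noteq> 0" using cf_mon[of 1 0 0] by auto
  ultimately show ?thesis by (metis mult_cancel_left2)
qed

lemma cf_1: "cf 1 n = (if n = 0 then 1 else 0)"
  using cf_mon[of 1 0 n] mon_1_0 by simp

lemma mon_0 [simp]: "mon 0 s = 0"
  by (rule cf_ext) (auto simp: cf_mon)

lemma mon_eq_0_iff [simp]: "mon c s = 0 \<longleftrightarrow> c = 0"
  by (metis cf_0 cf_mon mon_0)

lemma mon_add: "mon (c + d) s = mon c s + mon d s"
  by (rule cf_ext) (auto simp: cf_mon)

text \<open>The ideal of \<open>V\<close> generated by \<open>t\<^sup>n\<close>.\<close>

definition ge :: "nat \<Rightarrow> 'a set" where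
  "ge n = {x. \<forall>i<n. cf x i = 0}"

lemma ge_0 [simp]: "ge 0 = UNIV" by (simp add: ge_def)

lemma ge_mono: "m \<le> n \<Longrightarrow> ge n \<subseteq> ge m" by (auto simp: ge_def)

lemma zero_in_ge [simp]: "0 \<in> ge n" by (simp add: ge_def)

lemma ge_add: "x \<in> ge n \<Longrightarrow> y \<in> ge n \<Longrightarrow> x + y \<in> ge n" by (simp add: ge_def)

lemma ge_diff: "x \<in> ge n \<Longrightarrow> y \<in> ge n \<Longrightarrow> x - y \<in> ge n" by (simp add: ge_def)

lemma mon_mult_in_ge [simp]: "mon c n * x \<in> ge n"
  by (auto simp: ge_def cf_mon_mult)

lemma ge_factor:
  assumes "x \<in> ge n" obtains y where "x = mon 1 n * y" "\<And>i. cf y i = cf x (i + n)"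
proof -
  obtain y where y: "\<And>i. cf y i = cf x (i + n)" using shift_ex by blast
  have "x = mon 1 n * y"
    by (rule cf_ext) (use assms in \<open>auto simp: cf_mon_mult y ge_def\<close>)
  then show ?thesis using that y by blast
qed

lemma ge_iff: "x \<in> ge n \<longleftrightarrow> (\<exists>y. x = mon 1 n * y)"
  by (metis ge_factor mon_mult_in_ge)

lemma ge_mult: assumes "x \<in> ge m" "y \<in> ge n" shows "x * y \<in> ge (m + n)"
proof -
  obtain x' y' where "x = mon 1 m * x'" "y = mon 1 n * y'" using assms by (auto simp: ge_iff)
  then have "x * y = mon 1 (m + n) * (x' * y')"
    using mon_mult[of 1 m 1 n] by (simp add: algebra_simps flip: mon_mult)
  then show ?thesis by simp
qed

lemma ge_mult_left: "x \<in> ge m \<Longrightarrow> y * x \<in> ge m"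
  using ge_mult[of y 0 x m] by simp

lemma ge_mult_right: "x \<in> ge m \<Longrightarrow> x * y \<in> ge m"
  using ge_mult_left by (simp add: mult.commute)

lemma cf_mult_lowest:
  assumes "x \<in> ge m" "y \<in> ge n" shows "cf (x * y) (m + n) = cf x m * cf y n"
proof -
  have "cf (x * y) (m + n) = (\<Sum>i\<le>m+n. if i = m then cf x m * cf y n else 0)"
    unfolding cf_mult
  proof (intro sum.cong refl)
    fix i assume i: "i \<in> {..m+n}"
    consider "i < m" | "i = m" | "i > m" by linarith
    then show "cf x i * cf y (m + n - i) = (if i = m then cf x m * cf y n else 0)"
      by cases (use assms i in \<open>auto simp: ge_def\<close>)
  qed
  then show ?thesis by simp
qed

lemma order_ex:
  assumes "x \<noteq> 0" obtains n where "x \<in> ge n" "cf x n \<noteq> 0"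
proof -
  have "\<exists>n. cf x n \<noteq> 0" using assms cf_ext[of x 0] by auto
  then have "cf x (LEAST n. cf x n \<noteq> 0) \<noteq> 0" "x \<in> ge (LEAST n. cf x n \<noteq> 0)"
    using LeastI_ex[of "\<lambda>n. cf x n \<noteq> 0"] by (auto simp: ge_def dest: not_less_Least)
  then show ?thesis using that by blast
qed

lemma ge_Suc: "x \<in> ge (Suc n) \<longleftrightarrow> x \<in> ge n \<and> cf x n = 0"
  by (auto simp: ge_def less_Suc_eq)

definition restr :: "nat set \<Rightarrow> 'a \<Rightarrow> 'a" where
  "restr T x = (SOME y. \<forall>n. cf y n = (if n \<in> T then cf x n else 0))"

lemma cf_restr [simp]: "cf (restr T x) n = (if n \<in> T then cf x n else 0)"
  using someI_ex[OF restrict_ex[of T x]] by (simp add: restr_def)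

end

text \<open>A nonzero ideal of \<open>k[[t]]\<close> is generated by any of its elements of least order, a nonzero ideal
of \<open>k[t]\<close> by any of its elements of least degree.\<close>

interpretation Fps: exponent_ring "fps_nth :: 'k::field fps \<Rightarrow> _" "\<lambda>c s. fps_const c * fps_X ^ s"
proof
  fix x y :: "'k fps" and n s T J
  show "fps_nth (x + y) n = fps_nth x n + fps_nth y n" by simp
  show "fps_nth (x * y) n = (\<Sum>i\<le>n. fps_nth x i * fps_nth y (n - i))"
    by (simp add: fps_mult_nth atMost_atLeast0)
  show "x = y" if "\<And>n. fps_nth x n = fps_nth y n" using that by (simp add: fps_ext)
  show "fps_nth (fps_const c * fps_X ^ s) n = (if n = s then c else 0)" for c :: 'k
    by (simp add: fps_X_power_nth)
  show "\<exists>y. \<forall>n. fps_nth y n = (if n \<in> T then fps_nth x n else 0)"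
    by (rule exI[of _ "Abs_fps (\<lambda>n. if n \<in> T then fps_nth x n else 0)"]) simp
  show "\<exists>y. \<forall>n. fps_nth y n = fps_nth x (n + s)"
    by (rule exI[of _ "fps_shift s x"]) simp
  assume add: "\<And>x y. x \<in> J \<Longrightarrow> y \<in> J \<Longrightarrow> x + y \<in> J" and mult: "\<And>v x. x \<in> J \<Longrightarrow> v * x \<in> J"
    and x: "x \<in> J" "x \<noteq> 0"
  obtain p where p: "p \<in> J \<and> p \<noteq> 0" "\<And>y. y \<in> J \<and> y \<noteq> 0 \<Longrightarrow> subdegree p \<le> subdegree y"
    using ex_has_least_nat[of "\<lambda>y. y \<in> J \<and> y \<noteq> 0" x subdegree] x by blast
  have "p dvd y" if "y \<in> J" for y
    using p that by (cases "y = 0") (auto simp: fps_dvd_iff)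
  with p show "\<exists>p\<in>J. p \<noteq> 0 \<and> (\<forall>y\<in>J. p dvd y)" by blast
qed

interpretation Poly: exponent_ring "coeff :: 'k::field poly \<Rightarrow> _" monom
proof
  fix x y :: "'k poly" and n s T J
  show "coeff (x + y) n = coeff x n + coeff y n" by simp
  show "coeff (x * y) n = (\<Sum>i\<le>n. coeff x i * coeff y (n - i))"
    by (simp add: coeff_mult)
  show "x = y" if "\<And>n. coeff x n = coeff y n" using that by (simp add: poly_eqI)
  show "coeff (monom c s) n = (if n = s then c else 0)" for c :: 'k by simp
  have fin: "\<forall>\<^sub>\<infinity>n. (if n \<in> T then coeff x n else 0) = 0"
    using MOST_coeff_eq_0[of x] by (rule MOST_mono) simp
  show "\<exists>y. \<forall>n. coeff y n = (if n \<in> T then coeff x n else 0)"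
    by (rule exI[of _ "Abs_poly (\<lambda>n. if n \<in> T then coeff x n else 0)"])
      (simp add: Abs_poly_inverse[simplified, OF fin])
  show "\<exists>y. \<forall>n. coeff y n = coeff x (n + s)"
    by (rule exI[of _ "poly_shift s x"]) (simp add: coeff_poly_shift add.commute)
  assume add: "\<And>x y. x \<in> J \<Longrightarrow> y \<in> J \<Longrightarrow> x + y \<in> J" and mult: "\<And>v x. x \<in> J \<Longrightarrow> v * x \<in> J"
    and x: "x \<in> J" "x \<noteq> 0"
  obtain p where p: "p \<in> J \<and> p \<noteq> 0" "\<And>y. y \<in> J \<and> y \<noteq> 0 \<Longrightarrow> degree p \<le> degree y"
    using ex_has_least_nat[of "\<lambda>y. y \<in> J \<and> y \<noteq> 0" x degree] x by blast
  have "p dvd y" if y: "y \<in> J" for y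
  proof (rule ccontr)
    assume "\<not> p dvd y"
    then have nz: "y mod p \<noteq> 0" by (simp add: mod_eq_0_iff_dvd)
    have "y mod p = y + (- (y div p)) * p"
      by (simp add: minus_div_mult_eq_mod[symmetric])
    also have "\<dots> \<in> J" by (intro add mult y) (use p in blast)
    finally show False using p(2)[of "y mod p"] nz degree_mod_less'[of p y] p by force
  qed
  with p show "\<exists>p\<in>J. p \<noteq> 0 \<and> (\<forall>y\<in>J. p dvd y)" by blast
qed

section \<open>Semigroup rings\<close>

lemma subring_record_simps [simp]:
  "carrier (subring_record S) = S" "x \<otimes>\<^bsub>subring_record S\<^esub> y = x * y"
  "x \<oplus>\<^bsub>subring_record S\<^esub> y = x + y" "\<one>\<^bsub>subring_record S\<^esub> = 1" "\<zero>\<^bsub>subring_record S\<^esub> = 0"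
  by (simp_all add: subring_record_def)

lemma self_module_simps [simp]:
  "carrier (self_module R) = carrier R" "x \<oplus>\<^bsub>self_module R\<^esub> y = x \<oplus>\<^bsub>R\<^esub> y"
  "\<zero>\<^bsub>self_module R\<^esub> = \<zero>\<^bsub>R\<^esub>" "r \<odot>\<^bsub>self_module R\<^esub> x = r \<otimes>\<^bsub>R\<^esub> x"
  by (simp_all add: self_module_def)

lemma cring_subring_record:
  assumes "0 \<in> S" "1 \<in> S" "\<And>x y. x \<in> S \<Longrightarrow> y \<in> S \<Longrightarrow> x + y \<in> S"
    "\<And>x y. x \<in> S \<Longrightarrow> y \<in> S \<Longrightarrow> x * y \<in> S" "\<And>x. x \<in> S \<Longrightarrow> - x \<in> S"
  shows "cring (subring_record S)"
proof (intro cringI abelian_groupI comm_monoidI)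
  show "\<exists>y\<in>carrier (subring_record S). y \<oplus>\<^bsub>subring_record S\<^esub> x = \<zero>\<^bsub>subring_record S\<^esub>"
    if "x \<in> carrier (subring_record S)" for x
    using that assms by (intro bexI[of _ "- x"]) auto
qed (use assms in \<open>auto simp: algebra_simps\<close>)

lemma a_inv_subring_record:
  assumes "cring (subring_record S)" "x \<in> S" "- x \<in> S"
  shows "\<ominus>\<^bsub>subring_record S\<^esub> x = - x"
proof -
  interpret cring "subring_record S" by fact
  show ?thesis using assms by (intro minus_equality) auto
qed

lemma ideal_subring_recordI:
  assumes "cring (subring_record S)" "I \<subseteq> S" "0 \<in> I" "\<And>x y. x \<in> I \<Longrightarrow> y \<in> I \<Longrightarrow> x + y \<in> I"
    "\<And>r x. r \<in> S \<Longrightarrow> x \<in> I \<Longrightarrow> r * x \<in> I" "- 1 \<in> S"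
  shows "ideal I (subring_record S)"
proof -
  interpret cring "subring_record S" by fact
  have neg: "- x \<in> I" if "x \<in> I" for x using assms(5)[OF assms(6) that] by simp
  have comm: "x * r \<in> I" if "x \<in> I" "r \<in> S" for r x
    using assms(5)[OF that(2,1)] by (simp add: mult.commute)
  show ?thesis
  proof (rule idealI)
    show "ring (subring_record S)" by (rule ring_axioms)
    show "subgroup I (add_monoid (subring_record S))"
    proof (intro add.subgroupI)
      show "\<ominus>\<^bsub>subring_record S\<^esub> a \<in> I" if "a \<in> I" for a
        using a_inv_subring_record[OF assms(1), of a] subsetD[OF assms(2)] neg[OF that] that
        by simp
    qed (use assms in auto)
  qed (use assms comm in auto)
qed

lemma ideal_subring_recordD:
  assumes "ideal I (subring_record S)"
  shows "I \<subseteq> S" "0 \<in> I" "\<And>x y. x \<in> I \<Longrightarrow> y \<in> I \<Longrightarrow> x + y \<in> I"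
    "\<And>r x. r \<in> S \<Longrightarrow> x \<in> I \<Longrightarrow> r * x \<in> I"
    "\<And>r x. r \<in> S \<Longrightarrow> x \<in> I \<Longrightarrow> x * r \<in> I"
proof -
  interpret ideal I "subring_record S" by fact
  show "I \<subseteq> S" using a_subset by simp
  show "0 \<in> I" using additive_subgroup.zero_closed[OF additive_subgroup_axioms] by simp
  show "\<And>x y. x \<in> I \<Longrightarrow> y \<in> I \<Longrightarrow> x + y \<in> I"
    using additive_subgroup.a_closed[OF additive_subgroup_axioms] by simp
  show "\<And>r x. r \<in> S \<Longrightarrow> x \<in> I \<Longrightarrow> r * x \<in> I" using I_l_closed by simp
  show "\<And>r x. r \<in> S \<Longrightarrow> x \<in> I \<Longrightarrow> x * r \<in> I" using I_r_closed by simp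
qed

text \<open>The condition on \<open>con - 1\<close> makes \<open>ge con\<close> the largest ideal of \<open>V\<close> inside the subring \<open>RS\<close>
(\<open>in_ge_conI\<close>).\<close>

locale semigroup_ring = exponent_ring cf mon
  for cf :: "'a::idom \<Rightarrow> nat \<Rightarrow> 'k::field" and mon +
  fixes G :: "nat set" and con :: nat
  assumes zero_in_G [simp]: "0 \<in> G"
    and add_in_G: "m \<in> G \<Longrightarrow> n \<in> G \<Longrightarrow> m + n \<in> G"
    and con_in_G: "n \<ge> con \<Longrightarrow> n \<in> G"
    and con_least: "con > 0 \<Longrightarrow> con - 1 \<notin> G"
begin

definition RS :: "'a set" where "RS = {f. \<forall>n. cf f n \<noteq> 0 \<longrightarrow> n \<in> G}"
definition mm :: "'a set" where "mm = {f \<in> RS. cf f 0 = 0}"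
abbreviation R :: "'a ring" where "R \<equiv> subring_record RS"
abbreviation K :: "'a ring" where "K \<equiv> subring_record (range (\<lambda>c. mon c 0))"

lemma RS_add [intro]: "x \<in> RS \<Longrightarrow> y \<in> RS \<Longrightarrow> x + y \<in> RS"
  unfolding RS_def mem_Collect_eq cf_add by (metis add.left_neutral)

lemma RS_uminus [intro]: "x \<in> RS \<Longrightarrow> - x \<in> RS"
  by (auto simp: RS_def)

lemma RS_diff [intro]: "x \<in> RS \<Longrightarrow> y \<in> RS \<Longrightarrow> x - y \<in> RS"
  using RS_add[of x "- y"] by auto

lemma RS_0 [simp]: "0 \<in> RS" and RS_1 [simp]: "1 \<in> RS"
  by (auto simp: RS_def cf_1)

lemma RS_mult [intro]: assumes "x \<in> RS" "y \<in> RS" shows "x * y \<in> RS"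
proof -
  have "n \<in> G" if "cf (x * y) n \<noteq> 0" for n
  proof -
    obtain i where "i \<le> n" "cf x i * cf y (n - i) \<noteq> 0"
      using \<open>cf (x * y) n \<noteq> 0\<close> unfolding cf_mult by (rule sum.not_neutral_contains_not_neutral) auto
    then show ?thesis using add_in_G[of i "n - i"] assms by (auto simp: RS_def)
  qed
  then show ?thesis by (simp add: RS_def)
qed

lemma mon_in_RS: "s \<in> G \<Longrightarrow> mon c s \<in> RS"
  by (simp add: RS_def cf_mon)

lemma restr_in_RS: "x \<in> RS \<Longrightarrow> restr T x \<in> RS"
  by (auto simp: RS_def)

lemma ge_con_subset: "ge con \<subseteq> RS"
proof
  fix x assume "x \<in> ge con"
  then have "n \<ge> con" if "cf x n \<noteq> 0" for n using that by (auto simp: ge_def not_le[symmetric])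
  then show "x \<in> RS" using con_in_G by (auto simp: RS_def)
qed

lemma cring_R: "cring R"
  by (rule cring_subring_record) auto

sublocale R: cring R by (rule cring_R)

lemma a_inv_R [simp]: "x \<in> RS \<Longrightarrow> \<ominus>\<^bsub>R\<^esub> x = - x"
  using a_inv_subring_record[OF cring_R] by auto

lemma idealI_R:
  assumes "I \<subseteq> RS" "0 \<in> I" "\<And>x y. x \<in> I \<Longrightarrow> y \<in> I \<Longrightarrow> x + y \<in> I"
    "\<And>r x. r \<in> RS \<Longrightarrow> x \<in> I \<Longrightarrow> r * x \<in> I"
  shows "ideal I R"
  using ideal_subring_recordI[OF cring_R] assms RS_uminus[OF RS_1] by blast

lemma field_K: "field K"
proof -
  have cr: "cring K"
  proof (rule cring_subring_record)
    show "0 \<in> range (\<lambda>c. mon c 0)" by (rule image_eqI[of _ _ 0]) auto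
    show "1 \<in> range (\<lambda>c. mon c 0)" by (rule image_eqI[of _ _ 1]) (auto simp: mon_1_0)
    show "- x \<in> range (\<lambda>c. mon c 0)" if h: "x \<in> range (\<lambda>c. mon c 0)" for x
    proof -
      obtain c where "x = mon c 0" using h by blast
      then have "- x = mon (- c) 0" by (intro cf_ext) (auto simp: cf_mon)
      then show ?thesis by auto
    qed
  qed (auto simp: mon_mult mon_add[symmetric])
  interpret cring K by fact
  show ?thesis
  proof (rule cring_fieldI2)
    show "\<exists>b\<in>carrier K. a \<otimes>\<^bsub>K\<^esub> b = \<one>\<^bsub>K\<^esub>" if a: "a \<in> carrier K" "a \<noteq> \<zero>\<^bsub>K\<^esub>" for a
    proof -
      obtain c where "a = mon c 0" "c \<noteq> 0" using a by auto
      then show ?thesis by (intro bexI[of _ "mon (1/c) 0"]) (auto simp: mon_mult mon_1_0)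
    qed
  qed simp
qed

lemma K_subset: "range (\<lambda>c. mon c 0) \<subseteq> RS"
  by (auto intro: mon_in_RS)

lemma mm_subset: "mm \<subseteq> RS" by (auto simp: mm_def)

lemma mm_mult: "r \<in> RS \<Longrightarrow> x \<in> mm \<Longrightarrow> r * x \<in> mm"
  by (auto simp: mm_def cf_mult)

lemma ideal_mm: "ideal mm R"
  by (rule idealI_R) (auto simp: mm_def cf_mult)

lemma ge_G_ideal: "ideal {x \<in> RS. x \<in> ge n} R"
  by (rule idealI_R) (auto intro: ge_add ge_mult_left)

end

section \<open>Linear combinations of families\<close>

definition lc :: "('a, 'm) module \<Rightarrow> nat \<Rightarrow> (nat \<Rightarrow> 'm) \<Rightarrow> (nat \<Rightarrow> 'a) \<Rightarrow> 'm" where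
  "lc M n g v = (\<Oplus>\<^bsub>M\<^esub>i\<in>{..<n}. v i \<odot>\<^bsub>M\<^esub> g i)"

context
  fixes R :: "'a ring" and M :: "('a, 'm) module"
  assumes mod: "Module.module R M"
begin

interpretation module R M by (rule mod)

lemma lc_closed:
  assumes "g ` {..<n} \<subseteq> carrier M" "v \<in> {..<n} \<rightarrow> carrier R"
  shows "lc M n g v \<in> carrier M"
  unfolding lc_def using assms by (intro M.finsum_closed) auto

lemma lc_add:
  assumes "g ` {..<n} \<subseteq> carrier M" "v \<in> {..<n} \<rightarrow> carrier R" "w \<in> {..<n} \<rightarrow> carrier R"
    and "\<And>i. i < n \<Longrightarrow> u i = v i \<oplus>\<^bsub>R\<^esub> w i"
  shows "lc M n g u = lc M n g v \<oplus>\<^bsub>M\<^esub> lc M n g w"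
proof -
  have "lc M n g u = (\<Oplus>\<^bsub>M\<^esub>i\<in>{..<n}. v i \<odot>\<^bsub>M\<^esub> g i \<oplus>\<^bsub>M\<^esub> w i \<odot>\<^bsub>M\<^esub> g i)"
    unfolding lc_def using assms by (intro M.finsum_cong') (auto simp: smult_l_distr Pi_iff)
  also have "\<dots> = lc M n g v \<oplus>\<^bsub>M\<^esub> lc M n g w"
    unfolding lc_def using assms by (intro M.finsum_addf) (auto simp: Pi_iff)
  finally show ?thesis .
qed

lemma lc_smult:
  assumes "g ` {..<n} \<subseteq> carrier M" "v \<in> {..<n} \<rightarrow> carrier R" "r \<in> carrier R"
    and "\<And>i. i < n \<Longrightarrow> u i = r \<otimes>\<^bsub>R\<^esub> v i"
  shows "lc M n g u = r \<odot>\<^bsub>M\<^esub> lc M n g v"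
proof -
  have "r \<odot>\<^bsub>M\<^esub> lc M n g v = (\<Oplus>\<^bsub>M\<^esub>i\<in>{..<n}. r \<odot>\<^bsub>M\<^esub> (v i \<odot>\<^bsub>M\<^esub> g i))"
    unfolding lc_def using assms by (intro finsum_smult) (auto simp: Pi_iff)
  also have "\<dots> = lc M n g u"
    unfolding lc_def using assms by (intro M.finsum_cong') (auto simp: smult_assoc1 Pi_iff)
  finally show ?thesis ..
qed

lemma lc_unit:
  assumes "g ` {..<n} \<subseteq> carrier M" "j < n"
  shows "lc M n g (\<lambda>i. if i = j then \<one>\<^bsub>R\<^esub> else \<zero>\<^bsub>R\<^esub>) = g j"
proof -
  have "lc M n g (\<lambda>i. if i = j then \<one>\<^bsub>R\<^esub> else \<zero>\<^bsub>R\<^esub>) =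
      (\<Oplus>\<^bsub>M\<^esub>i\<in>{..<n}. if j = i then g i else \<zero>\<^bsub>M\<^esub>)"
    unfolding lc_def using assms by (intro M.finsum_cong') auto
  also have "\<dots> = g j" using assms by (intro M.add.finprod_singleton) auto
  finally show ?thesis .
qed

lemma lc_zero: "g ` {..<n} \<subseteq> carrier M \<Longrightarrow> (\<And>i. i < n \<Longrightarrow> v i = \<zero>\<^bsub>R\<^esub>) \<Longrightarrow> lc M n g v = \<zero>\<^bsub>M\<^esub>"
  unfolding lc_def by (subst M.finsum_cong'[where g = "\<lambda>_. \<zero>\<^bsub>M\<^esub>"]) auto

lemma lc_cong:
  assumes "g ` {..<n} \<subseteq> carrier M" "v \<in> {..<n} \<rightarrow> carrier R" "\<And>i. i < n \<Longrightarrow> u i = v i"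
  shows "lc M n g u = lc M n g v"
  unfolding lc_def using assms by (intro M.finsum_cong') auto

lemma lc_set:
  assumes "g ` {..<n} \<subseteq> carrier M" "inj_on g {..<n}" "a \<in> g ` {..<n} \<rightarrow> carrier R"
  shows "lincomb a (g ` {..<n}) = lc M n g (\<lambda>i. a (g i))"
  unfolding lc_def lincomb_def using assms by (subst M.finsum_reindex) (auto simp: Pi_iff)

lemma span_family:
  assumes g: "g ` {..<n} \<subseteq> carrier M"
  shows "span (g ` {..<n}) = {lc M n g v | v. v \<in> {..<n} \<rightarrow> carrier R}" (is "?L = ?R")
proof
  have sub: "submodule R ?R M"
  proof (unfold_locales, goal_cases)
    case 1 show ?case using lc_closed[OF g] by blast
  next
    case (2 x y)
    then obtain v w where "x = lc M n g v" "y = lc M n g w"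
      "v \<in> {..<n} \<rightarrow> carrier R" "w \<in> {..<n} \<rightarrow> carrier R" by blast
    then show ?case
      using lc_add[OF g, of v w "\<lambda>i. v i \<oplus>\<^bsub>R\<^esub> w i"]
      by (intro CollectI exI[of _ "\<lambda>i. v i \<oplus>\<^bsub>R\<^esub> w i"]) auto
  next
    case 3 show ?case
      by (intro CollectI exI[of _ "\<lambda>i. \<zero>\<^bsub>R\<^esub>"] conjI lc_zero[OF g, symmetric]) auto
  next
    case (4 c x)
    then obtain v where "x = lc M n g v" "v \<in> {..<n} \<rightarrow> carrier R" by blast
    then show ?case
      using lc_smult[OF g, of v c "\<lambda>i. c \<otimes>\<^bsub>R\<^esub> v i"] 4(1)
      by (intro CollectI exI[of _ "\<lambda>i. c \<otimes>\<^bsub>R\<^esub> v i"]) auto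
  qed
  have "g j \<in> ?R" if "j < n" for j
    by (intro CollectI exI[of _ "\<lambda>i. if i = j then \<one>\<^bsub>R\<^esub> else \<zero>\<^bsub>R\<^esub>"] conjI lc_unit[OF g that, symmetric]) auto
  then have "g ` {..<n} \<subseteq> ?R" by blast
  then show "?L \<subseteq> ?R" using span_is_subset sub by blast
  interpret S: submodule R ?L M by (rule span_is_submodule[OF g])
  have "lc M n g v \<in> ?L" if v: "v \<in> {..<n} \<rightarrow> carrier R" for v
  proof -
    have "(\<Oplus>\<^bsub>M\<^esub>i\<in>I. v i \<odot>\<^bsub>M\<^esub> g i) \<in> ?L" if I: "finite I" "I \<subseteq> {..<n}" for I
      using I
    proof (induction I)
      case (insert i I)
      have gi: "g i \<in> ?L" using in_own_span[OF g] insert by auto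
      have "(\<Oplus>\<^bsub>M\<^esub>i\<in>insert i I. v i \<odot>\<^bsub>M\<^esub> g i) = v i \<odot>\<^bsub>M\<^esub> g i \<oplus>\<^bsub>M\<^esub> (\<Oplus>\<^bsub>M\<^esub>i\<in>I. v i \<odot>\<^bsub>M\<^esub> g i)"
        using insert(1,2,4) g v by (intro M.finsum_insert) (auto simp: Pi_iff image_subset_iff subset_iff)
      then show ?case using insert gi v by (auto simp: Pi_iff)
    qed auto
    then show ?thesis by (simp add: lc_def)
  qed
  then show "?R \<subseteq> ?L" by blast
qed

lemma lin_indpt_family:
  assumes g: "g ` {..<n} \<subseteq> carrier M" and nz: "\<one>\<^bsub>R\<^esub> \<noteq> \<zero>\<^bsub>R\<^esub>"
    and rel: "\<And>v i. v \<in> {..<n} \<rightarrow> carrier R \<Longrightarrow> lc M n g v = \<zero>\<^bsub>M\<^esub> \<Longrightarrow> i < n \<Longrightarrow> v i = \<zero>\<^bsub>R\<^esub>"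
  shows "inj_on g {..<n}" "lin_indpt (g ` {..<n})"
proof -
  show inj: "inj_on g {..<n}"
  proof (rule inj_onI, rule ccontr)
    fix i j assume ij: "i \<in> {..<n}" "j \<in> {..<n}" "g i = g j" "i \<noteq> j"
    let ?u = "\<lambda>j l. if l = j then \<one>\<^bsub>R\<^esub> else \<zero>\<^bsub>R\<^esub>"
    have gi: "g i \<in> carrier M" using ij g by auto
    have 1: "lc M n g (\<lambda>l. (\<ominus>\<^bsub>R\<^esub> \<one>\<^bsub>R\<^esub>) \<otimes>\<^bsub>R\<^esub> ?u i l) = (\<ominus>\<^bsub>R\<^esub> \<one>\<^bsub>R\<^esub>) \<odot>\<^bsub>M\<^esub> lc M n g (?u i)"
      by (rule lc_smult[OF g]) auto
    have "lc M n g (\<lambda>l. ?u j l \<oplus>\<^bsub>R\<^esub> (\<ominus>\<^bsub>R\<^esub> \<one>\<^bsub>R\<^esub>) \<otimes>\<^bsub>R\<^esub> ?u i l)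
        = lc M n g (?u j) \<oplus>\<^bsub>M\<^esub> lc M n g (\<lambda>l. (\<ominus>\<^bsub>R\<^esub> \<one>\<^bsub>R\<^esub>) \<otimes>\<^bsub>R\<^esub> ?u i l)"
      by (rule lc_add[OF g]) auto
    also have "\<dots> = \<zero>\<^bsub>M\<^esub>"
      using ij gi 1 lc_unit[OF g] smult_minus_1[OF gi] by (simp add: M.r_neg)
    finally have "?u j i \<oplus>\<^bsub>R\<^esub> (\<ominus>\<^bsub>R\<^esub> \<one>\<^bsub>R\<^esub>) \<otimes>\<^bsub>R\<^esub> ?u i i = \<zero>\<^bsub>R\<^esub>"
      using ij(1) by (intro rel[of "\<lambda>l. ?u j l \<oplus>\<^bsub>R\<^esub> (\<ominus>\<^bsub>R\<^esub> \<one>\<^bsub>R\<^esub>) \<otimes>\<^bsub>R\<^esub> ?u i l"]) auto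
    then have "\<ominus>\<^bsub>R\<^esub> \<one>\<^bsub>R\<^esub> = \<zero>\<^bsub>R\<^esub>" using ij by simp
    then show False using nz by (metis R.minus_minus R.minus_zero R.one_closed)
  qed
  show "lin_indpt (g ` {..<n})"
  proof (rule finite_lin_indpt2)
    fix a assume a: "a \<in> g ` {..<n} \<rightarrow> carrier R" "lincomb a (g ` {..<n}) = \<zero>\<^bsub>M\<^esub>"
    then have "lc M n g (\<lambda>i. a (g i)) = \<zero>\<^bsub>M\<^esub>" using lc_set[OF g inj] by simp
    moreover have "(\<lambda>i. a (g i)) \<in> {..<n} \<rightarrow> carrier R" using a by auto
    ultimately have "a (g i) = \<zero>\<^bsub>R\<^esub>" if "i < n" for i using rel that by blast
    then show "\<forall>v\<in>g ` {..<n}. a v = \<zero>\<^bsub>R\<^esub>" by blast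
  qed (use g in auto)
qed

lemma lin_indpt_familyD:
  assumes g: "g ` {..<n} \<subseteq> carrier M" and inj: "inj_on g {..<n}" and li: "lin_indpt (g ` {..<n})"
    and v: "v \<in> {..<n} \<rightarrow> carrier R" "lc M n g v = \<zero>\<^bsub>M\<^esub>" "i < n"
  shows "v i = \<zero>\<^bsub>R\<^esub>"
proof (rule ccontr)
  assume nz: "v i \<noteq> \<zero>\<^bsub>R\<^esub>"
  define a where "a = (\<lambda>x. v (inv_into {..<n} g x))"
  have ag: "a (g i) = v i" if "i < n" for i using that inj by (simp add: a_def)
  have "lincomb a (g ` {..<n}) = lc M n g (\<lambda>i. a (g i))"
    using lc_set[OF g inj, of a] ag v by (auto simp: Pi_iff)
  also have "\<dots> = lc M n g v" by (rule lc_cong[OF g v(1)]) (rule ag)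
  finally have "lin_dep (g ` {..<n})"
    using v nz ag by (intro lin_dep_crit[of "g ` {..<n}" _ a "g i"]) (auto simp: Pi_iff)
  with li show False by simp
qed

lemma hom_lc:
  assumes f: "f \<in> module_hom R M N" and N: "Module.module R N"
    and g: "g ` {..<n} \<subseteq> carrier M" and v: "v \<in> {..<n} \<rightarrow> carrier R"
  shows "f (lc M n g v) = lc N n (\<lambda>i. f (g i)) v"
proof -
  interpret N: module R N by (rule N)
  interpret mod_hom R M N f by unfold_locales (rule f)
  have fin: "(\<lambda>i. v i \<odot>\<^bsub>M\<^esub> g i) \<in> {..<n} \<rightarrow> carrier M" using g v by (auto simp: Pi_iff)
  have "f (\<Oplus>\<^bsub>M\<^esub>i\<in>I. v i \<odot>\<^bsub>M\<^esub> g i) = (\<Oplus>\<^bsub>N\<^esub>i\<in>I. v i \<odot>\<^bsub>N\<^esub> f (g i))" if "finite I" "I \<subseteq> {..<n}" for I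
    using that
  proof (induction I)
    case (insert i I)
    have "f (\<Oplus>\<^bsub>M\<^esub>i\<in>insert i I. v i \<odot>\<^bsub>M\<^esub> g i) = f (v i \<odot>\<^bsub>M\<^esub> g i \<oplus>\<^bsub>M\<^esub> (\<Oplus>\<^bsub>M\<^esub>i\<in>I. v i \<odot>\<^bsub>M\<^esub> g i))"
      using insert fin by (subst M.finsum_insert) (auto simp: Pi_iff)
    also have "\<dots> = v i \<odot>\<^bsub>N\<^esub> f (g i) \<oplus>\<^bsub>N\<^esub> (\<Oplus>\<^bsub>N\<^esub>i\<in>I. v i \<odot>\<^bsub>N\<^esub> f (g i))"
      using insert fin g v by (subst f_add) (auto simp: Pi_iff image_subset_iff intro!: M.finsum_closed)
    also have "\<dots> = (\<Oplus>\<^bsub>N\<^esub>i\<in>insert i I. v i \<odot>\<^bsub>N\<^esub> f (g i))"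
      using insert g v by (subst N.M.finsum_insert) (auto simp: Pi_iff image_subset_iff)
    finally show ?case .
  qed auto
  then show ?thesis by (simp add: lc_def)
qed

end

lemma dim_familyI:
  fixes K :: "'a ring" and V :: "('a, 'm) module"
  assumes V: "vectorspace K V" and h: "h ` {..<n} \<subseteq> carrier V"
    and span: "\<And>x. x \<in> carrier V \<Longrightarrow> \<exists>v \<in> {..<n} \<rightarrow> carrier K. x = lc V n h v"
    and rel: "\<And>v i. v \<in> {..<n} \<rightarrow> carrier K \<Longrightarrow> lc V n h v = \<zero>\<^bsub>V\<^esub> \<Longrightarrow> i < n \<Longrightarrow> v i = \<zero>\<^bsub>K\<^esub>"
  shows "vectorspace.dim K V = n"
proof -
  interpret vectorspace K V by (rule V)
  have md: "Module.module K V" by unfold_locales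
  have li: "inj_on h {..<n}" "lin_indpt (h ` {..<n})"
    using lin_indpt_family[OF md h zero_not_one[symmetric]] rel by blast+
  have "span (h ` {..<n}) = carrier V"
    unfolding span_family[OF md h] using span lc_closed[OF md h] by blast
  then have "dim = card (h ` {..<n})"
    using li h by (intro dim_basis) (auto simp: basis_def)
  then show ?thesis using li by (simp add: card_image)
qed

section \<open>Minimal numbers of generators\<close>

lemma quot_module_simps:
  "carrier (quot_module M N) = a_rcosets\<^bsub>M\<^esub> N" "\<zero>\<^bsub>quot_module M N\<^esub> = N"
  "X \<oplus>\<^bsub>quot_module M N\<^esub> Y = X <+>\<^bsub>M\<^esub> Y"
  "r \<odot>\<^bsub>quot_module M N\<^esub> X = N <+>\<^bsub>M\<^esub> ((\<lambda>x. r \<odot>\<^bsub>M\<^esub> x) ` X)"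
  by (simp_all add: quot_module_def)

context
  fixes R :: "'a ring" and M :: "('a, 'm) module" (structure) and W
  assumes sub: "LinearCombinations.submodule R W M"
begin

interpretation W: submodule R W M by (rule sub)
interpretation module R M by (rule W.module)

lemma submodule_abelian_subgroup: "abelian_subgroup W M"
proof (rule abelian_subgroupI3)
  show "additive_subgroup W M"
  proof (unfold additive_subgroup_def, rule M.add.subgroupI)
    show "\<ominus> a \<in> W" if a: "a \<in> W" for a
      using W.smult_closed[OF _ a, of "\<ominus>\<^bsub>R\<^esub> \<one>\<^bsub>R\<^esub>"] smult_minus_1[OF subsetD[OF W.subset a]]
      by simp
  qed (use W.subset W.zero_closed in \<open>auto simp del: W.zero_closed\<close>)
qed (rule M.abelian_group_axioms)

interpretation W: abelian_subgroup W M by (rule submodule_abelian_subgroup)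

lemma submodule_uminus: "x \<in> W \<Longrightarrow> \<ominus> x \<in> W"
  using W.smult_closed[of "\<ominus>\<^bsub>R\<^esub> \<one>\<^bsub>R\<^esub>" x] smult_minus_1[OF subsetD[OF W.subset]] by simp

lemma quot_carrier: "carrier (quot_module M W) = {W +> x | x. x \<in> carrier M}"
  by (auto simp: quot_module_simps A_RCOSETS_def')

lemma quot_zero_iff: "x \<in> carrier M \<Longrightarrow> W +> x = W \<longleftrightarrow> x \<in> W"
  using W.a_rcos_self[of x] W.a_rcos_const[of x] by auto

lemma quot_add: "x \<in> carrier M \<Longrightarrow> y \<in> carrier M \<Longrightarrow>
    (W +> x) \<oplus>\<^bsub>quot_module M W\<^esub> (W +> y) = W +> (x \<oplus> y)"
  by (simp add: quot_module_simps W.a_rcos_sum)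

lemma quot_smult:
  assumes r: "r \<in> carrier R" and x: "x \<in> carrier M"
  shows "r \<odot>\<^bsub>quot_module M W\<^esub> (W +> x) = W +> (r \<odot> x)"
proof -
  have "z \<in> W +> (r \<odot> x)" if h: "z \<in> W <+>\<^bsub>M\<^esub> ((\<lambda>x. r \<odot> x) ` (W +> x))" for z
  proof -
    obtain w w' where w: "w \<in> W" "w' \<in> W" "z = w \<oplus> r \<odot> (w' \<oplus> x)"
      using h by (auto simp: set_add_def' a_r_coset_def')
    have c: "w \<in> carrier M" "w' \<in> carrier M" using w W.subset by auto
    have "z = (w \<oplus> r \<odot> w') \<oplus> r \<odot> x"
      using w c r x by (simp add: smult_r_distr M.a_assoc)
    moreover have "w \<oplus> r \<odot> w' \<in> W" using w r by auto
    ultimately show ?thesis by (auto simp: a_r_coset_def')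
  qed
  moreover have "z \<in> W <+>\<^bsub>M\<^esub> ((\<lambda>x. r \<odot> x) ` (W +> x))" if h: "z \<in> W +> (r \<odot> x)" for z
  proof -
    obtain w where "w \<in> W" "z = w \<oplus> r \<odot> x" using h by (auto simp: a_r_coset_def')
    then show ?thesis using W.a_rcos_self[OF x] by (auto simp: set_add_def')
  qed
  ultimately show ?thesis by (auto simp: quot_module_simps)
qed

lemma module_quot: "Module.module R (quot_module M W)"
proof -
  let ?Q = "quot_module M W"
  have z: "\<zero>\<^bsub>?Q\<^esub> = W +> \<zero>"
    using quot_zero_iff[of "\<zero>"] by (simp add: quot_module_simps)
  have ex: "\<exists>x. x \<in> carrier M \<and> X = W +> x" if "X \<in> carrier ?Q" for X
    using that by (auto simp: quot_carrier)
  show ?thesis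
  proof (rule module_criteria)
    show "cring R" by (rule R.cring_axioms)
    show "\<zero>\<^bsub>?Q\<^esub> \<in> carrier ?Q" unfolding z by (auto simp: quot_carrier)
    show "\<forall>v\<in>carrier ?Q. \<exists>u\<in>carrier ?Q. v \<oplus>\<^bsub>?Q\<^esub> u = \<zero>\<^bsub>?Q\<^esub>"
    proof
      fix v assume "v \<in> carrier ?Q"
      then obtain x where "x \<in> carrier M" "v = W +> x" using ex by blast
      then show "\<exists>u\<in>carrier ?Q. v \<oplus>\<^bsub>?Q\<^esub> u = \<zero>\<^bsub>?Q\<^esub>"
        by (intro bexI[of _ "W +> (\<ominus> x)"]) (auto simp: quot_add z M.r_neg quot_carrier)
    qed
  qed (auto dest!: ex simp: quot_carrier quot_add quot_smult z M.a_ac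
        smult_assoc1 smult_l_distr smult_r_distr)
qed

lemma quot_hom: "(\<lambda>x. W +> x) \<in> module_hom R M (quot_module M W)"
  by (auto simp: module_hom_def quot_add quot_smult quot_carrier)

end

context semigroup_ring
begin

lemma module_restrict_scalars:
  assumes "Module.module R M" and cr: "cring (subring_record S)" and sub: "S \<subseteq> RS"
  shows "Module.module (subring_record S) M"
proof -
  interpret module R M by fact
  have sub: "c \<in> carrier R" if "c \<in> S" for c using that sub by auto
  show ?thesis
  proof (rule module_criteria)
    show "\<forall>v\<in>carrier M. \<exists>u\<in>carrier M. v \<oplus>\<^bsub>M\<^esub> u = \<zero>\<^bsub>M\<^esub>"
      using M.r_neg M.a_inv_closed by blast
    show "\<forall>a b v. a \<in> carrier (subring_record S) \<and> b \<in> carrier (subring_record S) \<and> v \<in> carrier M \<longrightarrow>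
        (a \<oplus>\<^bsub>subring_record S\<^esub> b) \<odot>\<^bsub>M\<^esub> v = a \<odot>\<^bsub>M\<^esub> v \<oplus>\<^bsub>M\<^esub> b \<odot>\<^bsub>M\<^esub> v"
      using smult_l_distr sub by simp
    show "\<forall>a b v. a \<in> carrier (subring_record S) \<and> b \<in> carrier (subring_record S) \<and> v \<in> carrier M \<longrightarrow>
        (a \<otimes>\<^bsub>subring_record S\<^esub> b) \<odot>\<^bsub>M\<^esub> v = a \<odot>\<^bsub>M\<^esub> (b \<odot>\<^bsub>M\<^esub> v)"
      using smult_assoc1 sub by simp
    show "\<forall>v\<in>carrier M. \<one>\<^bsub>subring_record S\<^esub> \<odot>\<^bsub>M\<^esub> v = v" using smult_one by simp
    show "cring (subring_record S)" by (rule cr)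
  qed (use sub M.a_comm M.a_assoc in \<open>auto simp: smult_r_distr\<close>)
qed

context
  fixes M :: "('a, 'm) module" (structure)
  assumes mod: "Module.module R M"
begin

interpretation module R M by (rule mod)

abbreviation (input) "mM \<equiv> ideal_times_module R mm M"

lemma submodule_mM: "LinearCombinations.submodule R mM M"
  unfolding ideal_times_module_def using mm_subset by (intro span_is_submodule) auto

lemma smult_in_mM: "r \<in> mm \<Longrightarrow> x \<in> carrier M \<Longrightarrow> r \<odot> x \<in> mM"
  unfolding ideal_times_module_def
  by (rule subsetD[OF in_own_span]) (use mm_subset in auto)

lemma generatesD:
  assumes "generates R M n g"
  shows "g ` {..<n} \<subseteq> carrier M" "\<And>x. x \<in> carrier M \<Longrightarrow> \<exists>v\<in>{..<n} \<rightarrow> RS. x = lc M n g v"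
  using assms span_family[OF mod, of g n] by (fastforce simp: generates_def)+

lemma lc_mm_in_mM:
  assumes g: "g ` {..<n} \<subseteq> carrier M" and v: "v \<in> {..<n} \<rightarrow> mm"
  shows "lc M n g v \<in> mM"
proof -
  interpret W: submodule R mM M by (rule submodule_mM)
  have vc: "i < n \<Longrightarrow> v i \<in> RS" for i using v mm_subset by auto
  have "(\<Oplus>i\<in>I. v i \<odot> g i) \<in> mM" if "finite I" "I \<subseteq> {..<n}" for I
    using that
  proof (induction I)
    case (insert i I)
    have *: "v j \<odot> g j \<in> mM" if "j \<in> insert i I" for j
      using that insert(4) g v by (intro smult_in_mM) auto
    have "(\<Oplus>i\<in>insert i I. v i \<odot> g i) = v i \<odot> g i \<oplus> (\<Oplus>i\<in>I. v i \<odot> g i)"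
      using insert(1,2) * W.subset by (intro M.finsum_insert) auto
    then show ?case using insert * by auto
  qed auto
  then show ?thesis by (simp add: lc_def)
qed

lemma mM_eq:
  assumes gen: "generates R M n g"
  shows "mM = {lc M n g v | v. v \<in> {..<n} \<rightarrow> mm}" (is "_ = ?R")
proof
  note g = generatesD[OF gen]
  interpret I: ideal mm R by (rule ideal_mm)
  note I = ideal_subring_recordD[OF ideal_mm]
  have mR: "v \<in> {..<n} \<rightarrow> mm \<Longrightarrow> v \<in> {..<n} \<rightarrow> carrier R" for v using mm_subset by auto
  have sub: "submodule R ?R M"
  proof (unfold_locales, goal_cases)
    case 1 show ?case using lc_closed[OF mod g(1) mR] by blast
  next
    case (2 x y)
    then obtain v w where "x = lc M n g v" "y = lc M n g w"
      "v \<in> {..<n} \<rightarrow> mm" "w \<in> {..<n} \<rightarrow> mm" by blast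
    then show ?case
      using lc_add[OF mod g(1) mR mR, of v w "\<lambda>i. v i + w i"] I(3)
      by (intro CollectI exI[of _ "\<lambda>i. v i + w i"]) auto
  next
    case 3 show ?case
      using lc_zero[OF mod g(1), of "\<lambda>i. 0"] I(2)
      by (intro CollectI exI[of _ "\<lambda>i. 0"]) auto
  next
    case (4 c x)
    then obtain v where "x = lc M n g v" "v \<in> {..<n} \<rightarrow> mm" by blast
    then show ?case
      using lc_smult[OF mod g(1) mR, of v c "\<lambda>i. c * v i"] 4(1) I(4)
      by (intro CollectI exI[of _ "\<lambda>i. c * v i"]) auto
  qed
  have "r \<odot> x \<in> ?R" if r: "r \<in> mm" and x: "x \<in> carrier M" for r x
  proof -
    obtain v where v: "v \<in> {..<n} \<rightarrow> RS" "x = lc M n g v" using g(2) x by blast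
    have "lc M n g (\<lambda>i. r * v i) = r \<odot> x"
      unfolding v(2) by (rule lc_smult[OF mod g(1)]) (use v r mm_subset in auto)
    moreover have "(\<lambda>i. r * v i) \<in> {..<n} \<rightarrow> mm" using v r I(5) by auto
    ultimately show ?thesis by (metis (mono_tags, lifting) mem_Collect_eq)
  qed
  then show "mM \<subseteq> ?R" unfolding ideal_times_module_def
    by (intro span_is_subset[OF _ sub]) blast
  show "?R \<subseteq> mM" using lc_mm_in_mM[OF g(1)] by blast
qed

lemma vectorspace_quot: "vectorspace K (quot_module M mM)"
proof -
  interpret Q: module R "quot_module M mM" by (rule module_quot[OF submodule_mM])
  interpret field K by (rule field_K)
  interpret KQ: module K "quot_module M mM"
    by (rule module_restrict_scalars[OF Q.module_axioms cring_axioms K_subset])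
  show ?thesis by unfold_locales
qed

lemma lc_quot:
  assumes g: "g ` {..<n} \<subseteq> carrier M" and v: "v \<in> {..<n} \<rightarrow> RS"
  shows "lc (quot_module M mM) n (\<lambda>i. mM +> g i) v = mM +> lc M n g v"
  using hom_lc[OF mod quot_hom[OF submodule_mM] module_quot[OF submodule_mM] g] v by simp

lemma lc_split:
  assumes g: "g ` {..<n} \<subseteq> carrier M" and v: "v \<in> {..<n} \<rightarrow> RS"
  obtains w m where "m \<in> {..<n} \<rightarrow> mm" "w = (\<lambda>i. mon (cf (v i) 0) 0)" "w \<in> {..<n} \<rightarrow> RS"
    "\<And>i. i < n \<Longrightarrow> v i = w i + m i" "lc M n g v = lc M n g w \<oplus> lc M n g m"
proof -
  define w where "w = (\<lambda>i. mon (cf (v i) 0) 0)"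
  have m: "(\<lambda>i. v i - w i) \<in> {..<n} \<rightarrow> mm"
    using v by (auto simp: w_def mm_def cf_mon intro!: mon_in_RS)
  have w: "w \<in> {..<n} \<rightarrow> RS" by (auto simp: w_def intro!: mon_in_RS)
  show ?thesis
    by (rule that[OF m w_def w]) (use g m w mm_subset in \<open>auto intro!: lc_add[OF mod]\<close>)
qed

lemma quot_spanned:
  assumes gen: "generates R M n g" and X: "X \<in> carrier (quot_module M mM)"
  shows "\<exists>v\<in>{..<n} \<rightarrow> carrier K. X = lc (quot_module M mM) n (\<lambda>i. mM +> g i) v"
proof -
  note g = generatesD[OF gen]
  interpret W: submodule R mM M by (rule submodule_mM)
  interpret W: abelian_subgroup mM M by (rule submodule_abelian_subgroup[OF submodule_mM])
  obtain x where x: "x \<in> carrier M" "X = mM +> x"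
    using X by (auto simp: quot_carrier[OF submodule_mM])
  obtain v where v: "v \<in> {..<n} \<rightarrow> RS" "x = lc M n g v" using g(2) x by blast
  obtain w m where wm: "m \<in> {..<n} \<rightarrow> mm" "w = (\<lambda>i. mon (cf (v i) 0) 0)" "w \<in> {..<n} \<rightarrow> RS"
    "\<And>i. i < n \<Longrightarrow> v i = w i + m i" "lc M n g v = lc M n g w \<oplus> lc M n g m"
    by (rule lc_split[OF g(1) v(1)]) blast
  have m: "lc M n g m \<in> mM" by (rule lc_mm_in_mM[OF g(1) wm(1)])
  have w: "lc M n g w \<in> carrier M" using lc_closed[OF mod g(1)] wm(3) by simp
  have "x \<in> mM +> lc M n g w"
    unfolding v(2) wm(5) a_r_coset_def' using m w W.subset M.a_comm by blast
  then have "X = mM +> lc M n g w" using x w W.a_repr_independence' by metis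
  then show ?thesis using lc_quot[OF g(1) wm(3)] wm(2) by (intro bexI[of _ w]) auto
qed

text \<open>Relations with coefficients in the maximal ideal become trivial modulo it, so the classes of the
generators form a basis of \<open>M/\<mm>M\<close>.\<close>

lemma mu_eqI:
  assumes gen: "generates R M n g"
    and rel: "\<And>v i. v \<in> {..<n} \<rightarrow> RS \<Longrightarrow> lc M n g v = \<zero> \<Longrightarrow> i < n \<Longrightarrow> v i \<in> mm"
  shows "mu R K mm M = n"
  unfolding mu_def
proof (rule dim_familyI[OF vectorspace_quot, where h = "\<lambda>i. mM +> g i"])
  note g = generatesD[OF gen]
  show "(\<lambda>i. mM +> g i) ` {..<n} \<subseteq> carrier (quot_module M mM)"
    using g(1) by (auto simp: quot_carrier[OF submodule_mM])
  show "\<exists>v\<in>{..<n} \<rightarrow> carrier K. X = lc (quot_module M mM) n (\<lambda>i. mM +> g i) v"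
    if "X \<in> carrier (quot_module M mM)" for X
    using quot_spanned[OF gen that] .
  show "v i = \<zero>\<^bsub>K\<^esub>"
    if v: "v \<in> {..<n} \<rightarrow> carrier K"
      and z: "lc (quot_module M mM) n (\<lambda>i. mM +> g i) v = \<zero>\<^bsub>quot_module M mM\<^esub>" and i: "i < n" for v i
  proof -
    have vR: "v \<in> {..<n} \<rightarrow> RS" using v K_subset by auto
    have "mM +> lc M n g v = mM"
      using z lc_quot[OF g(1) vR] by (simp add: quot_module_simps)
    then have "lc M n g v \<in> mM"
      using quot_zero_iff[OF submodule_mM] lc_closed[OF mod g(1)] vR by simp
    then obtain m where m: "m \<in> {..<n} \<rightarrow> mm" "lc M n g v = lc M n g m"
      using mM_eq[OF gen] by blast
    have mR: "m \<in> {..<n} \<rightarrow> RS" using m(1) mm_subset by auto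
    have neg: "lc M n g (\<lambda>i. - 1 * m i) = (- 1) \<odot> lc M n g m"
      by (rule lc_smult[OF mod g(1)]) (use mR in auto)
    have "lc M n g (\<lambda>i. v i - m i) = lc M n g v \<oplus> lc M n g (\<lambda>i. - 1 * m i)"
      by (rule lc_add[OF mod g(1)]) (use mR vR in auto)
    also have "\<dots> = \<zero>"
      using neg m(2) smult_minus_1[of "lc M n g m"] lc_closed[OF mod g(1)] mR
      by (simp add: M.r_neg)
    finally have "v i - m i \<in> mm"
      using vR mR i by (intro rel[of "\<lambda>i. v i - m i"]) auto
    then have "cf (v i) 0 = 0" using m(1) i by (auto simp: mm_def)
    moreover obtain c where "v i = mon c 0" using v i by (auto simp: Pi_iff)
    ultimately show ?thesis by (simp add: cf_mon)
  qed
qed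

end

end

section \<open>Trace ideals and syzygies\<close>

lemma self_hom_add: "f \<in> module_hom R M (self_module R) \<Longrightarrow> x \<in> carrier M \<Longrightarrow> y \<in> carrier M \<Longrightarrow>
    f (x \<oplus>\<^bsub>M\<^esub> y) = f x \<oplus>\<^bsub>R\<^esub> f y"
  by (simp add: module_hom_def)

lemma self_hom_smult: "f \<in> module_hom R M (self_module R) \<Longrightarrow> r \<in> carrier R \<Longrightarrow> x \<in> carrier M \<Longrightarrow>
    f (r \<odot>\<^bsub>M\<^esub> x) = r \<otimes>\<^bsub>R\<^esub> f x"
  by (simp add: module_hom_def)

lemma self_hom_closed: "f \<in> module_hom R M (self_module R) \<Longrightarrow> x \<in> carrier M \<Longrightarrow> f x \<in> carrier R"
  by (auto simp: module_hom_def)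

context semigroup_ring
begin

lemma self_homI:
  assumes "\<And>x. x \<in> carrier M \<Longrightarrow> f x \<in> RS"
    "\<And>x y. x \<in> carrier M \<Longrightarrow> y \<in> carrier M \<Longrightarrow> f (x \<oplus>\<^bsub>M\<^esub> y) = f x + f y"
    "\<And>r x. r \<in> RS \<Longrightarrow> x \<in> carrier M \<Longrightarrow> f (r \<odot>\<^bsub>M\<^esub> x) = r * f x"
  shows "f \<in> module_hom R M (self_module R)"
  using assms by (auto simp: module_hom_def)

lemma self_hom_zero:
  assumes "Module.module R M" "f \<in> module_hom R M (self_module R)" shows "f \<zero>\<^bsub>M\<^esub> = 0"
proof -
  interpret module R M by fact
  show ?thesis using self_hom_smult[OF assms(2), of 0 "\<zero>\<^bsub>M\<^esub>"] by simp
qed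

lemma trace_gens_subset:
  "{f x | f x. f \<in> module_hom R M (self_module R) \<and> x \<in> carrier M} \<subseteq> carrier R"
  by (auto simp: module_hom_def)

lemma ideal_trace: "ideal (trace_ideal R M) R"
  unfolding trace_ideal_def by (rule R.genideal_ideal[OF trace_gens_subset])

lemma in_trace: "f \<in> module_hom R M (self_module R) \<Longrightarrow> x \<in> carrier M \<Longrightarrow> f x \<in> trace_ideal R M"
  unfolding trace_ideal_def by (rule subsetD[OF R.genideal_self[OF trace_gens_subset]]) blast

lemma trace_least:
  assumes "ideal I R" "\<And>f x. f \<in> module_hom R M (self_module R) \<Longrightarrow> x \<in> carrier M \<Longrightarrow> f x \<in> I"
  shows "trace_ideal R M \<subseteq> I"
  unfolding trace_ideal_def using assms by (intro R.genideal_minimal) auto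

lemma trace_zero_module:
  assumes "Module.module R M" "carrier M = {\<zero>\<^bsub>M\<^esub>}" "ideal I R"
  shows "trace_ideal R M \<subseteq> I"
proof (rule trace_least[OF assms(3)])
  fix f x assume "f \<in> module_hom R M (self_module R)" "x \<in> carrier M"
  then show "f x \<in> I"
    using self_hom_zero[OF assms(1), of f] assms(2) ideal_subring_recordD(2)[OF assms(3)] by auto
qed

text \<open>The values of \<open>F\<close> generate a principal ideal \<open>pV\<close>. For an element \<open>z\<close> of the conductor and any
\<open>w\<close> of \<open>V\<close>, the map \<open>z w F / p\<close> still has its values in \<open>R\<close>. As \<open>p\<close> is a combination of values
of \<open>F\<close> with coefficients \<open>w\<close> in \<open>V\<close>, values of these maps add up to \<open>z\<close>.\<close>

lemma ge_con_subset_trace: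
  assumes F: "F \<in> module_hom R N (self_module R)" and x: "x \<in> carrier N" "F x \<noteq> 0"
    and N: "\<And>y y'. y \<in> carrier N \<Longrightarrow> y' \<in> carrier N \<Longrightarrow> y \<oplus>\<^bsub>N\<^esub> y' \<in> carrier N"
      "\<And>r y. r \<in> RS \<Longrightarrow> y \<in> carrier N \<Longrightarrow> r \<odot>\<^bsub>N\<^esub> y \<in> carrier N"
  shows "ge con \<subseteq> trace_ideal R N"
proof
  define L where "L = (\<lambda>xs. sum_list (map (\<lambda>(w, x). w * F x) xs))"
  define J where "J = {L xs | xs. snd ` set xs \<subseteq> carrier N}"
  note I = ideal_subring_recordD[OF ideal_trace[of N]]
  have "\<exists>p\<in>J. p \<noteq> 0 \<and> (\<forall>y\<in>J. p dvd y)"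
  proof (rule principal_ex)
    fix y z assume "y \<in> J" "z \<in> J"
    then obtain ys zs where "y = L ys" "z = L zs" "snd ` set ys \<subseteq> carrier N" "snd ` set zs \<subseteq> carrier N"
      by (auto simp: J_def)
    then show "y + z \<in> J" unfolding J_def
      by (intro CollectI exI[of _ "ys @ zs"]) (auto simp: L_def)
  next
    fix v y assume "y \<in> J"
    then obtain ys where ys: "y = L ys" "snd ` set ys \<subseteq> carrier N" by (auto simp: J_def)
    have "v * y = L (map (\<lambda>(w, x). (v * w, x)) ys)" unfolding ys L_def
      by (induction ys) (auto simp: algebra_simps)
    moreover have "snd ` set (map (\<lambda>(w, x). (v * w, x)) ys) \<subseteq> carrier N" using ys by force
    ultimately show "v * y \<in> J" unfolding J_def by blast
  next
    show "F x \<in> J" unfolding J_def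
      by (intro CollectI exI[of _ "[(1, x)]"]) (use x in \<open>auto simp: L_def\<close>)
  qed (rule x)
  then obtain p xs where p: "p \<noteq> 0" "\<And>y. y \<in> J \<Longrightarrow> p dvd y" "p = L xs" "snd ` set xs \<subseteq> carrier N"
    by (auto simp: J_def)
  have "F y \<in> J" if "y \<in> carrier N" for y
    unfolding J_def by (intro CollectI exI[of _ "[(1, y)]"]) (use that in \<open>auto simp: L_def\<close>)
  then have "\<forall>y\<in>carrier N. \<exists>u. F y = p * u" using p(2) by (auto simp: dvd_def)
  then obtain q where q: "\<And>y. y \<in> carrier N \<Longrightarrow> F y = p * q y" by metis
  fix z assume z: "z \<in> ge con"
  have hom: "(\<lambda>y. z * w * q y) \<in> module_hom R N (self_module R)" for w
  proof (rule self_homI)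
    show "z * w * q y \<in> RS" for y
      using z ge_con_subset ge_mult_right[of z con "w * q y"] by (auto simp: mult.assoc)
    fix y y' assume y: "y \<in> carrier N" "y' \<in> carrier N"
    have "p * q (y \<oplus>\<^bsub>N\<^esub> y') = p * (q y + q y')"
      using q[OF y(1)] q[OF y(2)] q[OF N(1)[OF y]] self_hom_add[OF F y] by (simp add: algebra_simps)
    then have "q (y \<oplus>\<^bsub>N\<^esub> y') = q y + q y'" using p(1) mult_left_cancel by blast
    then show "z * w * q (y \<oplus>\<^bsub>N\<^esub> y') = z * w * q y + z * w * q y'"
      by (simp add: algebra_simps)
  next
    fix r y assume y: "r \<in> RS" "y \<in> carrier N"
    have "F (r \<odot>\<^bsub>N\<^esub> y) = r * F y" using self_hom_smult[OF F _ y(2), of r] y by simp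
    then have "p * q (r \<odot>\<^bsub>N\<^esub> y) = p * (r * q y)"
      unfolding q[OF y(2)] q[OF N(2)[OF y]] by (simp only: mult.left_commute)
    then have "q (r \<odot>\<^bsub>N\<^esub> y) = r * q y" using p(1) mult_left_cancel by blast
    then show "z * w * q (r \<odot>\<^bsub>N\<^esub> y) = r * (z * w * q y)"
      by (simp add: algebra_simps)
  qed
  have "(\<Sum>(w, x)\<leftarrow>ys. z * w * q x) \<in> trace_ideal R N \<and> p * (\<Sum>(w, x)\<leftarrow>ys. z * w * q x) = z * L ys"
    if "snd ` set ys \<subseteq> carrier N" for ys
    using that
  proof (induction ys)
    case (Cons wx ys)
    obtain w x where wx: "wx = (w, x)" by force
    have "z * w * q x \<in> trace_ideal R N" using in_trace[OF hom] Cons wx by simp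
    then show ?case using Cons wx I(3) q[of x] by (simp add: L_def algebra_simps)
  qed (use I(2) in \<open>auto simp: L_def\<close>)
  note * = this[OF p(4)]
  then have "p * (\<Sum>(w, x)\<leftarrow>xs. z * w * q x) = p * z" by (simp only: p(3) mult.commute)
  then have "(\<Sum>(w, x)\<leftarrow>xs. z * w * q x) = z" using p(1) mult_left_cancel by blast
  then show "z \<in> trace_ideal R N" using * by metis
qed

lemma syzygy_carrier:
  "v \<in> carrier (syzygy R M n g) \<longleftrightarrow> v \<in> {..<n} \<rightarrow>\<^sub>E RS \<and> lc M n g v = \<zero>\<^bsub>M\<^esub>"
  by (simp add: syzygy_def free_module_def lc_def)

lemma syzygy_ops:
  "v \<oplus>\<^bsub>syzygy R M n g\<^esub> w = (\<lambda>i\<in>{..<n}. v i + w i)" "r \<odot>\<^bsub>syzygy R M n g\<^esub> v = (\<lambda>i\<in>{..<n}. r * v i)"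
  by (simp_all add: syzygy_def free_module_def)

lemma syzygy_projection:
  "i < n \<Longrightarrow> (\<lambda>v. v i) \<in> module_hom R (syzygy R M n g) (self_module R)"
  by (rule self_homI) (auto simp: syzygy_ops syzygy_carrier)

context
  fixes M :: "('a, 'm) module" (structure) and n :: nat and g
  assumes mod: "Module.module R M" and g: "g ` {..<n} \<subseteq> carrier M"
begin

interpretation module R M by (rule mod)

lemma syzygy_add_closed:
  assumes "v \<in> carrier (syzygy R M n g)" "w \<in> carrier (syzygy R M n g)"
  shows "v \<oplus>\<^bsub>syzygy R M n g\<^esub> w \<in> carrier (syzygy R M n g)"
proof -
  have "lc M n g (\<lambda>i\<in>{..<n}. v i + w i) = lc M n g v \<oplus> lc M n g w"
    by (rule lc_add[OF mod g]) (use assms in \<open>auto simp: syzygy_carrier\<close>)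
  then show ?thesis using assms by (auto simp: syzygy_ops syzygy_carrier)
qed

lemma syzygy_smult_closed:
  assumes "r \<in> RS" "v \<in> carrier (syzygy R M n g)"
  shows "r \<odot>\<^bsub>syzygy R M n g\<^esub> v \<in> carrier (syzygy R M n g)"
proof -
  have "lc M n g (\<lambda>i\<in>{..<n}. r * v i) = r \<odot> lc M n g v"
    by (rule lc_smult[OF mod g]) (use assms in \<open>auto simp: syzygy_carrier\<close>)
  then show ?thesis using assms by (auto simp: syzygy_ops syzygy_carrier)
qed

lemma relation_in_trace_syzygy:
  assumes v: "v \<in> {..<n} \<rightarrow> RS" "lc M n g v = \<zero>" and i: "i < n"
  shows "v i \<in> trace_ideal R (syzygy R M n g)"
proof -
  have "lc M n g (restrict v {..<n}) = lc M n g v" by (rule lc_cong[OF mod g]) (use v in auto)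
  then have "restrict v {..<n} \<in> carrier (syzygy R M n g)" using v by (auto simp: syzygy_carrier)
  from in_trace[OF syzygy_projection[OF i] this] show ?thesis using i by simp
qed

lemma ge_con_subset_trace_syzygy:
  assumes v: "v \<in> {..<n} \<rightarrow> RS" "lc M n g v = \<zero>" and i: "i < n" "v i \<noteq> 0"
  shows "ge con \<subseteq> trace_ideal R (syzygy R M n g)"
proof (rule ge_con_subset_trace[OF syzygy_projection[OF i(1)]])
  have "lc M n g (restrict v {..<n}) = lc M n g v" by (rule lc_cong[OF mod g]) (use v in auto)
  then show "restrict v {..<n} \<in> carrier (syzygy R M n g)" using v by (auto simp: syzygy_carrier)
  show "restrict v {..<n} i \<noteq> 0" using i by simp
qed (use syzygy_add_closed syzygy_smult_closed in auto)

end

end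

section \<open>Semigroup rings of multiplicity two\<close>

context semigroup_ring
begin

definition even_part :: "'a set" where "even_part = {f. \<forall>n. cf f n \<noteq> 0 \<longrightarrow> even n}"

abbreviation "E \<equiv> even_part"

lemma E_0: "0 \<in> E" and E_1: "1 \<in> E" by (auto simp: even_part_def cf_1)

lemma E_add: "x \<in> E \<Longrightarrow> y \<in> E \<Longrightarrow> x + y \<in> E"
  unfolding even_part_def mem_Collect_eq cf_add by (metis add.left_neutral)

lemma E_uminus: "x \<in> E \<Longrightarrow> - x \<in> E"
  by (auto simp: even_part_def)

lemma E_diff: "x \<in> E \<Longrightarrow> y \<in> E \<Longrightarrow> x - y \<in> E"
  using E_add[of x "- y"] E_uminus by simp

lemma E_mult: assumes "x \<in> E" "y \<in> E" shows "x * y \<in> E"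
proof -
  have "even n" if "cf (x * y) n \<noteq> 0" for n
  proof -
    obtain i where i: "i \<le> n" "cf x i * cf y (n - i) \<noteq> 0"
      using \<open>cf (x * y) n \<noteq> 0\<close> unfolding cf_mult by (rule sum.not_neutral_contains_not_neutral) auto
    then have "even i" "even (n - i)" using assms by (auto simp: even_part_def)
    then show ?thesis using i(1) by (metis even_add le_add_diff_inverse)
  qed
  then show ?thesis by (simp add: even_part_def)
qed

lemma mon_in_E: "even s \<Longrightarrow> mon c s \<in> E" by (auto simp: even_part_def cf_mon)

lemma cring_E: "cring (subring_record E)"
  by (rule cring_subring_record) (auto intro: E_0 E_1 E_add E_mult E_uminus)

lemma E_factor:
  assumes "x \<in> E" "x \<in> ge s" "even s"
  obtains y where "y \<in> E" "x = mon 1 s * y" "\<And>i. cf y i = cf x (i + s)"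
proof -
  obtain y where y: "x = mon 1 s * y" "\<And>i. cf y i = cf x (i + s)" using ge_factor[OF assms(2)] by metis
  have "y \<in> E" using assms(1,3) unfolding even_part_def mem_Collect_eq y(2) by (metis even_add)
  then show ?thesis using that y by blast
qed

end

text \<open>Below the conductor number \<open>G\<close> consists of the even numbers, and \<open>con\<close> itself is even. So \<open>R\<close> is
free over its even elements with basis \<open>1\<close> and \<open>y0\<close>, the power of \<open>t\<close> with the least odd exponent
in \<open>G\<close>.\<close>

locale multiplicity_two = semigroup_ring +
  assumes two: "2 \<in> G" and one: "1 \<notin> G"
begin

lemma even_in_G: "even n \<Longrightarrow> n \<in> G"
proof (induction n rule: less_induct)
  case (less n)
  show ?case
  proof (cases "n = 0")
    case False
    then have "n - 2 \<in> G" using less by (intro less.IH) auto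
    from add_in_G[OF this two] False less.prems show ?thesis by (cases n rule: nat.exhaust) (auto elim!: evenE)
  qed simp
qed

lemma con_pos: "con > 0" using con_in_G[of 1] one by (cases con) auto

lemma con_even: "even con"
  using con_least[OF con_pos] even_in_G[of "con - 1"] con_pos by auto

lemma odd_in_G: assumes "odd n" "n \<in> G" shows "n \<ge> con"
proof (rule ccontr)
  assume "\<not> n \<ge> con"
  then have "con - 1 = n + (con - 1 - n)" "even (con - 1 - n)" using con_even con_pos assms(1) by auto
  then have "con - 1 \<in> G" using add_in_G[OF assms(2) even_in_G] by metis
  then show False using con_least con_pos by simp
qed

lemma con_ge_2: "con \<ge> 2" using con_even con_pos by (auto elim!: evenE)

lemma E_subset: "E \<subseteq> RS" by (auto simp: even_part_def RS_def intro: even_in_G)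

abbreviation y0 :: 'a where "y0 \<equiv> mon 1 (Suc con)"

lemma y0_in_RS: "y0 \<in> RS" by (intro mon_in_RS con_in_G) simp

lemma y0_square: "y0 * y0 \<in> E" by (simp add: mon_mult mon_in_E)

lemma RS_decompose:
  assumes "r \<in> RS" obtains a b where "a \<in> E" "b \<in> E" "r = a + y0 * b" "\<And>i. even i \<Longrightarrow> cf a i = cf r i"
proof -
  define a where "a = restr {n. even n} r"
  have cfa: "cf a i = (if even i then cf r i else 0)" for i by (simp add: a_def)
  have "cf (r - a) i = 0" if "i < Suc con" for i
    using that assms odd_in_G[of i] con_even by (cases "i = con") (auto simp: cfa RS_def)
  then have "r - a \<in> ge (Suc con)" by (simp add: ge_def)
  then obtain b where b: "r - a = y0 * b" "\<And>i. cf b i = cf (r - a) (i + Suc con)"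
    using ge_factor by metis
  have "b \<in> E" using con_even by (auto simp: even_part_def b(2) cfa)
  moreover have "a \<in> E" by (auto simp: even_part_def cfa)
  moreover have "r = a + y0 * b" using b(1) by (metis add.commute diff_add_cancel)
  ultimately show ?thesis using that[of a b] cfa by metis
qed

context
  fixes M :: "('a, 'm) module" (structure)
  assumes mod: "Module.module R M" and tf: "torsion_free R M"
begin

interpretation module R M by (rule mod)
interpretation EM: module "subring_record E" M
  by (rule module_restrict_scalars[OF mod cring_E E_subset])

lemma E_submodule_is_R_submodule:
  assumes N: "LinearCombinations.submodule (subring_record E) N M"
    and y: "\<And>x. x \<in> N \<Longrightarrow> y0 \<odot> x \<in> N"
  shows "LinearCombinations.submodule R N M"
proof -
  interpret N: submodule "subring_record E" N M by (rule N)
  show ?thesis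
  proof (unfold_locales, goal_cases)
    case (4 r x)
    then obtain a b where ab: "a \<in> E" "b \<in> E" "r = a + y0 * b"
      using RS_decompose[of r] by (metis subring_record_simps(1))
    have x: "x \<in> carrier M" using 4 N.subset by auto
    have "r \<odot> x = a \<odot> x \<oplus> y0 \<odot> (b \<odot> x)"
      using ab E_subset y0_in_RS x smult_l_distr[of a "y0 * b" x] smult_assoc1[of y0 b x]
      by (auto simp: subset_iff)
    also have "\<dots> \<in> N" using 4 ab y by auto
    finally show ?case .
  qed (use N.subset in auto)
qed

lemma span_E_closed:
  assumes B: "B \<subseteq> carrier M"
  shows "LinearCombinations.submodule (subring_record E) (EM.span B) M"
  by (rule EM.span_is_submodule[OF B])

text \<open>\<open>B\<close> generates the localisation of \<open>M\<close> at \<open>t\<close> over the even elements. In the complete case \<open>p\<close> is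
a unit; in the graded case it stands for the denominators of the localisation.\<close>

definition almost_gen :: "'m set \<Rightarrow> bool" where
  "almost_gen B \<longleftrightarrow> finite B \<and> B \<subseteq> carrier M \<and>
     (\<exists>p\<in>E. cf p 0 \<noteq> 0 \<and> (\<forall>x\<in>carrier M. p \<odot> x \<in> EM.span B))"

lemma almost_gen_ex:
  assumes "finitely_generated R M" shows "\<exists>B. almost_gen B"
proof -
  obtain X where X: "finite X" "X \<subseteq> carrier M" "span X = carrier M"
    using assms by (auto simp: finitely_generated_def)
  define B where "B = X \<union> (\<lambda>x. y0 \<odot> x) ` X"
  have B: "finite B" "B \<subseteq> carrier M" using X y0_in_RS by (auto simp: B_def)
  interpret S: submodule "subring_record E" "EM.span B" M by (rule span_E_closed[OF B(2)])
  have inB: "B \<subseteq> EM.span B" by (rule EM.in_own_span[OF B(2)])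
  define N where "N = {z \<in> carrier M. z \<in> EM.span B \<and> y0 \<odot> z \<in> EM.span B}"
  have "submodule R N M"
  proof (rule E_submodule_is_R_submodule)
    show "submodule (subring_record E) N M"
    proof (unfold_locales, goal_cases)
      case 1 show ?case by (auto simp: N_def)
    next
      case (2 x z) then show ?case using y0_in_RS by (auto simp: N_def smult_r_distr)
    next
      case 3 show ?case using y0_in_RS by (auto simp: N_def)
    next
      case (4 c x)
      then have c: "c \<in> RS" "x \<in> carrier M" using E_subset by (auto simp: N_def)
      have "y0 \<odot> (c \<odot> x) = c \<odot> (y0 \<odot> x)"
        using c y0_in_RS smult_assoc1[of y0 c x] smult_assoc1[of c y0 x] by (simp add: mult.commute)
      then show ?case using 4 c by (auto simp: N_def)
    qed
    show "y0 \<odot> x \<in> N" if "x \<in> N" for x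
    proof -
      have "y0 \<odot> (y0 \<odot> x) = (y0 * y0) \<odot> x"
        using that y0_in_RS smult_assoc1[of y0 y0 x] by (simp add: N_def)
      also have "\<dots> \<in> EM.span B" using that y0_square by (intro S.smult_closed) (auto simp: N_def)
      finally show ?thesis using that y0_in_RS by (auto simp: N_def)
    qed
  qed
  moreover have "X \<subseteq> N" using X inB by (auto simp: N_def B_def)
  ultimately have "carrier M \<subseteq> N" using span_is_subset X(3) by blast
  then have "almost_gen B" unfolding almost_gen_def
    using B E_1 by (intro conjI bexI[of _ 1]) (auto simp: N_def cf_1)
  then show ?thesis ..
qed

lemma mon_smult_cancel:
  assumes "x \<in> carrier M" "mon 1 s \<odot> x = \<zero>" "s \<in> G" shows "x = \<zero>"
  using tf assms mon_in_RS[OF assms(3), of 1] by (auto simp: torsion_free_def)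

text \<open>A relation can be divided by the highest power of \<open>t\<close> dividing all its coefficients, because
\<open>M\<close> is torsion-free. Then some coefficient has a nonzero constant term, and the corresponding
element of \<open>B\<close> can be dropped at the price of a larger denominator.\<close>

lemma minimal_almost_gen_indpt:
  assumes B: "almost_gen B" and min: "\<And>C. almost_gen C \<Longrightarrow> card B \<le> card C"
  shows "EM.lin_indpt B"
proof (rule EM.finite_lin_indpt2)
  show fin: "finite B" and BM: "B \<subseteq> carrier M" using B by (auto simp: almost_gen_def)
  obtain p where p: "p \<in> E" "cf p 0 \<noteq> 0" "\<And>x. x \<in> carrier M \<Longrightarrow> p \<odot> x \<in> EM.span B"
    using B by (auto simp: almost_gen_def)
  fix a assume a: "a \<in> B \<rightarrow> carrier (subring_record E)" "EM.lincomb a B = \<zero>"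
  show "\<forall>v\<in>B. a v = \<zero>\<^bsub>subring_record E\<^esub>"
  proof (rule ccontr)
    assume "\<not> ?thesis"
    then obtain v where v: "v \<in> B" "a v \<noteq> 0" by auto
    define Q where "Q = (\<lambda>d. \<exists>w\<in>B. cf (a w) d \<noteq> 0)"
    define d where "d = (LEAST d. Q d)"
    obtain d' where "cf (a v) d' \<noteq> 0" using order_ex[OF v(2)] by blast
    then have Qd: "Q d" unfolding d_def using v(1) by (intro LeastI[of Q d']) (auto simp: Q_def)
    then obtain w0 where w0: "w0 \<in> B" "cf (a w0) d \<noteq> 0" by (auto simp: Q_def)
    have ged: "a w \<in> ge d" if "w \<in> B" for w
      using not_less_Least[of _ Q] that unfolding ge_def d_def Q_def by blast
    have aE: "w \<in> B \<Longrightarrow> a w \<in> E" for w using a(1) by auto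
    have ev: "even d" using aE[OF w0(1)] w0(2) by (auto simp: even_part_def)
    have "\<forall>w\<in>B. \<exists>b. b \<in> E \<and> a w = mon 1 d * b \<and> cf b 0 = cf (a w) d"
    proof
      fix w assume "w \<in> B"
      from E_factor[OF aE[OF this] ged[OF this] ev]
      show "\<exists>b. b \<in> E \<and> a w = mon 1 d * b \<and> cf b 0 = cf (a w) d" by (metis add_0)
    qed
    then obtain b where b: "\<And>w. w \<in> B \<Longrightarrow> b w \<in> E" "\<And>w. w \<in> B \<Longrightarrow> a w = mon 1 d * b w"
      "\<And>w. w \<in> B \<Longrightarrow> cf (b w) 0 = cf (a w) d" by metis
    have bP: "b \<in> B \<rightarrow> carrier (subring_record E)" using b(1) by auto
    have mE: "mon 1 d \<in> carrier (subring_record E)" using ev by (simp add: mon_in_E)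
    have "mon 1 d \<odot> EM.lincomb b B = EM.lincomb (\<lambda>w. mon 1 d * b w) B"
      using EM.lincomb_smult[OF BM bP mE] by simp
    also have "\<dots> = EM.lincomb a B"
      by (rule EM.lincomb_cong) (use BM a b in auto)
    finally have bz: "EM.lincomb b B = \<zero>"
      using a(2) mon_smult_cancel EM.lincomb_closed[OF BM bP] even_in_G[OF ev] by simp
    define C where "C = B - {w0}"
    have C: "finite C" "C \<subseteq> carrier M" using fin BM by (auto simp: C_def)
    interpret S: submodule "subring_record E" "EM.span C" M by (rule span_E_closed[OF C(2)])
    have linC: "EM.lincomb c C \<in> EM.span C" if "c \<in> B \<rightarrow> E" for c
      unfolding EM.span_def using that C by (auto simp: C_def)
    have w0M: "w0 \<in> carrier M" using w0 BM by auto
    have "b w0 \<odot> w0 \<oplus> EM.lincomb b C = \<zero>"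
      using EM.lincomb_del2[OF fin BM bP w0(1)] bz by (simp add: C_def)
    then have "b w0 \<odot> w0 = \<ominus> EM.lincomb b C"
      using linC[of b] S.subset bP w0M b(1)[OF w0(1)]
      by (intro M.minus_equality[symmetric]) auto
    then have w0C: "b w0 \<odot> w0 \<in> EM.span C"
      using submodule_uminus[OF S.submodule_axioms] linC[of b] bP by simp
    have "(b w0 * p) \<odot> x \<in> EM.span C" if x: "x \<in> carrier M" for x
    proof -
      obtain c where c: "c \<in> B \<rightarrow> carrier (subring_record E)" "EM.lincomb c B = p \<odot> x"
        using EM.finite_in_span[OF fin BM p(3)[OF x]] by blast
      have cw: "c w0 \<in> E" "b w0 \<in> E" using c(1) w0(1) b(1) by auto
      have lC: "EM.lincomb c C \<in> EM.span C" using linC c(1) by simp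
      have lCM: "EM.lincomb c C \<in> carrier M" using lC S.subset by auto
      have "(b w0 * p) \<odot> x = b w0 \<odot> (p \<odot> x)"
        using EM.smult_assoc1[of "b w0" p x] cw p(1) x by simp
      also have "p \<odot> x = c w0 \<odot> w0 \<oplus> EM.lincomb c C"
        using EM.lincomb_del2[OF fin BM c(1) w0(1)] c(2) by (simp add: C_def)
      also have "b w0 \<odot> \<dots> = c w0 \<odot> (b w0 \<odot> w0) \<oplus> b w0 \<odot> EM.lincomb c C"
        using cw w0M lCM EM.smult_assoc1[of "b w0" "c w0" w0] EM.smult_assoc1[of "c w0" "b w0" w0]
        by (simp add: EM.smult_r_distr mult.commute)
      also have "\<dots> \<in> EM.span C" using cw lC w0C by auto
      finally show ?thesis .
    qed
    moreover have "b w0 * p \<in> E" using b(1) w0(1) p(1) E_mult by auto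
    moreover have "cf (b w0 * p) 0 \<noteq> 0" using b(3)[OF w0(1)] w0(2) p(2) by (simp add: cf_mult)
    \<comment> \<open>Without \<open>w0\<close> the denominator becomes \<open>b w0 * p\<close>.\<close>
    ultimately have "almost_gen C" unfolding almost_gen_def using C by blast
    from min[OF this] show False using card_Suc_Diff1[OF fin w0(1)] by (simp add: C_def)
  qed
qed

text \<open>A coordinate \<open>h\<close> with respect to an independent almost generating set extends to the \<open>R\<close>-linear
map that sends \<open>x\<close> to \<open>h (y0 x) + y0 (h x)\<close>. Its values have constant term zero only if \<open>h (y0 x)\<close>
is divisible by \<open>t\<^sup>2\<close>; and if this holds for all coordinates, then \<open>y0 x\<close> is divisible by \<open>t\<^sup>2\<close>.\<close>

lemma y0_smult_divisible:
  assumes fg: "finitely_generated R M"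
    and homs: "\<And>f x. f \<in> module_hom R M (self_module R) \<Longrightarrow> x \<in> carrier M \<Longrightarrow> f x \<in> mm"
    and x: "x \<in> carrier M"
  shows "\<exists>z\<in>carrier M. y0 \<odot> x = mon 1 2 \<odot> z"
proof -
  obtain B where B: "almost_gen B" "\<And>C. almost_gen C \<Longrightarrow> card B \<le> card C"
    using almost_gen_ex[OF fg] ex_has_least_nat[of almost_gen _ card] by metis
  have li: "EM.lin_indpt B" by (rule minimal_almost_gen_indpt[OF B])
  have fin: "finite B" and BM: "B \<subseteq> carrier M" using B(1) by (auto simp: almost_gen_def)
  obtain p where p: "p \<in> E" "cf p 0 \<noteq> 0" "\<And>x. x \<in> carrier M \<Longrightarrow> p \<odot> x \<in> EM.span B"
    using B(1) by (auto simp: almost_gen_def)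
  have ER: "c \<in> E \<Longrightarrow> c \<in> RS" for c using E_subset by auto
  have "\<forall>x\<in>carrier M. \<exists>c. c \<in> B \<rightarrow> E \<and> EM.lincomb c B = p \<odot> x"
    using EM.finite_in_span[OF fin BM p(3)] by simp
  then obtain h where h: "\<And>x. x \<in> carrier M \<Longrightarrow> h x \<in> B \<rightarrow> E"
    "\<And>x. x \<in> carrier M \<Longrightarrow> EM.lincomb (h x) B = p \<odot> x" by metis
  have uniq: "c v = c' v"
    if c: "c \<in> B \<rightarrow> E" "c' \<in> B \<rightarrow> E" "EM.lincomb c B = EM.lincomb c' B" and v: "v \<in> B" for c c' v
  proof (rule ccontr)
    assume ne: "c v \<noteq> c' v"
    let ?d = "\<lambda>v. c v \<oplus>\<^bsub>subring_record E\<^esub> (- 1) \<otimes>\<^bsub>subring_record E\<^esub> c' v"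
    have m1: "- 1 \<in> E" using E_uminus[OF E_1] .
    have c2: "EM.lincomb (\<lambda>v. (- 1) \<otimes>\<^bsub>subring_record E\<^esub> c' v) B = (- 1) \<odot> EM.lincomb c' B"
      using EM.lincomb_smult[OF BM, of c' "- 1"] c m1 by simp
    have lc': "EM.lincomb c' B \<in> carrier M" using EM.lincomb_closed[OF BM] c by simp
    have "EM.lincomb ?d B = EM.lincomb c B \<oplus> EM.lincomb (\<lambda>v. (- 1) \<otimes>\<^bsub>subring_record E\<^esub> c' v) B"
      by (rule EM.lincomb_sum[OF fin BM]) (use c m1 E_mult in \<open>auto simp: Pi_iff intro: E_uminus\<close>)
    also have "\<dots> = \<zero>"
      unfolding c2 c(3) using smult_minus_1[OF lc'] lc' by (simp add: M.r_neg)
    finally have "EM.lin_dep B"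
      by (intro EM.lin_dep_crit[OF fin subset_refl, of ?d v])
        (use c v ne in \<open>auto simp: Pi_iff intro!: E_diff\<close>)
    with li show False by simp
  qed
  have h_add: "h (x \<oplus> z) v = h x v + h z v" if "x \<in> carrier M" "z \<in> carrier M" "v \<in> B" for x z v
  proof (rule uniq[of _ "\<lambda>v. h x v + h z v"])
    have "EM.lincomb (\<lambda>v. h x v \<oplus>\<^bsub>subring_record E\<^esub> h z v) B = p \<odot> x \<oplus> p \<odot> z"
      using EM.lincomb_sum[OF fin BM, of "h x" "h z"] h that by simp
    then show "EM.lincomb (h (x \<oplus> z)) B = EM.lincomb (\<lambda>v. h x v + h z v) B"
      using h that ER[OF p(1)] by (simp add: smult_r_distr)
  qed (use h that in \<open>auto simp: Pi_iff intro!: E_add\<close>)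
  have h_smult: "h (c \<odot> x) v = c * h x v" if "c \<in> E" "x \<in> carrier M" "v \<in> B" for c x v
  proof (rule uniq[of _ "\<lambda>v. c * h x v"])
    have "EM.lincomb (\<lambda>v. c \<otimes>\<^bsub>subring_record E\<^esub> h x v) B = c \<odot> (p \<odot> x)"
      using EM.lincomb_smult[OF BM, of "h x" c] h that by simp
    also have "\<dots> = p \<odot> (c \<odot> x)"
      using EM.smult_assoc1[of c p x] EM.smult_assoc1[of p c x] that p(1) by (simp add: mult.commute)
    finally show "EM.lincomb (h (c \<odot> x)) B = EM.lincomb (\<lambda>v. c * h x v) B"
      using h that ER by simp
  qed (use h[of x] h[of "c \<odot> x"] that ER in \<open>auto simp: Pi_iff intro!: E_mult\<close>)
  \<comment> \<open>The \<open>R\<close>-linear map obtained from the coordinate at \<open>v\<close>.\<close>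
  define f where "f = (\<lambda>v x. h (y0 \<odot> x) v + y0 * h x v)"
  have yc: "y0 \<odot> x \<in> carrier M" if "x \<in> carrier M" for x using that y0_in_RS by simp
  have hE: "h x v \<in> E" if "x \<in> carrier M" "v \<in> B" for x v using h(1)[OF that(1)] that(2) by auto
  have y_swap: "y0 \<odot> (c \<odot> x) = c \<odot> (y0 \<odot> x)" if "c \<in> RS" "x \<in> carrier M" for c x
    using that y0_in_RS smult_assoc1[of y0 c x] smult_assoc1[of c y0 x] by (simp add: mult.commute)
  have y_y: "y0 \<odot> (y0 \<odot> x) = (y0 * y0) \<odot> x" if "x \<in> carrier M" for x
    using that y0_in_RS smult_assoc1[of y0 y0 x] by simp
  have f_hom: "f v \<in> module_hom R M (self_module R)" if v: "v \<in> B" for v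
  proof (rule self_homI)
    fix x assume x: "x \<in> carrier M"
    show "f v x \<in> RS" unfolding f_def using hE[OF _ v] x yc ER y0_in_RS by (intro RS_add RS_mult) auto
    fix z assume z: "z \<in> carrier M"
    show "f v (x \<oplus> z) = f v x + f v z"
      using x z v yc y0_in_RS by (simp add: f_def h_add smult_r_distr algebra_simps)
  next
    fix r x assume r: "r \<in> RS" and x: "x \<in> carrier M"
    obtain a b where ab: "a \<in> E" "b \<in> E" "r = a + y0 * b" using RS_decompose[OF r] by metis
    have fE: "f v (c \<odot> z) = c * f v z" if "c \<in> E" "z \<in> carrier M" for c z
      using that v yc ER by (simp add: f_def y_swap h_smult algebra_simps)
    have fy: "f v (y0 \<odot> z) = y0 * f v z" if "z \<in> carrier M" for z
      using that v yc y0_square by (simp add: f_def y_y h_smult algebra_simps)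
    have bx: "b \<odot> x \<in> carrier M" "a \<odot> x \<in> carrier M" using ab ER x by auto
    have "r \<odot> x = a \<odot> x \<oplus> y0 \<odot> (b \<odot> x)"
      using ab ER y0_in_RS x smult_l_distr[of a "y0 * b" x] smult_assoc1[of y0 b x]
        RS_mult[OF y0_in_RS ER[OF ab(2)]] by simp
    moreover have "f v (a \<odot> x \<oplus> y0 \<odot> (b \<odot> x))
        = f v (a \<odot> x) + f v (y0 \<odot> (b \<odot> x))"
      using bx v yc y0_in_RS by (simp add: f_def h_add smult_r_distr algebra_simps)
    ultimately show "f v (r \<odot> x) = r * f v x"
      using fE[OF ab(1) x] fE[OF ab(2) x] fy[OF bx(1)] ab(3) by (simp add: algebra_simps)
  qed
  have low: "\<exists>k. k \<in> E \<and> h (y0 \<odot> x) v = mon 1 2 * k" if v: "v \<in> B" for v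
  proof -
    have "cf (f v x) 0 = 0" using homs[OF f_hom[OF v] x] by (simp add: mm_def)
    then have "cf (h (y0 \<odot> x) v) 0 = 0" by (simp add: f_def cf_mon_mult)
    moreover have "cf (h (y0 \<odot> x) v) 1 = 0"
      using hE[OF yc[OF x] v] by (auto simp: even_part_def)
    ultimately have "h (y0 \<odot> x) v \<in> ge 2" by (auto simp: ge_def less_2_cases_iff)
    from E_factor[OF hE[OF yc[OF x] v] this] show ?thesis by (metis even_numeral)
  qed
  then obtain k where k: "\<And>v. v \<in> B \<Longrightarrow> k v \<in> E" "\<And>v. v \<in> B \<Longrightarrow> h (y0 \<odot> x) v = mon 1 2 * k v"
    by metis
  have kP: "k \<in> B \<rightarrow> carrier (subring_record E)" using k by auto
  have m2: "mon 1 2 \<in> E" by (simp add: mon_in_E)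
  define u where "u = EM.lincomb k B"
  have u: "u \<in> carrier M" unfolding u_def by (rule EM.lincomb_closed[OF BM kP])
  have pyx: "p \<odot> (y0 \<odot> x) = mon 1 2 \<odot> u"
  proof -
    have "EM.lincomb (h (y0 \<odot> x)) B = EM.lincomb (\<lambda>v. mon 1 2 * k v) B"
      by (rule EM.lincomb_cong[OF refl BM]) (use k m2 E_mult in auto)
    also have "\<dots> = mon 1 2 \<odot> u" using EM.lincomb_smult[OF BM kP, of "mon 1 2"] m2 by (simp add: u_def)
    finally show ?thesis using h(2)[OF yc[OF x]] by simp
  qed
  define c where "c = cf p 0"
  have "p - mon c 0 \<in> E" using p(1) mon_in_E[of 0 c] E_add[OF p(1) E_uminus[of "mon c 0"]] by simp
  moreover have "p - mon c 0 \<in> ge 2" 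
    using p(1) by (auto simp: ge_def less_2_cases_iff c_def cf_mon even_part_def)
  ultimately obtain q where q: "q \<in> E" "p - mon c 0 = mon 1 2 * q" by (rule E_factor) auto
  define w where "w = y0 \<odot> x"
  have w: "w \<in> carrier M" unfolding w_def by (rule yc[OF x])
  let ?i = "mon (1 / c) 0"
  have iR: "?i \<in> RS" "mon 1 2 \<in> RS" "q \<in> RS" "p \<in> RS" "mon c 0 \<in> RS"
    using m2 q(1) p(1) ER by (auto intro: mon_in_RS)
  have pe: "p = mon c 0 + mon 1 2 * q" using q(2) by (metis add.commute diff_add_cancel)
  have ic: "?i * mon c 0 = 1" using p(2) mon_mult[of "1/c" 0 c 0] by (simp add: c_def mon_1_0)
  have "?i * p = ?i * mon c 0 + mon 1 2 * (?i * q)"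
    using arg_cong[OF pe, of "\<lambda>z. ?i * z"] by (simp only: distrib_left mult.left_commute)
  then have "1 = ?i * p + mon 1 2 * (- (?i * q))" unfolding ic by simp
  then have "w = (?i * p + mon 1 2 * (- (?i * q))) \<odot> w" using w smult_one by simp
  also have "\<dots> = (?i * p) \<odot> w \<oplus> (mon 1 2 * (- (?i * q))) \<odot> w"
    using smult_l_distr[of "?i * p" "mon 1 2 * (- (?i * q))" w] w iR by (simp add: RS_mult RS_uminus)
  also have "(mon 1 2 * (- (?i * q))) \<odot> w = mon 1 2 \<odot> ((- (?i * q)) \<odot> w)"
    using smult_assoc1[of "mon 1 2" "- (?i * q)" w] w iR by (simp add: RS_mult RS_uminus)
  also have "(?i * p) \<odot> w = ?i \<odot> (mon 1 2 \<odot> u)"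
    using smult_assoc1[of ?i p w] w iR pyx by (simp add: w_def)
  also have "\<dots> = mon 1 2 \<odot> (?i \<odot> u)"
    using smult_assoc1[of ?i "mon 1 2" u] smult_assoc1[of "mon 1 2" ?i u] u iR by (simp add: mult.commute)
  also have "\<dots> \<oplus> mon 1 2 \<odot> ((- (?i * q)) \<odot> w)
      = mon 1 2 \<odot> (?i \<odot> u \<oplus> (- (?i * q)) \<odot> w)"
    using u w iR by (intro smult_r_distr[symmetric]) (auto intro!: smult_closed RS_uminus RS_mult)
  finally show ?thesis unfolding w_def[symmetric]
    using u w iR by (intro bexI[of _ "?i \<odot> u \<oplus> (- (?i * q)) \<odot> w"])
      (auto intro!: smult_closed RS_uminus RS_mult)
qed

end

end

context multiplicity_two
begin

text \<open>As long as the order of \<open>x\<close> is less than \<open>con\<close> it is even, so a multiple of \<open>u\<close> by a power of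
\<open>t\<^sup>2\<close> cancels the lowest term of \<open>x\<close>.\<close>

lemma ge_subset_ideal:
  assumes I: "ideal I R" and con: "ge con \<subseteq> I"
    and u: "u \<in> I" "u \<in> ge m" "cf u m \<noteq> 0" "even m" and x: "x \<in> RS" "x \<in> ge m"
  shows "x \<in> I"
proof -
  note I = ideal_subring_recordD[OF I]
  have "x \<in> I" if "x \<in> RS" "x \<in> ge l" "m \<le> l" for x l
    using that
  proof (induction "con - l" arbitrary: l x)
    case 0
    then show ?case using con ge_mono[of con l] by auto
  next
    case (Suc k)
    define d where "d = mon (cf x l / cf u m) (l - m)"
    have ev: "even (l - m) \<or> cf x l = 0"
    proof (cases "cf x l = 0")
      case False
      then have "l \<in> G" using Suc.prems(1) by (simp add: RS_def)
      then have "even l" using odd_in_G[of l] Suc.hyps(2) by linarith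
      then show ?thesis using u(4) Suc.prems(3) by simp
    qed simp
    then have dR: "d \<in> RS" unfolding d_def by (cases "cf x l = 0") (auto intro!: mon_in_RS even_in_G)
    have "d \<in> ge (l - m)" using mon_mult_in_ge[of _ "l - m" 1] by (simp add: d_def)
    then have du: "d * u \<in> ge l" "cf (d * u) l = cf x l"
      using ge_mult[of d "l - m" u m] cf_mult_lowest[of d "l - m" u m] u Suc.prems(3)
      by (auto simp: d_def cf_mon)
    have duR: "d * u \<in> I" using I(4) dR u(1) by auto
    have "x - d * u \<in> I"
    proof (rule Suc.hyps(1))
      show "k = con - Suc l" using Suc.hyps(2) by simp
      show "x - d * u \<in> ge (Suc l)" unfolding ge_Suc using du Suc.prems ge_diff by auto
    qed (use Suc.prems duR I(1) in auto)
    then show ?case using I(3)[OF _ duR] by (metis diff_add_cancel)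
  qed
  then show ?thesis using x by blast
qed

context
  fixes M :: "('a, 'm) module" (structure)
  assumes mod: "Module.module R M" and tf: "torsion_free R M"
begin

interpretation module R M by (rule mod)

text \<open>\<open>y0 M \<subseteq> t^(2i) M\<close>. The largest such \<open>i\<close> controls the traces of both \<open>M\<close> and its syzygy.\<close>

definition dvd_level :: "nat \<Rightarrow> bool" where
  "dvd_level i \<longleftrightarrow> (\<forall>x\<in>carrier M. \<exists>z\<in>carrier M. y0 \<odot> x = mon 1 (2 * i) \<odot> z)"

lemma mon_swap: "s \<in> G \<Longrightarrow> c \<in> RS \<Longrightarrow> x \<in> carrier M \<Longrightarrow>
    c \<odot> (mon 1 s \<odot> x) = mon 1 s \<odot> (c \<odot> x)"
  using smult_assoc1[of c "mon 1 s" x] smult_assoc1[of "mon 1 s" c x] mon_in_RS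
  by (simp add: mult.commute)

text \<open>In \<open>y0 f(x) = t^(2i) f(z)\<close>, an order of \<open>f(x)\<close> below \<open>2 i\<close> would give \<open>f(z)\<close> an odd order below
\<open>con\<close>.\<close>

lemma hom_in_ge:
  assumes D: "dvd_level i" and i: "2 * i \<le> con"
    and f: "f \<in> module_hom R M (self_module R)" and x: "x \<in> carrier M"
  shows "f x \<in> ge (2 * i)"
proof (cases "f x = 0")
  case False
  then obtain m where m: "f x \<in> ge m" "cf (f x) m \<noteq> 0" by (rule order_ex)
  obtain z where z: "z \<in> carrier M" "y0 \<odot> x = mon 1 (2 * i) \<odot> z"
    using D x by (auto simp: dvd_level_def)
  have i2: "mon 1 (2 * i) \<in> RS" by (intro mon_in_RS even_in_G) simp
  have "y0 * f x = mon 1 (2 * i) * f z"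
    using arg_cong[OF z(2), of f] self_hom_smult[OF f] x z(1) i2 y0_in_RS by simp
  then have eq: "cf (y0 * f x) (Suc con + m) = cf (mon 1 (2 * i) * f z) (Suc con + m)" by simp
  have "m \<ge> 2 * i"
  proof (rule ccontr)
    assume less: "\<not> m \<ge> 2 * i"
    have fR: "f x \<in> RS" "f z \<in> RS" using self_hom_closed[OF f] x z by auto
    have "m \<in> G" using m(2) fR by (auto simp: RS_def)
    then have ev: "even m" using odd_in_G[of m] less i by linarith
    have "cf (f z) (Suc con + m - 2 * i) \<noteq> 0" using eq m(2) i by (simp add: cf_mon_mult split: if_splits)
    then have inG: "Suc con + m - 2 * i \<in> G" using fR by (auto simp: RS_def)
    have "odd (Suc con + m - 2 * i)" using ev con_even less i by simp
    from odd_in_G[OF this inG] less i have "Suc m = 2 * i" by linarith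
    then show False using ev by presburger
  qed
  then show ?thesis using m(1) ge_mono by blast
qed simp

text \<open>Otherwise \<open>y0 M \<subseteq> t^(2i) \<mm>M\<close>. Level one gives \<open>\<mm>M \<subseteq> t\<^sup>2M\<close>, since \<open>\<mm>\<close> is generated by \<open>t\<^sup>2\<close> and
\<open>y0\<close>, and the next level would follow.\<close>

lemma not_dvd_level_Suc:
  assumes g: "generates R M n g" and D1: "dvd_level 1" and D: "dvd_level i" and nD: "\<not> dvd_level (Suc i)"
  shows "\<exists>a<n. \<exists>r\<in>{..<n} \<rightarrow> RS. y0 \<odot> g a = mon 1 (2 * i) \<odot> lc M n g r \<and> (\<exists>b<n. r b \<notin> mm)"
proof (rule ccontr)
  assume contra: "\<not> ?thesis"
  note gen = generatesD[OF mod g]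
  let ?W = "ideal_times_module R mm M"
  interpret W: submodule R ?W M by (rule submodule_mM[OF mod])
  have i2: "mon 1 (2 * i) \<in> RS" "mon 1 2 \<in> RS" "2 * i \<in> G" by (auto intro!: mon_in_RS even_in_G two)
  define N where "N = {x \<in> carrier M. \<exists>z\<in>?W. y0 \<odot> x = mon 1 (2 * i) \<odot> z}"
  have WM: "z \<in> ?W \<Longrightarrow> z \<in> carrier M" for z using W.subset by auto
  have "submodule R N M"
  proof (unfold_locales, goal_cases)
    case 1 show ?case by (auto simp: N_def)
  next
    case (2 x x')
    then obtain z z' where z: "z \<in> ?W" "z' \<in> ?W" "y0 \<odot> x = mon 1 (2 * i) \<odot> z"
      "y0 \<odot> x' = mon 1 (2 * i) \<odot> z'" by (auto simp: N_def)
    have "y0 \<odot> (x \<oplus> x') = mon 1 (2 * i) \<odot> (z \<oplus> z')"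
      using 2 z WM i2 y0_in_RS by (simp add: N_def smult_r_distr)
    then show ?case using 2 z by (auto simp: N_def)
  next
    case 3 show ?case using y0_in_RS i2 W.zero_closed
      by (auto simp: N_def intro!: bexI[of _ "\<zero>"])
  next
    case (4 c x)
    then obtain z where z: "z \<in> ?W" "y0 \<odot> x = mon 1 (2 * i) \<odot> z" by (auto simp: N_def)
    have xc: "x \<in> carrier M" "c \<in> RS" using 4 by (auto simp: N_def)
    have "y0 \<odot> (c \<odot> x) = c \<odot> (mon 1 (2 * i) \<odot> z)"
      unfolding z(2)[symmetric] using xc mon_swap[of "Suc con" c x] con_in_G by simp
    also have "\<dots> = mon 1 (2 * i) \<odot> (c \<odot> z)"
      using mon_swap[OF i2(3) xc(2) WM[OF z(1)]] .
    finally show ?case using xc z W.smult_closed[of c z] by (auto simp: N_def)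
  qed
  moreover have "g ` {..<n} \<subseteq> N"
  proof
    fix x assume "x \<in> g ` {..<n}"
    then obtain a where a: "a < n" "x = g a" by auto
    have ga: "g a \<in> carrier M" using gen(1) a by auto
    obtain z where z: "z \<in> carrier M" "y0 \<odot> g a = mon 1 (2 * i) \<odot> z"
      using D ga by (auto simp: dvd_level_def)
    obtain r where r: "r \<in> {..<n} \<rightarrow> RS" "z = lc M n g r" using gen(2)[OF z(1)] by blast
    have "r \<in> {..<n} \<rightarrow> mm" using contra a z(2) r by blast
    then show "x \<in> N" using lc_mm_in_mM[OF mod gen(1)] r(2) z(2) ga a(2) by (auto simp: N_def)
  qed
  ultimately have "span (g ` {..<n}) \<subseteq> N" by (intro span_is_subset)
  then have MN: "carrier M \<subseteq> N" using g by (simp add: generates_def)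
  define T where "T = {x \<in> carrier M. \<exists>z\<in>carrier M. x = mon 1 2 \<odot> z}"
  have T: "submodule R T M"
  proof (unfold_locales, goal_cases)
    case 1 show ?case by (auto simp: T_def)
  next
    case (2 x x')
    then show ?case using i2 by (auto simp: T_def smult_r_distr[symmetric] intro!: bexI)
  next
    case 3 show ?case using i2 by (auto simp: T_def intro!: bexI[of _ "\<zero>"])
  next
    case (4 c x)
    then obtain z where z: "z \<in> carrier M" "x = mon 1 2 \<odot> z" by (auto simp: T_def)
    then have "c \<odot> x = mon 1 2 \<odot> (c \<odot> z)" using mon_swap[OF two, of c z] 4 by simp
    moreover have "c \<odot> x \<in> carrier M" "c \<odot> z \<in> carrier M" using 4 z by (auto simp: T_def)
    ultimately show ?case unfolding T_def by blast
  qed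
  interpret T: submodule R T M by (rule T)
  have "r \<odot> x \<in> T" if r: "r \<in> mm" and x: "x \<in> carrier M" for r x
  proof -
    obtain a b where ab: "a \<in> E" "b \<in> E" "r = a + y0 * b" "\<And>i. even i \<Longrightarrow> cf a i = cf r i"
      using RS_decompose[of r] r mm_subset by (metis subsetD)
    have abR: "a \<in> RS" "b \<in> RS" using ab E_subset by auto
    have "a \<in> ge 2" using ab(1) ab(4)[of 0] r by (auto simp: ge_def less_2_cases_iff mm_def even_part_def)
    then obtain a' where a': "a' \<in> E" "a = mon 1 2 * a'" using E_factor[OF ab(1), of 2] by (metis even_numeral)
    have a'R: "a' \<in> RS" using a' E_subset by auto
    have "a \<odot> x \<in> T" unfolding a'(2) T_def using smult_assoc1[of "mon 1 2" a' x] a'R i2 x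
      by (auto intro!: RS_mult)
    moreover have "y0 \<odot> (b \<odot> x) \<in> T"
      using D1 x abR y0_in_RS by (auto simp: T_def dvd_level_def)
    moreover have "r \<odot> x = a \<odot> x \<oplus> y0 \<odot> (b \<odot> x)"
      using abR y0_in_RS x ab(3) smult_l_distr[of a "y0 * b" x] smult_assoc1[of y0 b x]
        RS_mult[OF y0_in_RS abR(2)] by simp
    ultimately show ?thesis by simp
  qed
  then have "{r \<odot> x | r x. r \<in> mm \<and> x \<in> carrier M} \<subseteq> T" by blast
  then have WT: "?W \<subseteq> T" unfolding ideal_times_module_def by (rule span_is_subset[OF _ T])
  have "dvd_level (Suc i)" unfolding dvd_level_def
  proof
    fix x assume x: "x \<in> carrier M"
    then obtain z where z: "z \<in> ?W" "y0 \<odot> x = mon 1 (2 * i) \<odot> z" using MN by (auto simp: N_def)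
    obtain z' where z': "z' \<in> carrier M" "z = mon 1 2 \<odot> z'" using z WT by (auto simp: T_def)
    have "y0 \<odot> x = mon 1 (2 * Suc i) \<odot> z'"
      unfolding z z'(2) using smult_assoc1[of "mon 1 (2 * i)" "mon 1 2" z'] i2 z'(1)
      by (simp add: mon_mult)
    then show "\<exists>z\<in>carrier M. y0 \<odot> x = mon 1 (2 * Suc i) \<odot> z" using z'(1) by blast
  qed
  with nD show False ..
qed

text \<open>If \<open>i\<close> is the largest level and \<open>2 i < con\<close>, then \<open>y0 g\<^sub>a = t^(2i) \<Sum> r\<^sub>b g\<^sub>b\<close> for some generator \<open>g\<^sub>a\<close>
and some \<open>r\<^sub>b\<close> with a nonzero constant term. In this relation the coefficient of \<open>g\<^sub>b\<close> has order
\<open>2 i\<close>, which is at most the order of any value of a map from \<open>M\<close> to \<open>R\<close>.\<close>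

lemma trace_subset_multiplicity_two:
  assumes fg: "finitely_generated R M"
    and homs: "\<And>f x. f \<in> module_hom R M (self_module R) \<Longrightarrow> x \<in> carrier M \<Longrightarrow> f x \<in> mm"
    and g: "generates R M n g"
    and con: "ge con \<subseteq> trace_ideal R (syzygy R M n g)"
  shows "trace_ideal R M \<subseteq> trace_ideal R (syzygy R M n g)" (is "_ \<subseteq> ?I")
proof (rule trace_least[OF ideal_trace])
  fix f x assume f: "f \<in> module_hom R M (self_module R)" and x: "x \<in> carrier M"
  note gen = generatesD[OF mod g]
  have "\<exists>z\<in>carrier M. y0 \<odot> x = mon 1 2 \<odot> z" if "x \<in> carrier M" for x
    by (rule y0_smult_divisible[OF mod tf fg _ that]) (rule homs)
  then have D1: "dvd_level 1" by (simp add: dvd_level_def)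
  obtain j where j: "con = 2 * j" using con_even by auto
  show "f x \<in> ?I"
  proof (cases "dvd_level j")
    case True
    then show ?thesis using hom_in_ge[OF True _ f x] j con by auto
  next
    case False
    define i where "i = (LEAST i. \<not> dvd_level (Suc i) \<and> i \<ge> 1)"
    obtain j' where j': "j = Suc j'" "j' \<ge> 1" using False D1 j con_ge_2 by (cases j) (auto simp: Suc_le_eq)
    have P: "\<not> dvd_level (Suc i) \<and> i \<ge> 1" unfolding i_def by (rule LeastI[of _ j']) (use False j' in auto)
    have le: "i \<le> j'" unfolding i_def by (rule Least_le) (use False j' in auto)
    have D: "dvd_level i"
    proof (cases "i = 1")
      case False
      then have "\<not> (\<not> dvd_level (Suc (i - 1)) \<and> i - 1 \<ge> 1)"
        using not_less_Least[of "i - 1" "\<lambda>i. \<not> dvd_level (Suc i) \<and> i \<ge> 1"] P unfolding i_def[symmetric] by auto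
      then show ?thesis using False P by auto
    qed (use D1 in simp)
    obtain a r b where ar: "a < n" "r \<in> {..<n} \<rightarrow> RS"
      "y0 \<odot> g a = mon 1 (2 * i) \<odot> lc M n g r" "b < n" "r b \<notin> mm"
      using not_dvd_level_Suc[OF g D1 D] P by blast
    let ?e = "\<lambda>l. if l = a then \<one>\<^bsub>R\<^esub> else \<zero>\<^bsub>R\<^esub>"
    \<comment> \<open>The relation \<open>y0 g\<^sub>a - t^(2i) \<Sum> r\<^sub>b g\<^sub>b = 0\<close>; below \<open>con + 1\<close> its coefficients are those of \<open>- t^(2i) r\<close>.\<close>
    define v where "v = (\<lambda>l. y0 * ?e l + (- mon 1 (2 * i)) * r l)"
    have i2: "mon 1 (2 * i) \<in> RS" "- mon 1 (2 * i) \<in> RS" by (auto intro!: mon_in_RS even_in_G)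
    have ga: "g a \<in> carrier M" using gen(1) ar by auto
    have lr: "lc M n g r \<in> carrier M" using lc_closed[OF mod gen(1)] ar by simp
    have 1: "lc M n g (\<lambda>l. y0 * ?e l) = y0 \<odot> g a"
      using lc_smult[OF mod gen(1), of ?e y0 "\<lambda>l. y0 * ?e l"] lc_unit[OF mod gen(1) ar(1)] y0_in_RS by auto
    have 2: "lc M n g (\<lambda>l. (- mon 1 (2 * i)) * r l) = (- mon 1 (2 * i)) \<odot> lc M n g r"
      using lc_smult[OF mod gen(1), of r "- mon 1 (2 * i)" "\<lambda>l. (- mon 1 (2 * i)) * r l"] ar i2 by simp
    have "lc M n g v = y0 \<odot> g a \<oplus> (- mon 1 (2 * i)) \<odot> lc M n g r"
      unfolding 1[symmetric] 2[symmetric]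
      by (rule lc_add[OF mod gen(1)]) (use y0_in_RS i2 ar in \<open>auto simp: v_def Pi_iff intro!: RS_diff RS_uminus RS_mult\<close>)
    also have "\<dots> = (mon 1 (2 * i) + (- mon 1 (2 * i))) \<odot> lc M n g r"
      unfolding ar(3) using smult_l_distr[of "mon 1 (2 * i)" "- mon 1 (2 * i)"] i2 lr by simp
    also have "\<dots> = \<zero>" using lr smult_l_null[of "lc M n g r"] by simp
    finally have vz: "lc M n g v = \<zero>" .
    have vR: "v \<in> {..<n} \<rightarrow> RS" using ar(1,2) y0_in_RS i2
      by (auto simp: v_def Pi_iff intro!: RS_diff RS_uminus RS_mult)
    have vI: "v b \<in> ?I" by (rule relation_in_trace_syzygy[OF mod gen(1) vR vz ar(4)])
    have "cf (r b) 0 \<noteq> 0" using ar(2,4,5) by (auto simp: mm_def)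
    moreover have "cf (v b) l = - (if 2 * i \<le> l then cf (r b) (l - 2 * i) else 0)" if "l < Suc con" for l
      using that by (auto simp: v_def cf_mon_mult cf_1 cf_mon)
    ultimately have "cf (v b) (2 * i) \<noteq> 0" "v b \<in> ge (2 * i)"
      using le j j' by (auto simp: ge_def)
    moreover have "f x \<in> ge (2 * i)" using hom_in_ge[OF D _ f x] le j j' by simp
    ultimately show ?thesis
      using ge_subset_ideal[OF ideal_trace con vI] self_hom_closed[OF f x] by simp
  qed
qed

end

end

context semigroup_ring
begin

text \<open>The trace of \<open>M\<close> is contained in \<open>mm\<close>. If \<open>mm\<close> lies in the conductor, then so does the trace of
\<open>M\<close>, while the trace of the nonzero syzygy contains the conductor.\<close>

lemma trace_subset_syzygy_trace:
  assumes mod: "Module.module R M" and tf: "torsion_free R M" and fg: "finitely_generated R M"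
    and homs: "\<And>f x. f \<in> module_hom R M (self_module R) \<Longrightarrow> x \<in> carrier M \<Longrightarrow> f x \<in> mm"
    and g: "generates R M n g"
    and rel: "v \<in> {..<n} \<rightarrow> RS" "lc M n g v = \<zero>\<^bsub>M\<^esub>" "i < n" "v i \<noteq> 0"
    and ring: "mm \<subseteq> ge con \<or> 2 \<in> G"
  shows "trace_ideal R M \<subseteq> trace_ideal R (syzygy R M n g)"
proof -
  have con: "ge con \<subseteq> trace_ideal R (syzygy R M n g)"
    using generatesD(1)[OF mod g] rel by (intro ge_con_subset_trace_syzygy[OF mod])
  show ?thesis
  proof (cases "mm \<subseteq> ge con")
    case True
    have "trace_ideal R M \<subseteq> mm" by (rule trace_least[OF ideal_mm]) (rule homs)
    then show ?thesis using True con by blast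
  next
    case False
    have "1 \<notin> G"
    proof
      assume "1 \<in> G"
      then have "n \<in> G" for n by (induction n) (use add_in_G[of _ 1] in auto)
      then have "con = 0" using con_least by auto
      with False show False by simp
    qed
    then interpret multiplicity_two cf mon G con using ring False by unfold_locales auto
    show ?thesis by (rule trace_subset_multiplicity_two[OF mod tf fg _ g con]) (rule homs)
  qed
qed

end

section \<open>Splitting off free summands\<close>

context semigroup_ring
begin

context
  fixes M :: "('a, 'm) module" (structure)
  assumes mod: "Module.module R M"
begin

interpretation module R M by (rule mod)

lemma add_eq_add_imp_diff:
  assumes c: "a \<in> carrier M" "b \<in> carrier M" "c \<in> carrier M" "d \<in> carrier M"
    and eq: "a \<oplus> b = c \<oplus> d"
  shows "a \<oplus> \<ominus> c = d \<oplus> \<ominus> b"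
proof -
  have "a \<oplus> \<ominus> c = (a \<oplus> b) \<oplus> (\<ominus> b \<oplus> \<ominus> c)"
    using c by (simp add: M.a_assoc M.r_neg2)
  also have "\<dots> = (d \<oplus> c) \<oplus> (\<ominus> c \<oplus> \<ominus> b)"
    unfolding eq using c by (simp only: M.a_comm M.a_inv_closed)
  also have "\<dots> = d \<oplus> \<ominus> b" using c by (simp add: M.a_assoc M.r_neg2)
  finally show ?thesis .
qed

context
  fixes b and W
  assumes b: "b \<in> carrier M" and W: "LinearCombinations.submodule R W M"
    and dec: "\<And>x. x \<in> carrier M \<Longrightarrow> \<exists>r\<in>RS. \<exists>w\<in>W. x = r \<odot> b \<oplus> w"
    and indep: "\<And>r. r \<in> RS \<Longrightarrow> r \<odot> b \<in> W \<Longrightarrow> r = 0"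
begin

interpretation W: submodule R W M by (rule W)

lemma complement_unique:
  assumes r: "r \<in> RS" "r' \<in> RS" and w: "w \<in> W" "w' \<in> W"
    and eq: "r \<odot> b \<oplus> w = r' \<odot> b \<oplus> w'"
  shows "r = r'"
proof -
  have c: "w \<in> carrier M" "w' \<in> carrier M" using w W.subset by auto
  have rb: "r \<odot> b \<in> carrier M" "r' \<odot> b \<in> carrier M" using r b by auto
  have "(r + (- r')) \<odot> b = r \<odot> b \<oplus> (- r') \<odot> b"
    using smult_l_distr[of r "- r'" b] r b RS_uminus by simp
  also have "(- r') \<odot> b = \<ominus> (r' \<odot> b)" using smult_l_minus[of r' b] r b by simp
  also have "r \<odot> b \<oplus> \<ominus> (r' \<odot> b) = w' \<oplus> \<ominus> w"
    by (rule add_eq_add_imp_diff[OF rb(1) c(1) rb(2) c(2) eq])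
  also have "\<dots> \<in> W" using w submodule_uminus[OF W] by auto
  finally have "r + (- r') = 0" using indep r RS_add RS_uminus by blast
  then show ?thesis by simp
qed

text \<open>Here \<open>M\<close> is the direct sum of \<open>W\<close> and a free module on \<open>b\<close>.\<close>

lemma complement_coordinate:
  "\<exists>f \<in> module_hom R M (self_module R). f b = 1"
proof -
  have "\<forall>x\<in>carrier M. \<exists>r. r \<in> RS \<and> (\<exists>w\<in>W. x = r \<odot> b \<oplus> w)" using dec by blast
  then obtain f where f: "\<And>x. x \<in> carrier M \<Longrightarrow> f x \<in> RS"
    "\<And>x. x \<in> carrier M \<Longrightarrow> \<exists>w\<in>W. x = f x \<odot> b \<oplus> w" by metis
  have uniq: "f x = r" if h: "x \<in> carrier M" "r \<in> RS" "w \<in> W" "x = r \<odot> b \<oplus> w" for x r w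
  proof -
    obtain w' where w': "w' \<in> W" "x = f x \<odot> b \<oplus> w'" using f(2)[OF h(1)] by blast
    show ?thesis by (rule complement_unique[OF f(1)[OF h(1)] h(2) w'(1) h(3) trans[OF w'(2)[symmetric] h(4)]])
  qed
  have "f \<in> module_hom R M (self_module R)"
  proof (rule self_homI)
    fix x y assume x: "x \<in> carrier M" and y: "y \<in> carrier M"
    obtain w where w: "w \<in> W" "x = f x \<odot> b \<oplus> w" using f(2)[OF x] by blast
    obtain v where v: "v \<in> W" "y = f y \<odot> b \<oplus> v" using f(2)[OF y] by blast
    have c: "w \<in> carrier M" "v \<in> carrier M" using w v W.subset by auto
    have rb: "f x \<odot> b \<in> carrier M" "f y \<odot> b \<in> carrier M" using x y f b by auto
    have "x \<oplus> y = (f x \<odot> b \<oplus> w) \<oplus> (f y \<odot> b \<oplus> v)"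
      by (rule arg_cong2[OF w(2) v(2)])
    also have "\<dots> = (f x \<odot> b \<oplus> f y \<odot> b) \<oplus> (w \<oplus> v)" using c rb by (simp add: M.a_ac)
    also have "f x \<odot> b \<oplus> f y \<odot> b = (f x + f y) \<odot> b"
      using smult_l_distr[of "f x" "f y" b] f x y b by simp
    finally have e: "x \<oplus> y = (f x + f y) \<odot> b \<oplus> (w \<oplus> v)" .
    show "f (x \<oplus> y) = f x + f y"
      by (rule uniq[OF _ _ _ e]) (use x y f(1) w(1) v(1) in auto)
  next
    fix r x assume r: "r \<in> RS" and x: "x \<in> carrier M"
    obtain w where w: "w \<in> W" "x = f x \<odot> b \<oplus> w" using f(2)[OF x] by blast
    have c: "w \<in> carrier M" using w W.subset by auto
    have rb: "f x \<odot> b \<in> carrier M" using x f b by auto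
    have "r \<odot> x = r \<odot> (f x \<odot> b \<oplus> w)"
      by (rule arg_cong[OF w(2)])
    also have "\<dots> = (r * f x) \<odot> b \<oplus> r \<odot> w"
      using smult_assoc1[of r "f x" b] r c rb f x b by (simp add: smult_r_distr)
    finally have e: "r \<odot> x = (r * f x) \<odot> b \<oplus> r \<odot> w" .
    show "f (r \<odot> x) = r * f x"
      by (rule uniq[OF _ _ _ e]) (use r x f(1) w(1) in auto)
  qed (rule f)
  moreover have "f b = 1" using b smult_one[of b] by (intro uniq[of _ _ "\<zero>"]) auto
  ultimately show ?thesis by blast
qed

lemma span_single: "span {b} = {r \<odot> b | r. r \<in> RS}"
proof -
  have "span {b} = {lincomb a {b} | a. a \<in> {b} \<rightarrow> carrier R}" using b by (intro finite_span) auto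
  also have "\<dots> = {r \<odot> b | r. r \<in> RS}"
  proof (intro equalityI subsetI)
    fix y assume "y \<in> {lincomb a {b} | a. a \<in> {b} \<rightarrow> carrier R}"
    then obtain a where a: "y = lincomb a {b}" "a b \<in> RS" by auto
    then have "y = a b \<odot> b" using b by (simp add: lincomb_def)
    then show "y \<in> {r \<odot> b | r. r \<in> RS}" using a(2) by blast
  next
    fix y assume "y \<in> {r \<odot> b | r. r \<in> RS}"
    then obtain r where r: "y = r \<odot> b" "r \<in> RS" by blast
    then have "y = lincomb (\<lambda>_. r) {b}" using b by (simp add: lincomb_def)
    moreover have "(\<lambda>_. r) \<in> {b} \<rightarrow> carrier R" using r by auto
    ultimately show "y \<in> {lincomb a {b} | a. a \<in> {b} \<rightarrow> carrier R}" by blast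
  qed
  finally show ?thesis .
qed

lemma complement_free_summand:
  "is_internal_direct_sum R M (span {b}) W" "span {b} \<noteq> {\<zero>}" "is_basis_of R M (span {b}) {b}"
proof -
  have sb: "submodule R (span {b}) M" using b by (intro span_is_submodule) auto
  have sum: "span {b} <+>\<^bsub>M\<^esub> W = carrier M"
  proof
    show "span {b} <+>\<^bsub>M\<^esub> W \<subseteq> carrier M" using b W.subset by (auto simp: set_add_def' span_single)
    show "carrier M \<subseteq> span {b} <+>\<^bsub>M\<^esub> W"
    proof
      fix x assume "x \<in> carrier M"
      then obtain r w where "r \<in> RS" "w \<in> W" "x = r \<odot> b \<oplus> w" using dec by blast
      then show "x \<in> span {b} <+>\<^bsub>M\<^esub> W" unfolding set_add_def' span_single by blast
    qed
  qed
  have int: "span {b} \<inter> W = {\<zero>}"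
  proof
    show "span {b} \<inter> W \<subseteq> {\<zero>}"
    proof
      fix y assume "y \<in> span {b} \<inter> W"
      then obtain r where r: "y = r \<odot> b" "r \<in> RS" "y \<in> W" by (auto simp: span_single)
      then have "r = 0" using indep by blast
      then show "y \<in> {\<zero>}" using r(1) smult_l_null[OF b] by simp
    qed
    show "{\<zero>} \<subseteq> span {b} \<inter> W" using submodule.zero_closed[OF sb] by auto
  qed
  show "is_internal_direct_sum R M (span {b}) W"
    unfolding is_internal_direct_sum_def using sb W sum int by blast
  have nz: "b \<noteq> \<zero>" using indep[of 1] b by auto
  have bb: "b \<in> span {b}" using in_own_span[of "{b}"] b by auto
  then show "span {b} \<noteq> {\<zero>}" using nz by auto
  have "lin_indpt {b}"
  proof (rule finite_lin_indpt2)
    fix a assume a: "a \<in> {b} \<rightarrow> carrier R" "lincomb a {b} = \<zero>"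
    then have "a b \<odot> b = \<zero>" using b by (auto simp: lincomb_def)
    then show "\<forall>v\<in>{b}. a v = \<zero>\<^bsub>R\<^esub>" using indep[of "a b"] a by auto
  qed (use b in auto)
  then show "is_basis_of R M (span {b}) {b}" using bb by (simp add: is_basis_of_def)
qed

end

text \<open>If \<open>b\<close> belongs to a basis of a summand \<open>N\<close> of \<open>M\<close>, then the span of the other basis elements together
with the complement of \<open>N\<close> is a complement of \<open>R b\<close>.\<close>

lemma free_summand_coordinate:
  assumes "has_nonzero_free_summand R M"
  shows "\<exists>f \<in> module_hom R M (self_module R). \<exists>x\<in>carrier M. f x = 1"
proof -
  obtain N N' B where *: "submodule R N M" "submodule R N' M" "N <+>\<^bsub>M\<^esub> N' = carrier M"
    "N \<inter> N' = {\<zero>}" "N \<noteq> {\<zero>}" "B \<subseteq> N" "lin_indpt B" "span B = N"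
    using assms by (auto simp: has_nonzero_free_summand_def is_internal_direct_sum_def is_basis_of_def)
  interpret N: submodule R N M by fact
  interpret N': submodule R N' M by fact
  have BM: "B \<subseteq> carrier M" using * N.subset by auto
  have "B \<noteq> {}"
  proof
    assume "B = {}"
    then have "N = {\<zero>}" using *(8) by (auto simp: span_def lincomb_def)
    with *(5) show False ..
  qed
  then obtain b where b: "b \<in> B" by auto
  define C where "C = B - {b}"
  have CM: "C \<subseteq> carrier M" using BM by (auto simp: C_def)
  interpret C: submodule R "span C" M by (rule span_is_submodule[OF CM])
  have CN: "span C \<subseteq> N" using *(8) span_is_monotone[of C B] by (auto simp: C_def)
  define W where "W = {c \<oplus> x | c x. c \<in> span C \<and> x \<in> N'}"
  have WM: "W \<subseteq> carrier M" using C.subset N'.subset by (auto simp: W_def)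
  have W: "submodule R W M"
  proof (unfold_locales, goal_cases)
    case 1 show ?case by (rule WM)
  next
    case (2 v w)
    then obtain c x c' x' where cx: "v = c \<oplus> x" "w = c' \<oplus> x'" "c \<in> span C" "c' \<in> span C" "x \<in> N'" "x' \<in> N'"
      by (auto simp: W_def)
    have "v \<oplus> w = (c \<oplus> c') \<oplus> (x \<oplus> x')"
      using cx C.subset N'.subset by (simp add: M.a_ac subset_iff)
    moreover have "c \<oplus> c' \<in> span C" "x \<oplus> x' \<in> N'" using cx by auto
    ultimately show ?case unfolding W_def by blast
  next
    case 3 show ?case unfolding W_def
      by (intro CollectI exI[of _ "\<zero>"]) auto
  next
    case (4 r v)
    then obtain c x where cx: "v = c \<oplus> x" "c \<in> span C" "x \<in> N'" by (auto simp: W_def)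
    have "r \<odot> v = r \<odot> c \<oplus> r \<odot> x"
      unfolding cx(1) using cx(2,3) 4(1) C.subset N'.subset by (intro smult_r_distr) auto
    moreover have "r \<odot> c \<in> span C" "r \<odot> x \<in> N'" using cx(2,3) 4(1) by auto
    ultimately show ?case unfolding W_def by blast
  qed
  have bM: "b \<in> carrier M" using b BM by auto
  have dec: "\<exists>r\<in>RS. \<exists>w\<in>W. x = r \<odot> b \<oplus> w" if x: "x \<in> carrier M" for x
  proof -
    have "x \<in> N <+>\<^bsub>M\<^esub> N'" using x *(3) by simp
    then obtain y z where yz: "y \<in> N" "z \<in> N'" "x = y \<oplus> z" by (auto simp: set_add_def')
    obtain a A where a: "finite A" "A \<subseteq> B" "a \<in> A \<rightarrow> carrier R" "y = lincomb a A"
      using yz(1) *(8) by (auto simp: span_def)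
    have "\<exists>r\<in>RS. \<exists>c\<in>span C. y = r \<odot> b \<oplus> c"
    proof (cases "b \<in> A")
      case True
      have "y = a b \<odot> b \<oplus> lincomb a (A - {b})"
        unfolding a(4) by (rule lincomb_del2) (use a True BM in auto)
      moreover have "lincomb a (A - {b}) \<in> span C" unfolding span_def using a
        by (intro CollectI exI[of _ a] exI[of _ "A - {b}"]) (auto simp: C_def)
      moreover have "a b \<in> RS" using a(3) True by auto
      ultimately show ?thesis by blast
    next
      case False
      have "y \<in> span C" unfolding span_def using a False
        by (intro CollectI exI[of _ a] exI[of _ "A"]) (auto simp: C_def)
      then show ?thesis using bM C.subset smult_l_null[OF bM] by (intro bexI[of _ 0] bexI[of _ y]) auto
    qed
    then obtain r c where rc: "r \<in> RS" "c \<in> span C" "y = r \<odot> b \<oplus> c" by blast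
    have "x = r \<odot> b \<oplus> (c \<oplus> z)"
      unfolding yz(3) rc(3) using rc bM yz C.subset N'.subset by (intro M.a_assoc) auto
    moreover have "c \<oplus> z \<in> W" using rc yz by (auto simp: W_def)
    ultimately show ?thesis using rc by blast
  qed
  have indep: "r = 0" if r: "r \<in> RS" "r \<odot> b \<in> W" for r
  proof (rule ccontr)
    assume nz: "r \<noteq> 0"
    obtain c x where cx: "c \<in> span C" "x \<in> N'" "r \<odot> b = c \<oplus> x" using r by (auto simp: W_def)
    have cM: "c \<in> carrier M" "x \<in> carrier M" using cx C.subset N'.subset by auto
    have mc: "\<ominus> c \<in> span C" using cx submodule_uminus[OF C.submodule_axioms] by auto
    have x: "x = r \<odot> b \<oplus> (\<ominus> c)"
      unfolding cx(3) using cM by (simp add: M.a_comm[of c x] M.a_assoc M.r_neg)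
    also have "\<dots> \<in> N"
      using r(1) b *(6) mc CN by (intro N.m_closed N.smult_closed) auto
    finally have "x = \<zero>" using cx *(4) by auto
    then have rz: "r \<odot> b \<oplus> (\<ominus> c) = \<zero>" using x by simp
    obtain a A where a: "finite A" "A \<subseteq> C" "a \<in> A \<rightarrow> carrier R" "\<ominus> c = lincomb a A"
      using mc unfolding span_def by blast
    have bA: "b \<notin> A" using a by (auto simp: C_def)
    define a' where "a' = (\<lambda>v. if v = b then r else a v)"
    have a'b: "a' b = r" and a'A: "\<And>v. v \<in> A \<Longrightarrow> a' v = a v" using bA by (auto simp: a'_def)
    have a'P: "a' \<in> A \<union> {b} \<rightarrow> carrier R" using a(3) r(1) by (auto simp: a'_def Pi_iff)
    have AM: "A \<subseteq> carrier M" using a(2) CM by auto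
    have "lincomb a' (A \<union> {b}) = a' b \<odot> b \<oplus> lincomb a' A"
      by (rule lincomb_insert[OF a(1) AM a'P bA bM])
    also have "lincomb a' A = lincomb a A" by (rule lincomb_cong[OF refl AM a'A a(3)])
    finally have "lincomb a' (A \<union> {b}) = \<zero>" unfolding a'b a(4)[symmetric] using rz by simp
    moreover have "A \<union> {b} \<subseteq> B" using a(2) b by (auto simp: C_def)
    ultimately have "lin_dep B"
      using a(1) a'P a'b nz by (intro lin_dep_crit[of "A \<union> {b}" B a' b]) auto
    with *(7) show False by simp
  qed
  have "\<exists>f \<in> module_hom R M (self_module R). f b = 1"
    by (rule complement_coordinate[OF bM W]) (rule dec, assumption, rule indep, assumption+)
  then show ?thesis using bM by blast
qed

text \<open>If \<open>f x\<close> is a unit, then the kernel of \<open>f\<close> is a complement of \<open>R x\<close>.\<close>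

lemma local_free_summand:
  assumes unit: "\<And>u. u \<in> RS \<Longrightarrow> cf u 0 \<noteq> 0 \<Longrightarrow> \<exists>w\<in>RS. u * w = 1"
    and f: "f \<in> module_hom R M (self_module R)" and x: "x \<in> carrier M" "f x \<notin> mm"
  shows "has_nonzero_free_summand R M"
proof -
  define W where "W = {z \<in> carrier M. f z = 0}"
  have fR: "f z \<in> RS" if "z \<in> carrier M" for z using self_hom_closed[OF f that] by simp
  obtain w where w: "w \<in> RS" "f x * w = 1" using unit[of "f x"] x fR by (auto simp: mm_def)
  have W: "submodule R W M"
    using self_hom_add[OF f] self_hom_smult[OF f] self_hom_zero[OF mod f]
    by unfold_locales (auto simp: W_def)
  have dec: "\<exists>r\<in>RS. \<exists>v\<in>W. z = r \<odot> x \<oplus> v" if z: "z \<in> carrier M" for z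
  proof -
    define r where "r = f z * w"
    have r: "r \<in> RS" "- r \<in> RS" using fR[OF z] w(1) by (auto simp: r_def)
    have c: "r \<odot> x \<in> carrier M" "(- r) \<odot> x \<in> carrier M" using r x by auto
    have zero: "r \<odot> x \<oplus> (- r) \<odot> x = \<zero>"
      using smult_l_distr[of r "- r" x] smult_l_null[OF x(1)] r x by simp
    have "f (z \<oplus> (- r) \<odot> x) = f z - r * f x"
      using self_hom_add[OF f] self_hom_smult[OF f] r x z c by simp
    also have "\<dots> = 0" using w(2) by (simp add: r_def mult.assoc mult.commute)
    finally have "z \<oplus> (- r) \<odot> x \<in> W" using z c by (simp add: W_def)
    moreover have "z = r \<odot> x \<oplus> (z \<oplus> (- r) \<odot> x)"
      using zero z c M.a_lcomm[of "r \<odot> x" z "(- r) \<odot> x"] by simp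
    ultimately show ?thesis using r by blast
  qed
  have indep: "r = 0" if r: "r \<in> RS" "r \<odot> x \<in> W" for r
  proof -
    have "r * f x = 0" using r self_hom_smult[OF f, of r x] x by (simp add: W_def)
    then show ?thesis using w(2) by auto
  qed
  have "is_internal_direct_sum R M (span {x}) W \<and> span {x} \<noteq> {\<zero>} \<and> is_basis_of R M (span {x}) {x}"
    by (intro conjI complement_free_summand[OF x(1) W]) (assumption | erule dec | erule (1) indep)+
  then show ?thesis unfolding has_nonzero_free_summand_def by blast
qed

lemma free_family_basis:
  assumes g: "generates R M n g"
    and rel: "\<And>v i. v \<in> {..<n} \<rightarrow> RS \<Longrightarrow> lc M n g v = \<zero> \<Longrightarrow> i < n \<Longrightarrow> v i = 0"
  shows "is_internal_direct_sum R M (carrier M) {\<zero>}" "is_basis_of R M (carrier M) (g ` {..<n})"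
proof -
  have s: "submodule R (carrier M) M" "submodule R {\<zero>} M" by unfold_locales auto
  have "carrier M <+>\<^bsub>M\<^esub> {\<zero>} = carrier M" by (auto simp: set_add_def')
  then show "is_internal_direct_sum R M (carrier M) {\<zero>}"
    using s by (auto simp: is_internal_direct_sum_def)
  have gM: "g ` {..<n} \<subseteq> carrier M" using g by (simp add: generates_def)
  have "lin_indpt (g ` {..<n})"
    by (rule lin_indpt_family(2)[OF mod gM]) (use rel in auto)
  then show "is_basis_of R M (carrier M) (g ` {..<n})"
    using g gM by (simp add: is_basis_of_def generates_def)
qed

end

end

section \<open>Splitting off graded free summands\<close>

locale graded_semigroup_ring = semigroup_ring cf mon G con
  for cf :: "'a::idom \<Rightarrow> nat \<Rightarrow> 'k::field" and mon G con +
  assumes finite_support: "finite {n. cf x n \<noteq> 0}"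
begin

lemma mon_expansion: "x = (\<Sum>n | cf x n \<noteq> 0. mon (cf x n) n)"
proof (rule cf_ext)
  fix m
  have "(\<Sum>n | cf x n \<noteq> 0. cf (mon (cf x n) n) m) = (\<Sum>n | cf x n \<noteq> 0. if n = m then cf x m else 0)"
    by (intro sum.cong) (auto simp: cf_mon)
  then show "cf x m = cf (\<Sum>n | cf x n \<noteq> 0. mon (cf x n) n) m"
    using finite_support[of x] by (simp add: cf_sum)
qed

context
  fixes M :: "('a, 'm) module" (structure) and D :: "int \<Rightarrow> 'm set"
  assumes mod: "Module.module R M"
    and D_sub: "\<And>d. subgroup (D d) (add_monoid M)"
    and D_dec: "\<And>x. x \<in> carrier M \<Longrightarrow> \<exists>!u. (\<forall>d. u d \<in> D d) \<and> finite {d. u d \<noteq> \<zero>} \<and>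
        x = (\<Oplus>d\<in>{d. u d \<noteq> \<zero>}. u d)"
    and D_smult: "\<And>s c d x. s \<in> G \<Longrightarrow> x \<in> D d \<Longrightarrow> mon c s \<odot> x \<in> D (d + int s)"
begin

interpretation module R M by (rule mod)

definition comp :: "'m \<Rightarrow> int \<Rightarrow> 'm" where
  "comp x = (THE u. (\<forall>d. u d \<in> D d) \<and> finite {d. u d \<noteq> \<zero>} \<and>
        x = (\<Oplus>d\<in>{d. u d \<noteq> \<zero>}. u d))"

lemma D_carrier: "x \<in> D d \<Longrightarrow> x \<in> carrier M"
  using subgroup.subset[OF D_sub[of d]] by auto

lemma D_zero: "\<zero> \<in> D d"
  using subgroup.one_closed[OF D_sub[of d]] by simp

lemma D_add: "x \<in> D d \<Longrightarrow> y \<in> D d \<Longrightarrow> x \<oplus> y \<in> D d"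
  using subgroup.m_closed[OF D_sub[of d]] by simp

lemma
  assumes "x \<in> carrier M"
  shows comp_in_D: "comp x d \<in> D d" and comp_fin: "finite {d. comp x d \<noteq> \<zero>}"
    and comp_sum: "x = (\<Oplus>d\<in>{d. comp x d \<noteq> \<zero>}. comp x d)"
  using theI'[OF D_dec[OF assms]] unfolding comp_def[symmetric] by auto

lemma finsum_support:
  assumes "finite F" "\<And>d. u d \<in> carrier M" "{d. u d \<noteq> \<zero>} \<subseteq> F"
  shows "(\<Oplus>d\<in>F. u d) = (\<Oplus>d\<in>{d. u d \<noteq> \<zero>}. u d)"
  using assms by (intro M.add.finprod_mono_neutral_cong_right) auto

lemma comp_eqI:
  assumes u: "\<And>d. u d \<in> D d" and F: "finite F" "\<And>d. d \<notin> F \<Longrightarrow> u d = \<zero>"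
    and x: "x = (\<Oplus>d\<in>F. u d)"
  shows "comp x = u"
proof -
  have uM: "u d \<in> carrier M" for d using D_carrier[OF u] .
  have xM: "x \<in> carrier M" unfolding x using uM by auto
  have sub: "{d. u d \<noteq> \<zero>} \<subseteq> F" using F(2) by blast
  have fin: "finite {d. u d \<noteq> \<zero>}" using finite_subset[OF sub F(1)] .
  have "(\<forall>d. u d \<in> D d) \<and> finite {d. u d \<noteq> \<zero>} \<and> x = (\<Oplus>d\<in>{d. u d \<noteq> \<zero>}. u d)"
    using u fin x finsum_support[OF F(1) uM sub] by simp
  then show ?thesis unfolding comp_def by (rule the1_equality[OF D_dec[OF xM]])
qed

lemma comp_finite_sum:
  assumes "x \<in> carrier M" "finite F" "{d. comp x d \<noteq> \<zero>} \<subseteq> F"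
  shows "x = (\<Oplus>d\<in>F. comp x d)"
  using finsum_support[OF assms(2), of "comp x"] comp_sum[OF assms(1)] assms
    D_carrier[OF comp_in_D[OF assms(1)]] by simp

lemma comp_add:
  assumes x: "x \<in> carrier M" and y: "y \<in> carrier M"
  shows "comp (x \<oplus> y) = (\<lambda>d. comp x d \<oplus> comp y d)"
proof (rule comp_eqI)
  let ?F = "{d. comp x d \<noteq> \<zero>} \<union> {d. comp y d \<noteq> \<zero>}"
  show F: "finite ?F" using comp_fin x y by auto
  have "x \<oplus> y = (\<Oplus>d\<in>?F. comp x d) \<oplus> (\<Oplus>d\<in>?F. comp y d)"
    by (rule arg_cong2[OF comp_finite_sum[OF x F] comp_finite_sum[OF y F]]) auto
  also have "\<dots> = (\<Oplus>d\<in>?F. comp x d \<oplus> comp y d)"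
    using D_carrier[OF comp_in_D[OF x]] D_carrier[OF comp_in_D[OF y]] by (intro M.finsum_addf[symmetric]) auto
  finally show "x \<oplus> y = (\<Oplus>d\<in>?F. comp x d \<oplus> comp y d)" .
qed (use comp_in_D x y D_add in auto)

lemma comp_mon_smult:
  assumes x: "x \<in> carrier M" and s: "s \<in> G"
  shows "comp (mon c s \<odot> x) = (\<lambda>d. mon c s \<odot> comp x (d - int s))"
proof (rule comp_eqI)
  let ?S = "{d. comp x d \<noteq> \<zero>}"
  let ?F = "(\<lambda>d. d + int s) ` ?S"
  have m: "mon c s \<in> RS" by (rule mon_in_RS[OF s])
  have cM: "comp x d \<in> carrier M" for d using D_carrier[OF comp_in_D[OF x]] .
  show "finite ?F" using comp_fin[OF x] by simp
  show "mon c s \<odot> comp x (d - int s) \<in> D d" for d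
    using D_smult[OF s comp_in_D[OF x, of "d - int s"]] by simp
  show "mon c s \<odot> comp x (d - int s) = \<zero>" if "d \<notin> ?F" for d
  proof -
    have "d - int s \<notin> ?S" using that by (auto simp: image_iff)
    then show ?thesis using m by simp
  qed
  have "mon c s \<odot> x = mon c s \<odot> (\<Oplus>d\<in>?S. comp x d)"
    by (rule arg_cong[OF comp_sum[OF x]])
  also have "\<dots> = (\<Oplus>d\<in>?S. mon c s \<odot> comp x d)"
    using m cM comp_fin[OF x] by (intro finsum_smult) auto
  also have "\<dots> = (\<Oplus>d\<in>?F. mon c s \<odot> comp x (d - int s))"
    using m cM by (subst M.finsum_reindex) (auto simp: inj_on_def)
  finally show "mon c s \<odot> x = (\<Oplus>d\<in>?F. mon c s \<odot> comp x (d - int s))" .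
qed

lemma comp_homogeneous:
  assumes "x \<in> D e" shows "comp x = (\<lambda>d. if d = e then x else \<zero>)"
  by (rule comp_eqI[where F = "{e}"]) (use assms D_zero D_carrier[OF assms] in auto)

text \<open>Statements about scalars that are stable under addition need to be checked for monomials only.\<close>

lemma smult_induct:
  assumes P0: "P 0" and Pm: "\<And>c s. s \<in> G \<Longrightarrow> P (mon c s)"
    and Pa: "\<And>r r'. r \<in> RS \<Longrightarrow> r' \<in> RS \<Longrightarrow> P r \<Longrightarrow> P r' \<Longrightarrow> P (r + r')" and r: "r \<in> RS"
  shows "P r"
proof -
  have "P (\<Sum>n\<in>I. mon (cf r n) n) \<and> (\<Sum>n\<in>I. mon (cf r n) n) \<in> RS" if "finite I" "I \<subseteq> {n. cf r n \<noteq> 0}" for I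
    using that
  proof (induction I)
    case (insert n I)
    then have "n \<in> G" using r by (auto simp: RS_def)
    then show ?case using insert Pm[of n] Pa mon_in_RS by (auto intro: RS_add)
  qed (use P0 in auto)
  from this[OF finite_support[of r] subset_refl] show ?thesis using mon_expansion[of r] by simp
qed

text \<open>Some homogeneous component \<open>x\<close> of \<open>x0\<close> has a value \<open>f x\<close> with nonzero constant term; let \<open>e\<close> be
its degree. The part of \<open>f\<close> of degree \<open>- e\<close> sends \<open>x\<close> to a nonzero constant, and its kernel is a
graded complement of \<open>R x\<close>.\<close>

lemma graded_free_summand:
  assumes f: "f \<in> module_hom R M (self_module R)" and x0: "x0 \<in> carrier M" "f x0 \<notin> mm"
  shows "has_nonzero_graded_free_summand R M D"
proof -
  have fR: "z \<in> carrier M \<Longrightarrow> f z \<in> RS" for z using self_hom_closed[OF f] by simp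
  have f0: "f \<zero> = 0" by (rule self_hom_zero[OF mod f])
  have f_add: "f (z \<oplus> w) = f z + f w" if "z \<in> carrier M" "w \<in> carrier M" for z w
    using self_hom_add[OF f that] by simp
  have f_smult: "f (r \<odot> z) = r * f z" if "r \<in> RS" "z \<in> carrier M" for r z
    using self_hom_smult[OF f _ that(2), of r] that by simp
  have "\<exists>e. f (comp x0 e) \<notin> mm"
  proof (rule ccontr)
    assume "\<not> ?thesis"
    then have all: "f (comp x0 e) \<in> mm" for e by blast
    have cM: "comp x0 d \<in> carrier M" for d using D_carrier[OF comp_in_D[OF x0(1)]] .
    have "f (\<Oplus>d\<in>F. comp x0 d) \<in> mm" if "finite F" for F
      using that
    proof (induction F)
      case empty
      show ?case using f0 ideal_subring_recordD(2)[OF ideal_mm] by simp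
    next
      case (insert d F)
      have "(\<Oplus>d\<in>insert d F. comp x0 d) = comp x0 d \<oplus> (\<Oplus>d\<in>F. comp x0 d)"
        using insert cM by (intro M.finsum_insert) auto
      then show ?case using insert all f_add cM ideal_subring_recordD(3)[OF ideal_mm] by simp
    qed
    from this[OF comp_fin[OF x0(1)]] comp_sum[OF x0(1)] x0(2) show False by simp
  qed
  then obtain e where e: "f (comp x0 e) \<notin> mm" by blast
  define x where "x = comp x0 e"
  have xD: "x \<in> D e" unfolding x_def by (rule comp_in_D[OF x0(1)])
  have xM: "x \<in> carrier M" by (rule D_carrier[OF xD])
  define c0 where "c0 = cf (f x) 0"
  have c0: "c0 \<noteq> 0" using e fR[OF xM] by (simp add: c0_def x_def mm_def)
  \<comment> \<open>The coefficients of the image of \<open>z\<close> under the part of \<open>f\<close> of degree \<open>- e\<close>.\<close>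
  define coe where "coe = (\<lambda>s z. cf (f (comp z (e + int s))) s)"
  define W where "W = {z \<in> carrier M. \<forall>s. coe s z = 0}"
  have cM: "comp z d \<in> carrier M" if "z \<in> carrier M" for z d using D_carrier[OF comp_in_D[OF that]] .
  have coe_add: "coe s (z \<oplus> w) = coe s z + coe s w" if "z \<in> carrier M" "w \<in> carrier M" for s z w
    using that by (simp add: coe_def comp_add f_add cM)
  have coe_mon: "coe s (mon c k \<odot> z) = (if k \<le> s then c * coe (s - k) z else 0)"
    if "z \<in> carrier M" "k \<in> G" for s c k z
    using that by (simp add: coe_def comp_mon_smult f_smult cM mon_in_RS cf_mon_mult of_nat_diff algebra_simps)
  have coe_0: "coe s \<zero> = 0" for s using coe_add[of "\<zero>" "\<zero>" s] by (metis M.r_zero M.zero_closed add_cancel_right_right)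
  have coe_x: "coe s x = (if s = 0 then c0 else 0)" for s
    by (simp add: coe_def comp_homogeneous[OF xD] c0_def f0)
  have coe_rx: "coe s (r \<odot> x) = cf r s * c0" if rR: "r \<in> RS" for r s
  proof (rule smult_induct[of "\<lambda>r. coe s (r \<odot> x) = cf r s * c0", OF _ _ _ rR])
    show "coe s (0 \<odot> x) = cf 0 s * c0" using smult_l_null[OF xM] coe_0 by simp
    show "coe s (mon c k \<odot> x) = cf (mon c k) s * c0" if "k \<in> G" for c k
      using that by (auto simp: coe_mon xM coe_x cf_mon)
    show "coe s ((r + r') \<odot> x) = cf (r + r') s * c0"
      if "r \<in> RS" "r' \<in> RS" "coe s (r \<odot> x) = cf r s * c0" "coe s (r' \<odot> x) = cf r' s * c0" for r r'
      using that smult_l_distr[of r r' x] xM by (simp add: coe_add algebra_simps)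
  qed
  have W_add: "z \<oplus> w \<in> W" if "z \<in> W" "w \<in> W" for z w using that by (auto simp: W_def coe_add)
  have W0: "\<zero> \<in> W" by (simp add: W_def coe_0)
  have W: "submodule R W M"
  proof (unfold_locales, goal_cases)
    case (4 r z)
    have zM: "z \<in> carrier M" using 4 by (simp add: W_def)
    have rR: "r \<in> RS" using 4 by simp
    show ?case
    proof (rule smult_induct[of "\<lambda>r. r \<odot> z \<in> W", OF _ _ _ rR])
      show "0 \<odot> z \<in> W" using smult_l_null[OF zM] W0 by simp
      show "mon c k \<odot> z \<in> W" if "k \<in> G" for c k
        using that 4 mon_in_RS[OF that] by (auto simp: W_def coe_mon)
      show "(r + r') \<odot> z \<in> W" if "r \<in> RS" "r' \<in> RS" "r \<odot> z \<in> W" "r' \<odot> z \<in> W" for r r'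
        using that smult_l_distr[of r r' z] zM W_add by simp
    qed
  qed (auto simp: W_def coe_add coe_0)
  interpret W: submodule R W M by (rule W)
  have dec: "\<exists>r\<in>RS. \<exists>w\<in>W. z = r \<odot> x \<oplus> w" if z: "z \<in> carrier M" for z
  proof -
    have "{s. coe s z \<noteq> 0} \<subseteq> (\<lambda>d. nat (d - e)) ` {d. comp z d \<noteq> \<zero>}"
    proof
      fix s assume "s \<in> {s. coe s z \<noteq> 0}"
      then have "comp z (e + int s) \<noteq> \<zero>" using f0 by (auto simp: coe_def)
      then show "s \<in> (\<lambda>d. nat (d - e)) ` {d. comp z d \<noteq> \<zero>}" by (intro image_eqI[of _ _ "e + int s"]) auto
    qed
    then have fin: "finite {s. coe s z \<noteq> 0}" using comp_fin[OF z] finite_subset by blast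
    define r where "r = (\<Sum>s | coe s z \<noteq> 0. mon (coe s z / c0) s)"
    have cfr: "cf r s = coe s z / c0" for s
    proof -
      have "cf r s = (\<Sum>k | coe k z \<noteq> 0. if k = s then coe s z / c0 else 0)"
        unfolding r_def cf_sum by (intro sum.cong) (auto simp: cf_mon)
      then show ?thesis using fin by simp
    qed
    have "s \<in> G" if "coe s z \<noteq> 0" for s
      using that fR[OF cM[OF z]] by (auto simp: coe_def RS_def)
    then have r: "r \<in> RS" using c0 by (auto simp: RS_def cfr)
    have rx: "r \<odot> x \<in> carrier M" "(- r) \<odot> x \<in> carrier M" using r xM by (auto intro!: smult_closed RS_uminus)
    have "coe s (z \<oplus> (- r) \<odot> x) = 0" for s
      using coe_rx[of "- r" s] r c0 by (simp add: coe_add z rx cfr RS_uminus)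
    then have "z \<oplus> (- r) \<odot> x \<in> W" using z rx by (simp add: W_def)
    moreover have "r \<odot> x \<oplus> (- r) \<odot> x = \<zero>"
      using smult_l_distr[of r "- r" x] smult_l_null[OF xM] r xM by (simp add: RS_uminus)
    then have "z = r \<odot> x \<oplus> (z \<oplus> (- r) \<odot> x)"
      using z rx M.a_lcomm[of "r \<odot> x" z "(- r) \<odot> x"] by simp
    ultimately show ?thesis using r by blast
  qed
  have indep: "r = 0" if r: "r \<in> RS" "r \<odot> x \<in> W" for r
  proof (rule cf_ext)
    show "cf r n = cf 0 n" for n using r coe_rx[OF r(1), of n] c0 by (simp add: W_def)
  qed
  have summand: "is_internal_direct_sum R M (span {x}) W \<and> span {x} \<noteq> {\<zero>} \<and> is_basis_of R M (span {x}) {x}"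
    by (intro conjI complement_free_summand[OF mod xM W]) (assumption | erule dec | erule (1) indep)+
  have hom: "homogeneous_elements D \<subseteq> carrier M" using D_carrier by (auto simp: homogeneous_elements_def)
  have xH: "x \<in> homogeneous_elements D" using xD by (auto simp: homogeneous_elements_def)
  have sx: "submodule R (span {x}) M" using xM by (intro span_is_submodule) auto
  have gx: "is_graded_submodule R M D (span {x})" unfolding is_graded_submodule_def
  proof (intro conjI sx equalityI)
    show "span (span {x} \<inter> homogeneous_elements D) \<subseteq> span {x}" by (rule span_is_subset[OF _ sx]) blast
    show "span {x} \<subseteq> span (span {x} \<inter> homogeneous_elements D)"
      using in_own_span[of "{x}"] xM xH by (intro span_is_monotone) auto
  qed
  have gW: "is_graded_submodule R M D W" unfolding is_graded_submodule_def
  proof (intro conjI W equalityI)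
    show "span (W \<inter> homogeneous_elements D) \<subseteq> W" by (rule span_is_subset[OF _ W]) blast
    show "W \<subseteq> span (W \<inter> homogeneous_elements D)"
    proof
      fix z assume z: "z \<in> W"
      have zM: "z \<in> carrier M" using z W.subset by blast
      interpret S: submodule R "span (W \<inter> homogeneous_elements D)" M
        by (rule span_is_submodule) (use W.subset in blast)
      have comp_W: "comp z d \<in> W" for d
      proof -
        have "coe s (comp z d) = 0" for s
        proof (cases "d = e + int s")
          case True
          then have "coe s (comp z d) = coe s z"
            using comp_homogeneous[OF comp_in_D[OF zM, of d]] by (simp add: coe_def)
          then show ?thesis using z by (simp add: W_def)
        next
          case False
          then show ?thesis using comp_homogeneous[OF comp_in_D[OF zM, of d]] f0 by (simp add: coe_def)
        qed
        then show ?thesis using cM[OF zM] by (simp add: W_def)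
      qed
      have in_S: "comp z d \<in> span (W \<inter> homogeneous_elements D)" for d
        using in_own_span[of "W \<inter> homogeneous_elements D"] comp_W[of d] comp_in_D[OF zM, of d] W.subset
        by (auto simp: homogeneous_elements_def)
      have "(\<Oplus>d\<in>F. comp z d) \<in> span (W \<inter> homogeneous_elements D)" if "finite F" for F
        using that
      proof (induction F)
        case (insert d F)
        have "(\<Oplus>d\<in>insert d F. comp z d) = comp z d \<oplus> (\<Oplus>d\<in>F. comp z d)"
          using insert cM[OF zM] by (intro M.finsum_insert) auto
        then show ?case using insert in_S by simp
      qed simp
      from this[OF comp_fin[OF zM]] show "z \<in> span (W \<inter> homogeneous_elements D)"
        using comp_sum[OF zM] by simp
    qed
  qed
  show ?thesis unfolding has_nonzero_graded_free_summand_def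
    using summand gx gW xH by blast
qed

end

end

section \<open>A module whose trace is not contained in the trace of its syzygy\<close>

text \<open>The maximal minors give a relation unless they vanish, and then two of the columns are
proportional.\<close>

lemma two_rows_dependent:
  fixes x1 x2 y1 y2 z1 z2 :: "'a::idom"
  shows "\<exists>a b c. (a \<noteq> 0 \<or> b \<noteq> 0 \<or> c \<noteq> 0) \<and> a * x1 + b * y1 + c * z1 = 0 \<and> a * x2 + b * y2 + c * z2 = 0"
proof -
  let ?a = "y1 * z2 - y2 * z1" and ?b = "z1 * x2 - z2 * x1" and ?c = "x1 * y2 - x2 * y1"
  consider "?a \<noteq> 0 \<or> ?b \<noteq> 0 \<or> ?c \<noteq> 0" | "?c = 0" "x1 \<noteq> 0" | "?c = 0" "x2 \<noteq> 0" | "x1 = 0" "x2 = 0"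
    by blast
  then show ?thesis
  proof cases
    case 1
    then show ?thesis
      by (intro exI[of _ ?a] exI[of _ ?b] exI[of _ ?c]) (simp add: algebra_simps)
  next
    case 2
    then show ?thesis
      by (intro exI[of _ y1] exI[of _ "- x1"] exI[of _ 0]) (simp add: algebra_simps)
  next
    case 3
    then show ?thesis
      by (intro exI[of _ y2] exI[of _ "- x2"] exI[of _ 0]) (simp add: algebra_simps)
  next
    case 4
    then show ?thesis by (intro exI[of _ 1] exI[of _ 0]) simp
  qed
qed

context semigroup_ring
begin

text \<open>If some element of \<open>G\<close> below \<open>con - 1\<close> is not a multiple of \<open>e\<close>, the least one serves as \<open>u\<close>. Otherwise
one of \<open>con\<close> and \<open>con + 1\<close> does, because not both of them are multiples of \<open>e\<close>; here
\<open>1\<close> and \<open>2\<close> are not in \<open>G\<close>.\<close>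

lemma pole_exponents_ex:
  assumes e: "e \<in> G" "3 \<le> e" "\<And>s. s \<in> G \<Longrightarrow> 0 < s \<Longrightarrow> e \<le> s" and less: "Suc e < con"
  shows "\<exists>u\<in>G. e < u \<and> u - e \<notin> G \<and> (u < con - 1 \<or> con - 1 < u \<and> u - (con - 1) \<notin> G)"
proof (cases "\<exists>s. s \<in> G \<and> s < con - 1 \<and> \<not> e dvd s")
  case True
  define u where "u = (LEAST s. s \<in> G \<and> s < con - 1 \<and> \<not> e dvd s)"
  have u: "u \<in> G" "u < con - 1" "\<not> e dvd u" using LeastI_ex[OF True] by (auto simp: u_def)
  have "u > 0" using u(3) by (cases u) auto
  then have eu: "e < u" using e(3)[OF u(1)] u(3) by (cases "e = u") auto
  have "u - e \<notin> G"
  proof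
    assume "u - e \<in> G"
    moreover have "\<not> e dvd (u - e)" using u(3) eu by (simp add: dvd_minus_self)
    moreover have "u - e < u" using eu e(2) by simp
    moreover have "\<not> (u - e \<in> G \<and> u - e < con - 1 \<and> \<not> e dvd (u - e))"
      using \<open>u - e < u\<close> unfolding u_def by (rule not_less_Least)
    ultimately show False using u(2) by simp
  qed
  then show ?thesis using u eu by blast
next
  case False
  define F where "F = con - 1"
  have F: "con = Suc F" using less by (simp add: F_def)
  obtain k where k: "k = 1 \<or> k = 2" "\<not> e dvd F + k"
  proof (cases "e dvd F + 1")
    case True
    have "\<not> e dvd F + 2"
    proof
      assume "e dvd F + 2"
      then have "e dvd (F + 2) - (F + 1)" using True by (rule dvd_diff_nat)
      then show False using e(2) by simp
    qed
    then show ?thesis using that by blast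
  qed (use that in blast)
  have small: "k \<notin> G" using e(3)[of k] e(2) k(1) by auto
  have "F + k - e \<notin> G"
  proof
    assume h: "F + k - e \<in> G"
    have "\<not> e dvd (F + k - e)" using k(2) less F by (simp add: dvd_minus_self)
    moreover have "F + k - e < con - 1" using k(1) e(2) F less by auto
    ultimately show False using False h by blast
  qed
  moreover have "F + k \<in> G" by (rule con_in_G) (use k F in auto)
  ultimately show ?thesis using small less F k(1)
    by (intro bexI[of _ "F + k"]) auto
qed

end

text \<open>The module is \<open>C = R\<^sup>2 + R (t^(u-e), t^(F-e))\<close> inside \<open>V\<^sup>2\<close>, where \<open>F = con - 1\<close>. The injection \<open>enc\<close>
transports it to the element type over which the modules range. The conditions on \<open>u\<close> say that none
of \<open>1, t^(u-e), t^(F-e)\<close> is a multiple of another one by an element of \<open>R\<close>.\<close>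

locale pole_module = semigroup_ring cf mon G con
  for cf :: "'a::idom \<Rightarrow> nat \<Rightarrow> 'k::field" and mon G con +
  fixes e u :: nat and enc :: "'a \<times> 'a \<Rightarrow> 'm"
  assumes e: "e \<in> G" "0 < e" "\<And>s. s \<in> G \<Longrightarrow> 0 < s \<Longrightarrow> e \<le> s" and less: "Suc e < con"
    and u: "u \<in> G" "e < u" "u - e \<notin> G" "u < con - 1 \<or> con - 1 < u \<and> u - (con - 1) \<notin> G"
    and inj: "inj enc"
begin

abbreviation "dl \<equiv> u - e"
abbreviation "yy \<equiv> con - 1 - e"
abbreviation "td \<equiv> mon 1 dl"
abbreviation "ty \<equiv> mon 1 yy"
abbreviation "dec \<equiv> inv_into UNIV enc"

lemma dec_enc [simp]: "dec (enc p) = p" by (rule inv_into_f_f[OF inj UNIV_I])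

definition C :: "('a \<times> 'a) set" where
  "C = {(a * td + b, a * ty + c) | a b c. a \<in> RS \<and> b \<in> RS \<and> c \<in> RS}"

definition PM :: "('a, 'm) module" where
  "PM = \<lparr>carrier = enc ` C, mult = (\<lambda>_ _. enc (0, 0)), one = enc (0, 0), zero = enc (0, 0),
     add = (\<lambda>x y. enc (fst (dec x) + fst (dec y), snd (dec x) + snd (dec y))),
     smult = (\<lambda>r x. enc (r * fst (dec x), r * snd (dec x)))\<rparr>"

lemma PM_simps [simp]:
  "carrier PM = enc ` C" "\<zero>\<^bsub>PM\<^esub> = enc (0, 0)"
  "enc (a, b) \<oplus>\<^bsub>PM\<^esub> enc (c, d) = enc (a + c, b + d)"
  "r \<odot>\<^bsub>PM\<^esub> enc (a, b) = enc (r * a, r * b)"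
  by (simp_all add: PM_def)

lemma enc_eq [simp]: "enc p = enc q \<longleftrightarrow> p = q" by (rule inj_eq[OF inj])

lemma CI: "a \<in> RS \<Longrightarrow> b \<in> RS \<Longrightarrow> c \<in> RS \<Longrightarrow> (a * td + b, a * ty + c) \<in> C"
  unfolding C_def by blast

lemma C_zero: "(0, 0) \<in> C" using CI[of 0 0 0] by simp

lemma C_add: assumes "p \<in> C" "q \<in> C" shows "(fst p + fst q, snd p + snd q) \<in> C"
proof -
  obtain a b c a' b' c' where "p = (a * td + b, a * ty + c)" "q = (a' * td + b', a' * ty + c')"
    "a \<in> RS" "b \<in> RS" "c \<in> RS" "a' \<in> RS" "b' \<in> RS" "c' \<in> RS" using assms by (auto simp: C_def)
  then show ?thesis using CI[of "a + a'" "b + b'" "c + c'"] by (auto simp: algebra_simps)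
qed

lemma C_smult: assumes "p \<in> C" "r \<in> RS" shows "(r * fst p, r * snd p) \<in> C"
proof -
  obtain a b c where "p = (a * td + b, a * ty + c)" "a \<in> RS" "b \<in> RS" "c \<in> RS"
    using assms by (auto simp: C_def)
  then show ?thesis using CI[of "r * a" "r * b" "r * c"] assms(2) by (auto simp: algebra_simps)
qed

lemma module_PM: "Module.module R PM"
proof (rule module_criteria)
  show "cring R" by (rule cring_R)
  show "\<zero>\<^bsub>PM\<^esub> \<in> carrier PM" using C_zero by simp
  show "\<forall>v w. v \<in> carrier PM \<and> w \<in> carrier PM \<longrightarrow> v \<oplus>\<^bsub>PM\<^esub> w \<in> carrier PM"
    using C_add by fastforce
  show "\<forall>v\<in>carrier PM. \<exists>neg_v\<in>carrier PM. v \<oplus>\<^bsub>PM\<^esub> neg_v = \<zero>\<^bsub>PM\<^esub>"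
  proof
    fix v assume "v \<in> carrier PM"
    then obtain p where p: "v = enc p" "p \<in> C" by auto
    show "\<exists>neg_v\<in>carrier PM. v \<oplus>\<^bsub>PM\<^esub> neg_v = \<zero>\<^bsub>PM\<^esub>"
      using C_smult[OF p(2), of "- 1"] RS_uminus[OF RS_1] p
      by (intro bexI[of _ "enc (- fst p, - snd p)"]) (cases p; auto)+
  qed
  show "\<forall>c v. c \<in> carrier R \<and> v \<in> carrier PM \<longrightarrow> c \<odot>\<^bsub>PM\<^esub> v \<in> carrier PM"
    using C_smult by fastforce
qed (auto simp: algebra_simps)

sublocale PM: module R PM by (rule module_PM)

definition gg :: "nat \<Rightarrow> 'm" where
  "gg i = (if i = 0 then enc (td, ty) else if i = 1 then enc (1, 0) else enc (0, 1))"

lemma gg_carrier: "gg ` {..<3} \<subseteq> carrier PM"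
  using CI[of 1 0 0] CI[of 0 1 0] CI[of 0 0 1] by (auto simp: gg_def)

lemma lessThan_3: "{..<3} = {0, 1, 2::nat}" by auto

lemma finsum_3: 
  assumes "\<And>i. i < 3 \<Longrightarrow> f i \<in> carrier PM"
  shows "(\<Oplus>\<^bsub>PM\<^esub>i\<in>{..<3::nat}. f i) = f 0 \<oplus>\<^bsub>PM\<^esub> (f 1 \<oplus>\<^bsub>PM\<^esub> f 2)"
proof -
  have f: "f 0 \<in> carrier PM" "f 1 \<in> carrier PM" "f 2 \<in> carrier PM" using assms by auto
  then have "(\<Oplus>\<^bsub>PM\<^esub>i\<in>{0, 1, 2::nat}. f i) = f 0 \<oplus>\<^bsub>PM\<^esub> (\<Oplus>\<^bsub>PM\<^esub>i\<in>{1, 2::nat}. f i)"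
    by (intro PM.M.finsum_insert) auto
  also have "(\<Oplus>\<^bsub>PM\<^esub>i\<in>{1, 2::nat}. f i) = f 1 \<oplus>\<^bsub>PM\<^esub> (\<Oplus>\<^bsub>PM\<^esub>i\<in>{2::nat}. f i)"
    using f by (intro PM.M.finsum_insert) auto
  also have "(\<Oplus>\<^bsub>PM\<^esub>i\<in>{2::nat}. f i) = f 2 \<oplus>\<^bsub>PM\<^esub> (\<Oplus>\<^bsub>PM\<^esub>i\<in>{}. f i)"
    using f by (intro PM.M.finsum_insert) auto
  also have "\<dots> = f 2" using f PM.M.r_zero by simp
  finally show ?thesis unfolding lessThan_3 .
qed

lemma lc_3:
  assumes "h ` {..<3} \<subseteq> carrier PM" "v \<in> {..<3} \<rightarrow> RS"
  shows "lc PM 3 h v = v 0 \<odot>\<^bsub>PM\<^esub> h 0 \<oplus>\<^bsub>PM\<^esub> (v 1 \<odot>\<^bsub>PM\<^esub> h 1 \<oplus>\<^bsub>PM\<^esub> v 2 \<odot>\<^bsub>PM\<^esub> h 2)"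
  unfolding lc_def
proof (rule finsum_3)
  fix i :: nat assume "i < 3"
  then show "v i \<odot>\<^bsub>PM\<^esub> h i \<in> carrier PM" using assms by (intro PM.smult_closed) auto
qed

lemma lc_gg:
  assumes "v \<in> {..<3} \<rightarrow> RS"
  shows "lc PM 3 gg v = enc (v 0 * td + v 1, v 0 * ty + v 2)"
  unfolding lc_3[OF gg_carrier assms] by (simp add: gg_def)

lemma generates_gg: "generates R PM 3 gg"
proof -
  have "enc (a * td + b, a * ty + c) \<in> {lc PM 3 gg v | v. v \<in> {..<3} \<rightarrow> carrier R}"
    if "a \<in> RS" "b \<in> RS" "c \<in> RS" for a b c
    using that lc_gg[of "\<lambda>i. if i = 0 then a else if i = 1 then b else c"]
    by (intro CollectI exI[of _ "\<lambda>i. if i = 0 then a else if i = 1 then b else c"]) auto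
  moreover have "lc PM 3 gg v \<in> enc ` C" if "v \<in> {..<3} \<rightarrow> carrier R" for v
    using that lc_closed[OF module_PM gg_carrier] by simp
  ultimately have "PM.span (gg ` {..<3}) = carrier PM"
    unfolding span_family[OF module_PM gg_carrier] by (fastforce simp: C_def)
  then show ?thesis using gg_carrier by (simp add: generates_def)
qed

lemma finitely_generated_PM: "finitely_generated R PM"
  using generates_gg unfolding finitely_generated_def generates_def
  by (intro exI[of _ "gg ` {..<3}"]) auto

lemma torsion_free_PM: "torsion_free R PM"
  by (auto simp: torsion_free_def)

lemma sub_in_G: "s \<in> G \<Longrightarrow> n \<in> G \<Longrightarrow> m = n + s \<Longrightarrow> m \<in> G" using add_in_G by (simp add: add.commute)

lemma con_minus_1: "con - 1 \<notin> G" using con_least less by simp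

lemma yy_notin: "yy \<notin> G"
  using con_minus_1 sub_in_G[OF e(1), of yy "con - 1"] less by auto

lemma dl_pos: "0 < dl" using u by simp
lemma yy_pos: "0 < yy" using less by simp

lemma dl_neq_yy: "dl \<noteq> yy" using u(4) u(2) less by auto

lemma dl_minus_yy: "yy < dl \<Longrightarrow> dl - yy \<notin> G"
  using u(4) u(2) less by (auto simp: le_diff_conv)

lemma yy_minus_dl: "dl < yy \<Longrightarrow> yy - dl \<notin> G"
  using con_minus_1 sub_in_G[OF u(1), of "yy - dl" "con - 1"] u(2) less by auto

text \<open>The values \<open>p\<^sub>0, p\<^sub>1, p\<^sub>2\<close> of \<open>f\<close> on the generators satisfy \<open>p\<^sub>0 = t^(u-e) p\<^sub>1 + t^(F-e) p\<^sub>2\<close>. A constant term of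
\<open>p\<^sub>1\<close> or \<open>p\<^sub>2\<close> would appear on the right at an exponent outside \<open>G\<close> and could not be cancelled.\<close>

lemma hom_in_mm:
  assumes f: "f \<in> module_hom R PM (self_module R)" and x: "x \<in> carrier PM"
  shows "f x \<in> mm"
proof -
  have fR: "f z \<in> RS" if "z \<in> carrier PM" for z using self_hom_closed[OF f that] by simp
  have gM: "gg 0 \<in> carrier PM" "gg 1 \<in> carrier PM" "gg 2 \<in> carrier PM" using gg_carrier by auto
  define p where "p = (\<lambda>i. f (gg i))"
  have pR: "p i \<in> RS" if "i < 3" for i using fR gg_carrier that by (auto simp: p_def)
  have nz: "cf (p i) s = 0" if "i < 3" "s \<notin> G" for i s using pR[OF that(1)] that(2) by (auto simp: RS_def)
  \<comment> \<open>The relation between the generators has coefficients in \<open>R\<close> after multiplication by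
    \<open>t^con\<close>.\<close>
  let ?w = "mon 1 con"
  have wR: "?w \<in> RS" "?w * td \<in> RS" "?w * ty \<in> RS"
    by (auto simp: mon_mult intro!: mon_in_RS con_in_G)
  have g0: "?w \<odot>\<^bsub>PM\<^esub> gg 0 = (?w * td) \<odot>\<^bsub>PM\<^esub> gg 1 \<oplus>\<^bsub>PM\<^esub> (?w * ty) \<odot>\<^bsub>PM\<^esub> gg 2"
    by (simp add: gg_def)
  have cM: "(?w * td) \<odot>\<^bsub>PM\<^esub> gg 1 \<in> carrier PM" "(?w * ty) \<odot>\<^bsub>PM\<^esub> gg 2 \<in> carrier PM"
    using wR gM PM.smult_closed by auto
  have sm: "f (r \<odot>\<^bsub>PM\<^esub> z) = r * f z" if "r \<in> RS" "z \<in> carrier PM" for r z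
    using self_hom_smult[OF f _ that(2), of r] that by simp
  have ad: "f (z \<oplus>\<^bsub>PM\<^esub> z') = f z + f z'" if "z \<in> carrier PM" "z' \<in> carrier PM" for z z'
    using self_hom_add[OF f that] by simp
  have "?w * p 0 = (?w * td) * p 1 + (?w * ty) * p 2"
    using arg_cong[OF g0, of f] unfolding sm[OF wR(1) gM(1)] ad[OF cM] sm[OF wR(2) gM(2)] sm[OF wR(3) gM(3)] p_def .
  then have "?w * p 0 = ?w * (td * p 1 + ty * p 2)" by (simp add: algebra_simps)
  then have rel: "p 0 = td * p 1 + ty * p 2" by simp
  have c: "cf (p 0) s = (if dl \<le> s then cf (p 1) (s - dl) else 0) + (if yy \<le> s then cf (p 2) (s - yy) else 0)" for s
    unfolding rel by (simp add: cf_mon_mult)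
  have "cf (p 0) 0 = 0" using c[of 0] dl_pos yy_pos by simp
  moreover have "cf (p 1) 0 = 0"
    using c[of dl] nz[of 0 dl] u(3) nz[of 2 "dl - yy"] dl_minus_yy dl_neq_yy by (cases "yy < dl") auto
  moreover have "cf (p 2) 0 = 0"
    using c[of yy] nz[of 0 yy] yy_notin nz[of 1 "yy - dl"] yy_minus_dl dl_neq_yy by (cases "dl < yy") auto
  moreover have three: "i = 0 \<or> i = 1 \<or> i = 2" if "i < 3" for i :: nat using that by auto
  ultimately have pm: "p i \<in> mm" if "i < 3" for i
    using three[OF that] pR[OF that] by (auto simp: mm_def)
  obtain v where v: "v \<in> {..<3} \<rightarrow> RS" "x = lc PM 3 gg v"
    using generatesD(2)[OF module_PM generates_gg x] by blast
  have "f (lc PM 3 gg v) = v 0 * p 0 + (v 1 * p 1 + v 2 * p 2)"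
  proof -
    have c: "v i \<odot>\<^bsub>PM\<^esub> gg i \<in> carrier PM" if "i < 3" for i
      using that v(1) gg_carrier by (intro PM.smult_closed) auto
    have vi: "v 0 \<in> RS" "v 1 \<in> RS" "v 2 \<in> RS" using v(1) by auto
    have c3: "v 0 \<odot>\<^bsub>PM\<^esub> gg 0 \<in> carrier PM" "v 1 \<odot>\<^bsub>PM\<^esub> gg 1 \<in> carrier PM" "v 2 \<odot>\<^bsub>PM\<^esub> gg 2 \<in> carrier PM"
      using c by auto
    show ?thesis unfolding lc_3[OF gg_carrier v(1)]
      by (simp only: ad[OF c3(1) PM.M.a_closed[OF c3(2,3)]] ad[OF c3(2,3)]
          sm[OF vi(1) gM(1)] sm[OF vi(2) gM(2)] sm[OF vi(3) gM(3)] p_def)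
  qed
  moreover have "v i * p i \<in> mm" if "i < 3" for i using mm_mult pm[OF that] v(1) that by auto
  ultimately show ?thesis unfolding v(2) using ideal_subring_recordD(3)[OF ideal_mm] by simp
qed

text \<open>A term of \<open>v 0\<close> of exponent \<open>0\<close> or \<open>e\<close> would become a term of exponent \<open>u - e\<close> in \<open>v 1\<close>
or of exponent \<open>con - 1\<close> in \<open>v 2\<close>.\<close>

lemma relation_first:
  assumes v: "v \<in> {..<3} \<rightarrow> RS" "lc PM 3 gg v = \<zero>\<^bsub>PM\<^esub>"
  shows "v 1 = - (v 0 * td)" "v 2 = - (v 0 * ty)" "v 0 \<in> ge (Suc e)"
proof -
  have "v 0 * td + v 1 = 0" "v 0 * ty + v 2 = 0" using v lc_gg by auto
  then show 1: "v 1 = - (v 0 * td)" "v 2 = - (v 0 * ty)" by (auto simp: eq_neg_iff_add_eq_0 add.commute)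
  have vR: "v 0 \<in> RS" "v 1 \<in> RS" "v 2 \<in> RS" using v(1) by auto
  have d: "s + dl \<in> G" "s + yy \<in> G" "s \<in> G" if "cf (v 0) s \<noteq> 0" for s
  proof -
    have "cf (v 1) (s + dl) \<noteq> 0" "cf (v 2) (s + yy) \<noteq> 0"
      using that unfolding 1 by (simp_all add: mult.commute[of "v 0"] cf_mon_mult)
    then show "s + dl \<in> G" "s + yy \<in> G" "s \<in> G" using vR that by (auto simp: RS_def)
  qed
  show "v 0 \<in> ge (Suc e)" unfolding ge_def
  proof (intro CollectI allI impI, rule ccontr)
    fix s assume s: "s < Suc e" "cf (v 0) s \<noteq> 0"
    note d = d[OF s(2)]
    have "s = 0 \<or> s = e" using e(3)[OF d(3)] s(1) by (cases "s = 0") auto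
    then show False using d u(3) con_minus_1 less by auto
  qed
qed

lemma mu_PM: "mu R K mm PM = 3"
proof (rule mu_eqI[OF module_PM generates_gg])
  fix v i assume v: "v \<in> {..<3} \<rightarrow> RS" "lc PM 3 gg v = \<zero>\<^bsub>PM\<^esub>" and i: "i < (3::nat)"
  note r = relation_first[OF v]
  have "cf (v i) 0 = 0"
  proof -
    have "cf (v 0) 0 = 0" using r(3) by (simp add: ge_def)
    then have "cf (v 1) 0 = 0" "cf (v 2) 0 = 0" unfolding r(1,2) by (simp_all add: cf_mult)
    moreover have "i = 0 \<or> i = 1 \<or> i = 2" using i by auto
    ultimately show ?thesis using \<open>cf (v 0) 0 = 0\<close> by auto
  qed
  then show "v i \<in> mm" using v(1) i by (auto simp: mm_def)
qed

text \<open>The first coordinate times \<open>t\<^sup>e\<close> maps the module to \<open>R\<close>, since \<open>t\<^sup>e t^(u-e) = t\<^sup>u\<close>. A map \<open>H\<close> from the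
syzygy to \<open>R\<close> is multiplication of the first coordinate by a fraction \<open>p / t^con\<close>. On the
conductor, which is part of the syzygy, this shows \<open>p V \<subseteq> R\<close>, so the fraction lies in \<open>V\<close> and
\<open>H\<close> preserves the property of having order above \<open>e\<close>.\<close>

lemma trace_not_subset:
  "\<not> trace_ideal R PM \<subseteq> trace_ideal R (syzygy R PM 3 gg)"
proof
  assume sub: "trace_ideal R PM \<subseteq> trace_ideal R (syzygy R PM 3 gg)"
  let ?f = "\<lambda>x. mon 1 e * fst (dec x)"
  have uR: "mon 1 e * (a * td + b) \<in> RS" if "a \<in> RS" "b \<in> RS" for a b
  proof -
    have "mon 1 e * (a * td + b) = a * mon 1 u + mon 1 e * b"
      using u(2) mon_mult[of 1 e 1 dl] by (simp add: algebra_simps)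
    then show ?thesis using that u(1) e(1) by (auto intro!: RS_add RS_mult mon_in_RS)
  qed
  have "?f \<in> module_hom R PM (self_module R)"
  proof (rule self_homI)
    fix x assume "x \<in> carrier PM"
    then obtain a b c where "x = enc (a * td + b, a * ty + c)" "a \<in> RS" "b \<in> RS" by (auto simp: C_def)
    then show "?f x \<in> RS" using uR by simp
  next
    fix x y assume "x \<in> carrier PM" "y \<in> carrier PM"
    then show "?f (x \<oplus>\<^bsub>PM\<^esub> y) = ?f x + ?f y" by (auto simp: distrib_left)
  next
    fix r x assume "x \<in> carrier PM"
    then show "?f (r \<odot>\<^bsub>PM\<^esub> x) = r * ?f x" by (auto simp: mult.left_commute)
  qed
  moreover have "gg 1 \<in> carrier PM" using gg_carrier by auto
  ultimately have "?f (gg 1) \<in> trace_ideal R PM" by (rule in_trace)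
  then have in1: "mon 1 e \<in> trace_ideal R (syzygy R PM 3 gg)" using sub by (auto simp: gg_def)
  let ?S = "syzygy R PM 3 gg"
  \<comment> \<open>The relation with first coefficient \<open>w\<close>; it is in the syzygy for every \<open>w\<close> of the conductor.\<close>
  define vec where "vec = (\<lambda>w. \<lambda>i\<in>{..<3::nat}. if i = 0 then w else if i = 1 then - (w * td) else - (w * ty))"
  have "trace_ideal R ?S \<subseteq> {x \<in> RS. x \<in> ge (Suc e)}"
  proof (rule trace_least[OF ge_G_ideal])
    fix H v assume H: "H \<in> module_hom R ?S (self_module R)" and v: "v \<in> carrier ?S"
    have vv: "v \<in> {..<3} \<rightarrow>\<^sub>E RS" "lc PM 3 gg v = \<zero>\<^bsub>PM\<^esub>" using v by (auto simp: syzygy_carrier)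
    then have vP: "v \<in> {..<3} \<rightarrow> RS" by auto
    note r = relation_first[OF vP vv(2)]
    have HR: "H w \<in> RS" if "w \<in> carrier ?S" for w using self_hom_closed[OF H that] by simp
    have Hs: "H (a \<odot>\<^bsub>?S\<^esub> w) = a * H w" if "a \<in> RS" "w \<in> carrier ?S" for a w
      using self_hom_smult[OF H _ that(2), of a] that(1) by simp
    have vec_mem: "vec w \<in> carrier ?S" if "w \<in> ge con" for w
    proof -
      have wR: "w \<in> RS" "w * td \<in> RS" "w * ty \<in> RS" using that ge_con_subset ge_mult_right by blast+
      have vP: "vec w \<in> {..<3} \<rightarrow>\<^sub>E RS" using wR by (auto simp: vec_def)
      then have "lc PM 3 gg (vec w) = enc (vec w 0 * td + vec w 1, vec w 0 * ty + vec w 2)" by (intro lc_gg) auto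
      also have "\<dots> = \<zero>\<^bsub>PM\<^esub>" by (simp add: vec_def)
      finally show ?thesis using vP by (simp add: syzygy_carrier)
    qed
    have v_vec: "v = vec (v 0)"
    proof
      fix i :: nat
      show "v i = vec (v 0) i"
      proof (cases "i < 3")
        case True
        then have "i = 0 \<or> i = 1 \<or> i = 2" by auto
        then show ?thesis using r(1,2) by (auto simp: vec_def)
      next
        case False
        then show ?thesis using vv(1) by (auto simp: vec_def PiE_def extensional_def)
      qed
    qed
    have smv: "a \<odot>\<^bsub>?S\<^esub> vec w = vec (a * w)" for a w by (auto simp: syzygy_ops vec_def fun_eq_iff algebra_simps)
    let ?t = "mon 1 con"
    have tR: "?t \<in> RS" by (intro mon_in_RS con_in_G) simp
    have tg: "?t * w \<in> ge con" "?t \<in> ge con" for w using mon_mult_in_ge[of 1 con 1] by auto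
    define p where "p = H (vec ?t)"
    have pV: "p * w \<in> RS" for w
    proof -
      have "?t * H (vec (?t * w)) = H (vec (?t * (?t * w)))"
        using Hs[OF tR vec_mem[OF tg(1)]] by (simp add: smv)
      also have "\<dots> = H (vec ((?t * w) * ?t))" by (simp add: algebra_simps)
      also have "\<dots> = (?t * w) * p"
        using Hs[OF subsetD[OF ge_con_subset tg(1)[of w]] vec_mem[OF tg(2)]] by (simp add: smv p_def)
      finally have "?t * H (vec (?t * w)) = ?t * (p * w)" by (simp add: algebra_simps)
      then have "H (vec (?t * w)) = p * w" by simp
      then show ?thesis using HR[OF vec_mem[OF tg(1)]] by metis
    qed
    have pc: "p \<in> ge con" unfolding ge_def
    proof (intro CollectI allI impI, rule ccontr)
      fix s assume s: "s < con" "cf p s \<noteq> 0"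
      have "cf (p * mon 1 (con - 1 - s)) (con - 1) = cf p s"
        using s(1) by (simp add: mult.commute[of p] cf_mon_mult)
      then show False using pV[of "mon 1 (con - 1 - s)"] s con_minus_1 by (auto simp: RS_def)
    qed
    then obtain q where q: "p = ?t * q" by (auto simp: ge_iff)
    have v0R: "v 0 \<in> RS" using vP by auto
    have "?t * H v = H (vec (?t * v 0))" using Hs[OF tR v] v_vec smv by metis
    also have "\<dots> = H (vec (v 0 * ?t))" by (simp add: mult.commute)
    also have "\<dots> = v 0 * p" using Hs[OF v0R vec_mem[OF tg(2)]] by (simp add: smv p_def)
    finally have "?t * H v = ?t * (v 0 * q)" by (simp add: q algebra_simps)
    then have "H v = v 0 * q" by simp
    then show "H v \<in> {x \<in> RS. x \<in> ge (Suc e)}" using HR[OF v] ge_mult_right[OF r(3)] by auto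
  qed
  with in1 have "mon 1 e \<in> ge (Suc e)" by auto
  then show False by (auto simp: ge_def cf_mon)
qed

lemma rank_PM: "module_rank R PM = 2"
proof -
  have upper: "card B \<le> 2" if B: "B \<subseteq> carrier PM" "finite B" "PM.lin_indpt B" for B
  proof (rule ccontr)
    assume "\<not> card B \<le> 2"
    then obtain T where T: "T \<subseteq> B" "card T = 3" using obtain_subset_with_card_n[of 3 B] by auto
    then obtain x y z where xyz: "T = {x, y, z}" "x \<noteq> y" "x \<noteq> z" "y \<noteq> z"
      by (auto simp: card_3_iff)
    define h where "h = (\<lambda>i::nat. if i = 0 then x else if i = 1 then y else z)"
    have im: "h ` {..<3} = T" unfolding lessThan_3 xyz by (auto simp: h_def)
    have hc: "h ` {..<3} \<subseteq> carrier PM" using im T B by auto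
    have hinj: "inj_on h {..<3}" unfolding lessThan_3 using xyz by (auto simp: inj_on_def h_def)
    have li: "PM.lin_indpt (h ` {..<3})" using PM.subset_li_is_li[OF B(3)] im T by simp
    have xc: "x \<in> carrier PM" "y \<in> carrier PM" "z \<in> carrier PM" using xyz T B by auto
    then obtain x1 x2 y1 y2 z1 z2 where enc: "x = enc (x1, x2)" "y = enc (y1, y2)" "z = enc (z1, z2)"
      by auto
    obtain a b c where abc: "a \<noteq> 0 \<or> b \<noteq> 0 \<or> c \<noteq> 0" "a * x1 + b * y1 + c * z1 = 0" "a * x2 + b * y2 + c * z2 = 0"
      using two_rows_dependent by blast
    define v where "v = (\<lambda>i::nat. mon 1 con * (if i = 0 then a else if i = 1 then b else c))"
    have vR: "v i \<in> RS" for i unfolding v_def using mon_mult_in_ge ge_con_subset by blast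
    have vP: "v \<in> {..<3} \<rightarrow> RS" using vR by auto
    have "lc PM 3 h v = enc (mon 1 con * (a * x1 + b * y1 + c * z1), mon 1 con * (a * x2 + b * y2 + c * z2))"
      unfolding lc_3[OF hc vP] by (simp add: h_def v_def enc algebra_simps)
    then have "lc PM 3 h v = \<zero>\<^bsub>PM\<^esub>" unfolding abc by simp
    then have "v i = 0" if "i < 3" for i
      using lin_indpt_familyD[OF module_PM hc hinj li, of v i] vR that by simp
    from this[of 0] this[of 1] this[of 2] show False using abc(1) by (simp add: v_def)
  qed
  define h where "h = (\<lambda>i::nat. if i = 0 then enc (1, 0) else enc (0, 1))"
  have hc: "h ` {..<2} \<subseteq> carrier PM" using CI[of 0 1 0] CI[of 0 0 1] by (auto simp: h_def)
  have "v i = 0" if v: "v \<in> {..<2} \<rightarrow> RS" "lc PM 2 h v = \<zero>\<^bsub>PM\<^esub>" and i: "i < 2" for v i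
  proof -
    define w where "w = (\<lambda>i. if i = 0 then 0 else v (i - 1))"
    have w: "w \<in> {..<3} \<rightarrow> RS" using v(1) by (auto simp: w_def)
    have c: "v 0 \<odot>\<^bsub>PM\<^esub> h 0 \<in> carrier PM" "v 1 \<odot>\<^bsub>PM\<^esub> h 1 \<in> carrier PM"
      using v(1) hc by (auto intro!: PM.smult_closed simp del: PM_simps)
    have "lc PM 2 h v = (\<Oplus>\<^bsub>PM\<^esub>i\<in>{0, 1::nat}. v i \<odot>\<^bsub>PM\<^esub> h i)"
      unfolding lc_def by (rule arg_cong[of _ _ "finsum PM _"]) auto
    also have "\<dots> = v 0 \<odot>\<^bsub>PM\<^esub> h 0 \<oplus>\<^bsub>PM\<^esub> (\<Oplus>\<^bsub>PM\<^esub>i\<in>{1::nat}. v i \<odot>\<^bsub>PM\<^esub> h i)"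
      using c by (intro PM.M.finsum_insert) auto
    also have "(\<Oplus>\<^bsub>PM\<^esub>i\<in>{1::nat}. v i \<odot>\<^bsub>PM\<^esub> h i) = v 1 \<odot>\<^bsub>PM\<^esub> h 1 \<oplus>\<^bsub>PM\<^esub> (\<Oplus>\<^bsub>PM\<^esub>i\<in>{}. v i \<odot>\<^bsub>PM\<^esub> h i)"
      using c by (intro PM.M.finsum_insert) auto
    finally have "lc PM 2 h v = enc (v 0, v 1)" by (simp add: h_def)
    then show ?thesis using v(2) i by (auto simp: less_2_cases_iff)
  qed
  then have li: "inj_on h {..<2}" "PM.lin_indpt (h ` {..<2})"
    using lin_indpt_family[OF module_PM hc] by auto
  show ?thesis unfolding module_rank_def
  proof (rule Greatest_equality)
    show "\<exists>B\<subseteq>carrier PM. finite B \<and> card B = 2 \<and> PM.lin_indpt B"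
      using li hc by (intro exI[of _ "h ` {..<2}"]) (auto simp: card_image)
    show "n \<le> 2" if "\<exists>B\<subseteq>carrier PM. finite B \<and> card B = n \<and> PM.lin_indpt B" for n
      using that upper by blast
  qed
qed

lemma no_free_summand_PM: "\<not> has_nonzero_free_summand R PM"
proof
  assume "has_nonzero_free_summand R PM"
  then obtain f x where "f \<in> module_hom R PM (self_module R)" "x \<in> carrier PM" "f x = 1"
    using free_summand_coordinate[OF module_PM] by blast
  then show False using hom_in_mm[of f x] by (simp add: mm_def cf_1)
qed

end

section \<open>The maximal ideal and its multiplicity\<close>

context semigroup_ring
begin

text \<open>Every exponent of an element of \<open>mm\<close> is assigned a generator that can be subtracted from it; collecting
the terms assigned to the same generator writes the element as a finite combination.\<close>

lemma genideal_eq_mm: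
  assumes fin: "finite A" and A: "A \<subseteq> G" "0 \<notin> A"
    and dec: "\<And>s. s \<in> G \<Longrightarrow> 0 < s \<Longrightarrow> \<exists>a\<in>A. a \<le> s \<and> s - a \<in> G"
  shows "genideal R (mon 1 ` A) = mm"
proof
  have sub: "mon 1 ` A \<subseteq> mm" using A by (auto simp: mm_def cf_mon intro!: mon_in_RS gr0I)
  then show "genideal R (mon 1 ` A) \<subseteq> mm" by (rule R.genideal_minimal[OF ideal_mm])
  have "mon 1 ` A \<subseteq> carrier R" using sub mm_subset by auto
  note gi = R.genideal_ideal[OF this] R.genideal_self[OF this]
  note I = ideal_subring_recordD[OF gi(1)]
  show "mm \<subseteq> genideal R (mon 1 ` A)"
  proof
    fix f assume f: "f \<in> mm"
    obtain al where al: "\<And>s. s \<in> G \<Longrightarrow> 0 < s \<Longrightarrow> al s \<in> A \<and> al s \<le> s \<and> s - al s \<in> G"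
      using dec by metis
    define T where "T = (\<lambda>a. {s \<in> G. 0 < s \<and> al s = a})"
    have "\<forall>a. \<exists>h. \<forall>n. cf h n = cf (restr (T a) f) (n + a)" using shift_ex by blast
    then obtain h where h: "\<And>a n. cf (h a) n = cf (restr (T a) f) (n + a)" by metis
    have hR: "h a \<in> RS" for a
      unfolding RS_def
    proof (intro CollectI allI impI)
      fix n assume "cf (h a) n \<noteq> 0"
      then have "n + a \<in> G" "0 < n + a" "al (n + a) = a" by (auto simp: h T_def split: if_splits)
      then show "n \<in> G" using al[of "n + a"] by simp
    qed
    have "f = (\<Sum>a\<in>A. mon 1 a * h a)"
    proof (rule cf_ext)
      fix n
      have "cf (mon 1 a * h a) n = (if a = al n then if n \<in> G \<and> 0 < n then cf f n else 0 else 0)" for a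
        using al[of n] by (auto simp: cf_mon_mult h T_def)
      then have "cf (\<Sum>a\<in>A. mon 1 a * h a) n = (\<Sum>a\<in>A. if a = al n then if n \<in> G \<and> 0 < n then cf f n else 0 else 0)"
        by (simp add: cf_sum)
      also have "\<dots> = cf f n"
        using fin al[of n] f by (auto simp: mm_def RS_def)
      finally show "cf f n = cf (\<Sum>a\<in>A. mon 1 a * h a) n" ..
    qed
    moreover have "(\<Sum>a\<in>B. mon 1 a * h a) \<in> genideal R (mon 1 ` A)" if "finite B" "B \<subseteq> A" for B
      using that
    proof (induction B)
      case (insert a B)
      have "mon 1 a * h a \<in> genideal R (mon 1 ` A)"
        using I(5)[OF hR] gi(2) insert(4) by blast
      then show ?case using insert I(3) by simp
    qed (use I(2) in simp)
    ultimately show "f \<in> genideal R (mon 1 ` A)" using fin by simp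
  qed
qed

lemma module_self: "Module.module R (self_module R)"
proof (rule module_criteria)
  show "\<forall>v\<in>carrier (self_module R). \<exists>neg_v\<in>carrier (self_module R). v \<oplus>\<^bsub>self_module R\<^esub> neg_v = \<zero>\<^bsub>self_module R\<^esub>"
    using RS_uminus by (auto intro!: bexI[of _ "- _"])
qed (auto simp: cring_R algebra_simps)

lemma ideal_submodule: "ideal I R \<Longrightarrow> LinearCombinations.submodule R I (self_module R)"
  by (frule ideal_subring_recordD(1), frule ideal_subring_recordD(2))
    (auto simp: LinearCombinations.submodule_def module_self ideal_subring_recordD(3,4))

definition orders_below :: "nat \<Rightarrow> 'a set \<Rightarrow> nat set" where
  "orders_below B I = {s. s < B \<and> (\<exists>x\<in>I. x \<in> ge s \<and> cf x s \<noteq> 0)}"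

text \<open>Elements of \<open>J\<close> are approximated by elements of \<open>I\<close>, one order at a time, until the difference
has order at least \<open>B\<close>.\<close>

lemma subset_of_orders:
  assumes I: "ideal I R" and J: "ideal J R" and IJ: "I \<subseteq> J" and B: "ge B \<inter> RS \<subseteq> I"
    and ord: "orders_below B J \<subseteq> orders_below B I"
  shows "J \<subseteq> I"
proof
  note I = ideal_subring_recordD[OF I] and J = ideal_subring_recordD[OF J]
  have claim: "x \<in> I" if "x \<in> J" "x \<in> ge l" for x l
    using that
  proof (induction "B - l" arbitrary: l x)
    case 0
    then show ?case using B ge_mono[of B l] J(1) by auto
  next
    case (Suc k)
    obtain y where y: "y \<in> I" "y \<in> ge l" "cf y l = cf x l"
    proof (cases "cf x l = 0")
      case True
      then show ?thesis using that[of 0] I(2) by simp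
    next
      case False
      then have "l \<in> orders_below B J" using Suc.prems Suc.hyps(2) by (auto simp: orders_below_def)
      then have "l \<in> orders_below B I" using ord by blast
      then obtain z where z: "z \<in> I" "z \<in> ge l" "cf z l \<noteq> 0" by (auto simp: orders_below_def)
      have "mon (cf x l / cf z l) 0 * z \<in> I" using I(4)[OF mon_in_RS[OF zero_in_G] z(1)] .
      then show ?thesis
        by (rule that) (use z in \<open>auto simp: cf_mon_mult intro!: ge_mult_left\<close>)
    qed
    have my: "(- 1) * y \<in> I" using I(4) RS_uminus[OF RS_1] y(1) by blast
    have "x - y \<in> I"
    proof (rule Suc.hyps(1))
      show "k = B - Suc l" using Suc.hyps(2) by simp
      show "x - y \<in> J" using J(3)[OF Suc.prems(1), of "(- 1) * y"] my IJ by auto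
      show "x - y \<in> ge (Suc l)" using y Suc.prems(2) by (simp add: ge_Suc ge_diff)
    qed
    then show ?case using I(3)[OF _ y(1)] by (metis diff_add_cancel)
  qed
  show "x \<in> I" if "x \<in> J" for x using claim[of x 0] that by simp
qed

text \<open>Each step of the chain adds a new order below \<open>B\<close>.\<close>

lemma ideal_chain_length:
  assumes I: "\<And>i. i \<le> l \<Longrightarrow> ideal (I i) R" and strict: "\<And>i. i < l \<Longrightarrow> I i \<subset> I (Suc i)"
    and B: "ge B \<inter> RS \<subseteq> I 0"
  shows "l \<le> B"
proof -
  have sub: "I 0 \<subseteq> I i" if "i \<le> l" for i
    using that
  proof (induction i)
    case (Suc i)
    then show ?case using strict[of i] by auto
  qed simp
  have "i \<le> card (orders_below B (I i))" if "i \<le> l" for i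
    using that
  proof (induction i)
    case (Suc i)
    have "orders_below B (I i) \<subseteq> orders_below B (I (Suc i))"
      using strict[of i] Suc.prems by (auto simp: orders_below_def)
    moreover have "\<not> orders_below B (I (Suc i)) \<subseteq> orders_below B (I i)"
    proof
      assume "orders_below B (I (Suc i)) \<subseteq> orders_below B (I i)"
      then have "I (Suc i) \<subseteq> I i"
        using subset_of_orders[OF I[of i] I[of "Suc i"]] strict[of i] Suc.prems B sub[of i] by auto
      with strict[of i] Suc.prems show False by auto
    qed
    moreover have "finite (orders_below B (I (Suc i)))" by (simp add: orders_below_def)
    ultimately have "card (orders_below B (I i)) < card (orders_below B (I (Suc i)))"
      by (intro psubset_card_mono) auto
    then show ?case using Suc by simp
  qed simp
  then have "l \<le> card (orders_below B (I l))" by simp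
  also have "\<dots> \<le> card {..<B}" by (intro card_mono) (auto simp: orders_below_def)
  finally show ?thesis by simp
qed

lemma length_quot_upper:
  assumes J: "ideal J R" and B: "ge B \<inter> RS \<subseteq> J"
  shows "module_length R (quot_module (self_module R) J) \<le> enat B"
  unfolding module_length_def
proof (rule Sup_least, clarsimp)
  let ?S = "self_module R" let ?Q = "quot_module ?S J"
  fix l N assume N: "\<forall>i\<le>l. LinearCombinations.submodule R (N i) ?Q" and strict: "\<forall>i<l. N i \<subset> N (Suc i)"
  have sJ: "LinearCombinations.submodule R J ?S" by (rule ideal_submodule[OF J])
  define I where "I = (\<lambda>i. {x \<in> RS. J +>\<^bsub>?S\<^esub> x \<in> N i})"
  show "l \<le> B"
  proof (rule ideal_chain_length)
    fix i assume i: "i \<le> l"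
    interpret Ni: LinearCombinations.submodule R "N i" ?Q using N i by blast
    show "ideal (I i) R"
    proof (rule idealI_R)
      have "J +>\<^bsub>?S\<^esub> 0 = \<zero>\<^bsub>?Q\<^esub>"
        using quot_zero_iff[OF sJ, of 0] ideal_subring_recordD(2)[OF J] by (simp add: quot_module_simps)
      then show "0 \<in> I i" using Ni.zero_closed by (simp add: I_def)
      show "x + y \<in> I i" if "x \<in> I i" "y \<in> I i" for x y
        using that quot_add[OF sJ, of x y] Ni.m_closed[of "J +>\<^bsub>?S\<^esub> x" "J +>\<^bsub>?S\<^esub> y"] by (auto simp: I_def)
      show "r * x \<in> I i" if "r \<in> RS" "x \<in> I i" for r x
        using that quot_smult[OF sJ, of r x] Ni.smult_closed[of r "J +>\<^bsub>?S\<^esub> x"] by (auto simp: I_def)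
    qed (auto simp: I_def)
  next
    fix i assume i: "i < l"
    then have sub: "N i \<subset> N (Suc i)" using strict by blast
    then obtain X where X: "X \<in> N (Suc i)" "X \<notin> N i" by blast
    have "N (Suc i) \<subseteq> carrier ?Q" using N i LinearCombinations.submodule.subset by (metis Suc_leI)
    then obtain x where "x \<in> RS" "X = J +>\<^bsub>?S\<^esub> x" using X quot_carrier[OF sJ] by auto
    then show "I i \<subset> I (Suc i)" using X sub by (auto simp: I_def)
  next
    interpret N0: LinearCombinations.submodule R "N 0" ?Q using N by blast
    show "ge B \<inter> RS \<subseteq> I 0"
    proof
      fix x assume x: "x \<in> ge B \<inter> RS"
      then have "J +>\<^bsub>?S\<^esub> x = \<zero>\<^bsub>?Q\<^esub>" using quot_zero_iff[OF sJ, of x] B by (auto simp: quot_module_simps)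
      then show "x \<in> I 0" using N0.zero_closed x by (simp add: I_def)
    qed
  qed
qed

text \<open>The ideals \<open>ge (B - k)\<close> with \<open>B - k \<ge> con\<close> are contained in \<open>R\<close> and form a chain above \<open>J\<close>.\<close>

lemma length_quot_lower:
  assumes J: "ideal J R" and B: "J \<subseteq> ge B"
  shows "enat (B - con) \<le> module_length R (quot_module (self_module R) J)"
  unfolding module_length_def
proof (rule Sup_upper, intro CollectI exI[of _ "B - con"] conjI refl allI impI)
  let ?S = "self_module R" let ?Q = "quot_module ?S J"
  have sJ: "LinearCombinations.submodule R J ?S" by (rule ideal_submodule[OF J])
  interpret Q: module R ?Q by (rule module_quot[OF sJ])
  interpret J: abelian_subgroup J ?S by (rule submodule_abelian_subgroup[OF sJ])
  define N where "N = (\<lambda>k. {J +>\<^bsub>?S\<^esub> x | x. x \<in> RS \<and> x \<in> ge (B - k)})"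
  show "\<exists>N. (\<forall>i\<le>B - con. LinearCombinations.submodule R (N i) ?Q) \<and> (\<forall>i<B - con. N i \<subset> N (Suc i))"
  proof (intro exI[of _ N] conjI allI impI)
    fix k
    show "LinearCombinations.submodule R (N k) ?Q"
    proof (unfold_locales, goal_cases)
      case 1 show ?case by (auto simp: N_def quot_carrier[OF sJ])
    next
      case (2 X Y)
      then obtain x y where "X = J +>\<^bsub>?S\<^esub> x" "Y = J +>\<^bsub>?S\<^esub> y" "x \<in> RS" "y \<in> RS" "x \<in> ge (B - k)" "y \<in> ge (B - k)"
        by (auto simp: N_def)
      then show ?case using quot_add[OF sJ, of x y] ge_add RS_add by (auto simp: N_def)
    next
      case 3
      have "J +>\<^bsub>?S\<^esub> 0 = \<zero>\<^bsub>?Q\<^esub>"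
        using quot_zero_iff[OF sJ, of 0] ideal_subring_recordD(2)[OF J] by (simp add: quot_module_simps)
      then show ?case unfolding N_def by (metis (mono_tags, lifting) CollectI RS_0 zero_in_ge)
    next
      case (4 r X)
      then obtain x where "X = J +>\<^bsub>?S\<^esub> x" "x \<in> RS" "x \<in> ge (B - k)" by (auto simp: N_def)
      then show ?case using quot_smult[OF sJ, of r x] 4(1) ge_mult_left RS_mult by (auto simp: N_def)
    qed
  next
    fix k assume k: "k < B - con"
    define x where "x = mon 1 (B - Suc k)"
    have xR: "x \<in> RS" "x \<in> ge (B - Suc k)"
      using k con_in_G mon_mult_in_ge[of 1 "B - Suc k" 1] by (auto simp: x_def intro!: mon_in_RS)
    have "J +>\<^bsub>?S\<^esub> x \<notin> N k"
    proof
      assume "J +>\<^bsub>?S\<^esub> x \<in> N k"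
      then obtain z where z: "J +>\<^bsub>?S\<^esub> x = J +>\<^bsub>?S\<^esub> z" "z \<in> RS" "z \<in> ge (B - k)" by (auto simp: N_def)
      have "x \<in> J +>\<^bsub>?S\<^esub> x" using J.a_rcos_self xR by simp
      then obtain j where "j \<in> J" "x = j + z" unfolding z(1) by (auto simp: a_r_coset_def')
      then have "x \<in> ge (B - k)" using B ge_mono[of "B - k" B] z(3) ge_add by auto
      then have "cf x (B - Suc k) = 0" using k by (auto simp: ge_def)
      then show False by (simp add: x_def cf_mon)
    qed
    moreover have "J +>\<^bsub>?S\<^esub> x \<in> N (Suc k)" using xR by (auto simp: N_def)
    moreover have "ge (B - k) \<subseteq> ge (B - Suc k)" by (rule ge_mono) simp
    then have "N k \<subseteq> N (Suc k)" unfolding N_def by blast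
    ultimately show "N k \<subset> N (Suc k)" by blast
  qed
qed

lemma mm_power:
  assumes e: "e \<in> G" "0 < e" "\<And>s. s \<in> G \<Longrightarrow> 0 < s \<Longrightarrow> e \<le> s"
  shows "ideal (mm [^]\<^bsub>ideals_set R\<^esub> (n::nat)) R \<and> mm [^]\<^bsub>ideals_set R\<^esub> n \<subseteq> ge (n * e) \<and>
    mon 1 (n * e) \<in> mm [^]\<^bsub>ideals_set R\<^esub> n"
proof (induction n)
  case 0
  then show ?case using R.oneideal by (simp add: ideals_set_def mon_1_0)
next
  case (Suc n)
  let ?P = "mm [^]\<^bsub>ideals_set R\<^esub> n"
  have pow: "mm [^]\<^bsub>ideals_set R\<^esub> Suc n = ?P \<cdot>\<^bsub>R\<^esub> mm" by (simp add: ideals_set_def)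
  have mge: "mm \<subseteq> ge e"
  proof
    fix x assume x: "x \<in> mm"
    have "cf x i = 0" if "i < e" for i
      using x e(3)[of i] that by (cases "i = 0") (auto simp: mm_def RS_def)
    then show "x \<in> ge e" by (simp add: ge_def)
  qed
  have "x \<in> ge (Suc n * e)" if "x \<in> ?P \<cdot>\<^bsub>R\<^esub> mm" for x
    using that
  proof (induction x rule: ideal_prod.induct)
    case (prod i j)
    then show ?case using Suc.IH mge ge_mult[of i "n * e" j e] by (auto simp: add.commute)
  next
    case (sum x y)
    then show ?case using ge_add by simp
  qed
  moreover have "mon 1 (n * e) \<otimes>\<^bsub>R\<^esub> mon 1 e \<in> ?P \<cdot>\<^bsub>R\<^esub> mm"
    using Suc.IH e by (intro ideal_prod.prod) (auto simp: mm_def cf_mon intro!: mon_in_RS)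
  moreover have "mon 1 (n * e) * mon 1 e = mon 1 (Suc n * e)" by (simp add: mon_mult add.commute)
  ultimately show ?case unfolding pow using R.ideal_prod_is_ideal[OF _ ideal_mm] Suc.IH by auto
qed

text \<open>The \<open>n\<close>-th power of the maximal ideal lies between \<open>ge (n * e + con)\<close> and \<open>ge (n * e)\<close>, so the
length of the quotient differs from \<open>n * e\<close> by at most \<open>con\<close>.\<close>

lemma hs_multiplicity_eq:
  assumes e: "e \<in> G" "0 < e" "\<And>s. s \<in> G \<Longrightarrow> 0 < s \<Longrightarrow> e \<le> s"
  shows "hs_multiplicity R mm = real e"
proof -
  define L where "L = (\<lambda>n::nat. module_length R (quot_module (self_module R) (mm [^]\<^bsub>ideals_set R\<^esub> n)))"
  have bounds: "enat (n * e - con) \<le> L n \<and> L n \<le> enat (n * e + con)" for n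
  proof
    let ?P = "mm [^]\<^bsub>ideals_set R\<^esub> n"
    have P: "ideal ?P R" "?P \<subseteq> ge (n * e)" "mon 1 (n * e) \<in> ?P" using mm_power[OF e, of n] by auto
    show "enat (n * e - con) \<le> L n" unfolding L_def by (rule length_quot_lower[OF P(1,2)])
    have "x \<in> ?P" if h: "x \<in> ge (n * e + con)" for x
    proof -
      obtain y where y: "x = mon 1 (n * e + con) * y" using h by (auto simp: ge_iff)
      then have "x = (mon 1 con * y) * mon 1 (n * e)"
        using mon_mult[of 1 "n * e" 1 con] by (simp add: algebra_simps)
      moreover have "mon 1 con * y \<in> RS" using ge_con_subset by auto
      ultimately show ?thesis using ideal_subring_recordD(4)[OF P(1) _ P(3)] by simp
    qed
    then show "L n \<le> enat (n * e + con)" unfolding L_def by (intro length_quot_upper[OF P(1)]) blast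
  qed
  have lb: "real n * real e - real con \<le> real (the_enat (L n))"
    and ub: "real (the_enat (L n)) \<le> real n * real e + real con" for n
  proof -
    obtain l where l: "L n = enat l" using bounds[of n] by (cases "L n") auto
    then have "n * e - con \<le> l" "l \<le> n * e + con" using bounds[of n] by auto
    then have "n * e \<le> l + con" "l \<le> n * e + con" by auto
    then have "real (n * e) \<le> real (l + con)" "real l \<le> real (n * e + con)" by (simp_all only: of_nat_le_iff)
    then show "real n * real e - real con \<le> real (the_enat (L n))"
      "real (the_enat (L n)) \<le> real n * real e + real con" using l by simp_all
  qed
  have c0: "(\<lambda>n. real con / real n) \<longlonglongrightarrow> 0" by (rule lim_const_over_n)
  have "(\<lambda>n. real (the_enat (L n)) / real n) \<longlonglongrightarrow> real e"
  proof (rule tendsto_sandwich)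
    show "(\<lambda>n. real e - real con / real n) \<longlonglongrightarrow> real e" using tendsto_diff[OF tendsto_const c0, of "real e"] by simp
    show "(\<lambda>n. real e + real con / real n) \<longlonglongrightarrow> real e" using tendsto_add[OF tendsto_const c0, of "real e"] by simp
    show "\<forall>\<^sub>F n in sequentially. real e - real con / real n \<le> real (the_enat (L n)) / real n"
      using eventually_gt_at_top[of 0]
    proof eventually_elim
      case (elim n)
      then show ?case using divide_right_mono[OF lb[of n], of "real n"] by (simp add: field_simps)
    qed
    show "\<forall>\<^sub>F n in sequentially. real (the_enat (L n)) / real n \<le> real e + real con / real n"
      using eventually_gt_at_top[of 0]
    proof eventually_elim
      case (elim n)
      then show ?case using divide_right_mono[OF ub[of n], of "real n"] by (simp add: field_simps)
    qed
  qed
  then show ?thesis unfolding hs_multiplicity_def L_def by (rule limI)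
qed

lemma in_ge_conI:
  assumes "\<And>w. p * w \<in> RS" shows "p \<in> ge con"
  unfolding ge_def
proof (intro CollectI allI impI, rule ccontr)
  fix s assume s: "s < con" "cf p s \<noteq> 0"
  have "cf (p * mon 1 (con - 1 - s)) (con - 1) = cf p s"
    using s(1) by (simp add: mult.commute[of p] cf_mon_mult)
  then show False using assms[of "mon 1 (con - 1 - s)"] s con_least by (auto simp: RS_def)
qed

end

section \<open>The conductor\<close>

lemma to_fract_power: "to_fract (x ^ n) = to_fract x ^ n"
  by (induction n) auto

lemma coeff_linear_power_in:
  assumes "0 \<in> S" "1 \<in> S" "\<And>x y. x \<in> S \<Longrightarrow> y \<in> S \<Longrightarrow> x + y \<in> S"
    "\<And>x y. x \<in> S \<Longrightarrow> y \<in> S \<Longrightarrow> x * y \<in> S" "b \<in> S"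
  shows "coeff ([:b, 1:] ^ n) i \<in> S"
proof (induction n arbitrary: i)
  case 0
  then show ?case using assms(1,2) by (simp add: coeff_pCons split: nat.split)
next
  case (Suc n)
  have "coeff ([:b, 1:] ^ Suc n) i = b * coeff ([:b, 1:] ^ n) i + coeff (pCons 0 ([:b, 1:] ^ n)) i"
    by simp
  then show ?case using assms Suc by (auto simp: coeff_pCons split: nat.split)
qed

context semigroup_ring
begin

lemma total_quotient_ring_RS: "total_quotient_ring RS = UNIV"
proof -
  have "q \<in> total_quotient_ring RS" for q
  proof (cases q rule: Fract_cases)
    case (Fract a b)
    let ?t = "mon 1 con"
    have "q = Fraction_Field.Fract (?t * a) (?t * b)"
      using Fract mult_fract_cancel[of ?t a b] by simp
    moreover have "?t * a \<in> RS" "?t * b \<in> RS" using ge_con_subset by auto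
    ultimately show ?thesis unfolding total_quotient_ring_def using Fract(2)
      by (intro CollectI exI[of _ "?t * a"] exI[of _ "?t * b"]) auto
  qed
  then show ?thesis by blast
qed

text \<open>Without its constant term, \<open>v\<close> has positive order, so a power of it lies in the conductor. This is an
integral equation over \<open>R\<close>.\<close>

lemma to_fract_integral: "to_fract v \<in> integral_closure RS"
proof -
  define x where "x = v - mon (cf v 0) 0"
  have x1: "x \<in> ge 1" by (auto simp: x_def ge_def cf_mon)
  have xn: "x ^ n \<in> ge n" for n
  proof (induction n)
    case (Suc n)
    then show ?case using ge_mult[OF x1 Suc] by simp
  qed simp
  let ?n = "Suc con"
  have xR: "x ^ ?n \<in> RS" using xn[of ?n] ge_mono[of con ?n] ge_con_subset by auto
  let ?b = "to_fract (- mon (cf v 0) 0)"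
  let ?L = "[:?b, 1:]"
  let ?p = "?L ^ ?n + [:- to_fract (x ^ ?n):]"
  have deg: "degree (?L ^ ?n) = ?n" by (rule degree_linear_power)
  have lc: "lead_coeff (?L ^ ?n) = 1" by (simp add: lead_coeff_power del: power_Suc)
  have degp: "degree ?p = ?n" using deg by (subst degree_add_eq_left) auto
  have "lead_coeff ?p = 1" using lc deg unfolding degp by (simp add: coeff_pCons del: power_Suc)
  moreover have "coeff ?p i \<in> to_fract ` RS" for i
  proof -
    have "coeff (?L ^ ?n) i \<in> to_fract ` RS"
    proof (rule coeff_linear_power_in)
      show "0 \<in> to_fract ` RS" by (rule image_eqI[of _ _ 0]) auto
      show "1 \<in> to_fract ` RS" by (rule image_eqI[of _ _ 1]) auto
      show "a + b \<in> to_fract ` RS" if "a \<in> to_fract ` RS" "b \<in> to_fract ` RS" for a b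
        using that by (auto simp flip: to_fract_add)
      show "a * b \<in> to_fract ` RS" if "a \<in> to_fract ` RS" "b \<in> to_fract ` RS" for a b
        using that by (auto simp flip: to_fract_mult)
      show "?b \<in> to_fract ` RS" by (intro imageI RS_uminus mon_in_RS) simp
    qed
    then obtain r where r: "r \<in> RS" "coeff (?L ^ ?n) i = to_fract r" by auto
    obtain s where s: "s \<in> RS" "coeff [:- to_fract (x ^ ?n):] i = to_fract s"
    proof (cases i)
      case 0
      have "- to_fract (x ^ ?n) = to_fract (- (x ^ ?n))" by simp
      then show ?thesis using that[of "- (x ^ ?n)"] xR RS_uminus 0 by simp
    next
      case (Suc j)
      then show ?thesis using that[of 0] by simp
    qed
    have "coeff ?p i = to_fract (r + s)" using r s by (simp del: power_Suc)
    then show ?thesis using r s by blast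
  qed
  moreover have "poly ?p (to_fract v) = 0"
  proof -
    have "poly ?p (to_fract v) = (?b + to_fract v) ^ ?n - to_fract (x ^ ?n)"
      by (simp del: power_Suc)
    also have "?b + to_fract v = to_fract x" unfolding x_def by simp
    finally show ?thesis by (simp add: to_fract_power del: power_Suc)
  qed
  ultimately show ?thesis
    unfolding integral_closure_def total_quotient_ring_RS by blast
qed

text \<open>Since \<open>V\<close> is principal, \<open>q\<close> can be written as a fraction in lowest terms. By the integral equation, the
denominator divides a power of the numerator, and is a unit.\<close>

lemma integral_in_V:
  assumes "q \<in> integral_closure RS" shows "q \<in> range to_fract"
proof -
  obtain p where p: "lead_coeff p = 1" "\<And>i. coeff p i \<in> to_fract ` RS" "poly p q = 0"
    using assms by (auto simp: integral_closure_def)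
  obtain a b where ab: "q = Fraction_Field.Fract a b" "b \<noteq> 0" by (cases q rule: Fract_cases) auto
  define J where "J = {a * w + b * z | w z. True}"
  have "\<exists>d\<in>J. d \<noteq> 0 \<and> (\<forall>y\<in>J. d dvd y)"
  proof (rule principal_ex[of J b])
    show "x + y \<in> J" if h: "x \<in> J" "y \<in> J" for x y
    proof -
      obtain w z w' z' where "x = a * w + b * z" "y = a * w' + b * z'" using h by (auto simp: J_def)
      then have "x + y = a * (w + w') + b * (z + z')" by (simp add: algebra_simps)
      then show ?thesis unfolding J_def by blast
    qed
    show "v * x \<in> J" if h: "x \<in> J" for v x
    proof -
      obtain w z where "x = a * w + b * z" using h by (auto simp: J_def)
      then have "v * x = a * (v * w) + b * (v * z)" by (simp add: algebra_simps)
      then show ?thesis unfolding J_def by blast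
    qed
    show "b \<in> J" unfolding J_def by (intro CollectI exI[of _ 0] exI[of _ 1]) simp
  qed (rule ab)
  then obtain d w z where d: "d \<noteq> 0" "\<And>y. y \<in> J \<Longrightarrow> d dvd y" "d = a * w + b * z" by (auto simp: J_def)
  have aJ: "a \<in> J" unfolding J_def by (intro CollectI exI[of _ 1] exI[of _ 0]) simp
  have bJ: "b \<in> J" unfolding J_def by (intro CollectI exI[of _ 0] exI[of _ 1]) simp
  obtain a' where a': "a = d * a'" using d(2)[OF aJ] by (rule dvdE)
  obtain b' where b': "b = d * b'" using d(2)[OF bJ] by (rule dvdE)
  note ab' = a' b'
  have "d * 1 = d * (a' * w + b' * z)" using d(3) unfolding ab' by (simp add: algebra_simps)
  then have one: "1 = a' * w + b' * z" using d(1) mult_left_cancel by blast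
  have b0: "b' \<noteq> 0" using ab(2) ab'(2) by auto
  have q: "q = to_fract a' / to_fract b'" using ab(1) ab' d(1) mult_fract_cancel[of d a' b'] Fract_conv_to_fract by simp
  define n where "n = degree p"
  have "\<forall>i. \<exists>r. coeff p i = to_fract r" using p(2) by blast
  then obtain c where c: "\<And>i. coeff p i = to_fract (c i)" by (auto dest: choice)
  have cn: "c n = 1" using p(1) c[of n] to_fract_eq_iff[of "c n" 1] by (simp add: n_def)
  have "0 = to_fract b' ^ n * poly p q" using p(3) by simp
  also have "\<dots> = (\<Sum>i\<le>n. to_fract (c i * a' ^ i * b' ^ (n - i)))"
    unfolding poly_altdef n_def[symmetric] sum_distrib_left
  proof (intro sum.cong refl)
    fix i assume "i \<in> {..n}"
    then have "to_fract b' ^ n = to_fract b' ^ i * to_fract b' ^ (n - i)" by (simp flip: power_add)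
    then show "to_fract b' ^ n * (coeff p i * q ^ i) = to_fract (c i * a' ^ i * b' ^ (n - i))"
      using b0 by (simp add: c q to_fract_power power_divide field_simps)
  qed
  also have "\<dots> = to_fract (\<Sum>i\<le>n. c i * a' ^ i * b' ^ (n - i))" by (simp add: to_fract_sum)
  finally have "to_fract (\<Sum>i\<le>n. c i * a' ^ i * b' ^ (n - i)) = 0" by (rule sym)
  then have z: "(\<Sum>i\<le>n. c i * a' ^ i * b' ^ (n - i)) = 0" by (simp only: to_fract_eq_0_iff)
  have split: "{..n} = insert n {..<n}" by auto
  have "a' ^ n = - (\<Sum>i<n. c i * a' ^ i * b' ^ (n - i))" using z unfolding split by (simp add: cn eq_neg_iff_add_eq_0)
  moreover have "b' dvd (\<Sum>i<n. c i * a' ^ i * b' ^ (n - i))"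
    by (intro dvd_sum dvd_mult dvd_power) auto
  ultimately have bn: "b' dvd a' ^ n" by simp
  have "b' dvd 1"
    using bn
  proof (induction n)
    case (Suc k)
    have "a' ^ k = a' ^ k * (a' * w + b' * z)" using one by simp
    also have "\<dots> = a' ^ Suc k * w + b' * (a' ^ k * z)" by (simp add: algebra_simps)
    finally have "a' ^ k = a' ^ Suc k * w + b' * (a' ^ k * z)" .
    moreover have "b' dvd a' ^ Suc k * w + b' * (a' ^ k * z)" using Suc.prems by (intro dvd_add dvd_mult2) auto
    ultimately show ?case using Suc.IH by metis
  qed simp
  then obtain v where v: "1 = b' * v" by (auto simp: dvd_def)
  then have "to_fract b' * to_fract v = 1" by (metis to_fract_1 to_fract_mult)
  then have iv: "to_fract v = inverse (to_fract b')" by (metis inverse_unique)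
  have "q = to_fract (a' * v)" unfolding q to_fract_mult iv by (simp add: divide_inverse)
  then show ?thesis by blast
qed

lemma conductor_eq: "conductor RS = to_fract ` ge con"
proof -
  have ic: "integral_closure RS = range to_fract" using to_fract_integral integral_in_V by blast
  show ?thesis unfolding conductor_def total_quotient_ring_RS ic
  proof (intro equalityI subsetI)
    fix q assume "q \<in> {q \<in> UNIV. \<forall>x\<in>range to_fract. q * x \<in> to_fract ` RS}"
    then have h: "q * to_fract v \<in> to_fract ` RS" for v by blast
    obtain r where r: "q = to_fract r" using h[of 1] by auto
    have "r * v \<in> RS" for v using h[of v] unfolding r by (auto simp flip: to_fract_mult)
    then have "r \<in> ge con" by (rule in_ge_conI)
    then show "q \<in> to_fract ` ge con" using r by blast
  next
    fix q assume "q \<in> to_fract ` ge con"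
    then obtain r where r: "q = to_fract r" "r \<in> ge con" by blast
    have "r * v \<in> RS" for v using ge_mult_right[OF r(2)] ge_con_subset by blast
    then show "q \<in> {q \<in> UNIV. \<forall>x\<in>range to_fract. q * x \<in> to_fract ` RS}"
      unfolding r(1) by (auto simp flip: to_fract_mult)
  qed
qed

lemma conductor_eq_iff: "conductor RS = to_fract ` mm \<longleftrightarrow> ge con = mm"
  unfolding conductor_eq by (rule inj_image_eq_iff) (auto simp: inj_def)

end

section \<open>The grading of the module\<close>

locale graded_pole_module =
  pole_module cf mon G con e u enc + graded_semigroup_ring cf mon G con
  for cf :: "'a::idom \<Rightarrow> nat \<Rightarrow> 'k::field" and mon G con e u and enc :: "'a \<times> 'a \<Rightarrow> 'm"
begin

definition CD :: "int \<Rightarrow> ('a \<times> 'a) set" where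
  "CD d = {p \<in> C. (\<forall>n. cf (fst p) n \<noteq> 0 \<longrightarrow> int n = d + int dl) \<and>
     (\<forall>n. cf (snd p) n \<noteq> 0 \<longrightarrow> int n = d + int yy)}"

definition DD :: "int \<Rightarrow> 'm set" where "DD d = enc ` CD d"

definition prj :: "int \<Rightarrow> 'a \<times> 'a \<Rightarrow> 'a \<times> 'a" where
  "prj d p = (restr {n. int n = d + int dl} (fst p), restr {n. int n = d + int yy} (snd p))"

lemma prj_in_C: assumes "p \<in> C" shows "prj d p \<in> C"
proof -
  obtain a b c where p: "p = (a * td + b, a * ty + c)" "a \<in> RS" "b \<in> RS" "c \<in> RS"
    using assms by (auto simp: C_def)
  let ?a = "restr {n. int n = d} a" and ?b = "restr {n. int n = d + int dl} b"
    and ?c = "restr {n. int n = d + int yy} c"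
  have "restr {n. int n = d + int m} (a * mon 1 m + z) = ?a * mon 1 m + restr {n. int n = d + int m} z" for m z
    by (rule cf_ext) (auto simp: mult.commute[of _ "mon 1 m"] cf_mon_mult)
  then have "prj d p = (?a * td + ?b, ?a * ty + ?c)" unfolding prj_def p by simp
  then show ?thesis using CI[of ?a ?b ?c] p restr_in_RS by simp
qed

lemma prj_in_CD: "p \<in> C \<Longrightarrow> prj d p \<in> CD d"
  using prj_in_C by (auto simp: CD_def prj_def split: if_splits)

lemma finsum_enc:
  assumes "finite F" "\<And>d. d \<in> F \<Longrightarrow> f d \<in> C"
  shows "(\<Oplus>\<^bsub>PM\<^esub>d\<in>F. enc (f d)) = enc (\<Sum>d\<in>F. fst (f d), \<Sum>d\<in>F. snd (f d))"
  using assms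
proof (induction F)
  case (insert d F)
  have "(\<Oplus>\<^bsub>PM\<^esub>d\<in>insert d F. enc (f d)) = enc (f d) \<oplus>\<^bsub>PM\<^esub> (\<Oplus>\<^bsub>PM\<^esub>d\<in>F. enc (f d))"
    using insert(1,2) insert(4) by (intro PM.M.finsum_insert) auto
  then show ?case using insert by (cases "f d") simp
qed simp

lemma subgroup_DD: "subgroup (DD d) (add_monoid PM)"
proof (rule PM.M.add.subgroupI)
  have C0: "(0, 0) \<in> CD d" using C_zero by (simp add: CD_def)
  show "DD d \<subseteq> carrier PM" by (auto simp: DD_def CD_def)
  show "DD d \<noteq> {}" using C0 by (auto simp: DD_def)
  show "x \<oplus>\<^bsub>PM\<^esub> y \<in> DD d" if "x \<in> DD d" "y \<in> DD d" for x y
  proof -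
    obtain p q where pq: "x = enc p" "y = enc q" "p \<in> CD d" "q \<in> CD d" using \<open>x \<in> DD d\<close> \<open>y \<in> DD d\<close> by (auto simp: DD_def)
    have "(fst p + fst q, snd p + snd q) \<in> CD d"
      using pq(3,4) C_add[of p q] unfolding CD_def by (auto, metis add.left_neutral, metis add.left_neutral)
    then show ?thesis using pq by (cases p; cases q) (auto simp: DD_def)
  qed
  show "\<ominus>\<^bsub>PM\<^esub> x \<in> DD d" if "x \<in> DD d" for x
  proof -
    obtain p where p: "x = enc p" "p \<in> CD d" using \<open>x \<in> DD d\<close> by (auto simp: DD_def)
    have pC: "p \<in> C" using p by (simp add: CD_def)
    have mC: "(- fst p, - snd p) \<in> C" using C_smult[OF pC RS_uminus[OF RS_1]] by simp
    have "\<ominus>\<^bsub>PM\<^esub> x = enc (- fst p, - snd p)"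
      using p(1) pC mC by (intro PM.M.minus_equality) (cases p; auto)+
    moreover have "(- fst p, - snd p) \<in> CD d" using mC p(2) by (auto simp: CD_def)
    ultimately show ?thesis by (auto simp: DD_def)
  qed
qed

text \<open>The component of degree \<open>d\<close> of a pair consists of its terms with exponents \<open>d + (u - e)\<close> and
\<open>d + (con - 1 - e)\<close>; these degrees make the generator \<open>gg 0\<close> homogeneous of degree \<open>0\<close>.\<close>

lemma decomposition_PM:
  assumes "x \<in> carrier PM"
  shows "\<exists>!v. (\<forall>d. v d \<in> DD d) \<and> finite {d. v d \<noteq> \<zero>\<^bsub>PM\<^esub>} \<and>
        x = (\<Oplus>\<^bsub>PM\<^esub>d\<in>{d. v d \<noteq> \<zero>\<^bsub>PM\<^esub>}. v d)"
proof -
  obtain p where p: "x = enc p" "p \<in> C" using assms by auto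
  let ?v = "\<lambda>d. enc (prj d p)"
  let ?F = "{d. ?v d \<noteq> \<zero>\<^bsub>PM\<^esub>}"
  have nz: "int n - int dl \<in> ?F" if "cf (fst p) n \<noteq> 0" for n
  proof
    show "?v (int n - int dl) \<noteq> \<zero>\<^bsub>PM\<^esub>"
    proof
      assume "?v (int n - int dl) = \<zero>\<^bsub>PM\<^esub>"
      then have "cf (restr {m. int m = int n - int dl + int dl} (fst p)) n = 0" by (simp add: prj_def)
      then show False using that by simp
    qed
  qed
  have nz2: "int n - int yy \<in> ?F" if "cf (snd p) n \<noteq> 0" for n
  proof
    show "?v (int n - int yy) \<noteq> \<zero>\<^bsub>PM\<^esub>"
    proof
      assume "?v (int n - int yy) = \<zero>\<^bsub>PM\<^esub>"
      then have "cf (restr {m. int m = int n - int yy + int yy} (snd p)) n = 0" by (simp add: prj_def)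
      then show False using that by simp
    qed
  qed
  have sub: "?F \<subseteq> (\<lambda>n. int n - int dl) ` {n. cf (fst p) n \<noteq> 0} \<union> (\<lambda>n. int n - int yy) ` {n. cf (snd p) n \<noteq> 0}"
  proof
    fix d assume d: "d \<in> ?F"
    show "d \<in> (\<lambda>n. int n - int dl) ` {n. cf (fst p) n \<noteq> 0} \<union> (\<lambda>n. int n - int yy) ` {n. cf (snd p) n \<noteq> 0}"
    proof (rule ccontr)
      assume no: "d \<notin> (\<lambda>n. int n - int dl) ` {n. cf (fst p) n \<noteq> 0} \<union> (\<lambda>n. int n - int yy) ` {n. cf (snd p) n \<noteq> 0}"
      have "restr {n. int n = d + int dl} (fst p) = 0"
        by (rule cf_ext) (use no in \<open>auto simp: image_iff\<close>)
      moreover have "restr {n. int n = d + int yy} (snd p) = 0"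
        by (rule cf_ext) (use no in \<open>auto simp: image_iff\<close>)
      ultimately show False using d by (simp add: prj_def)
    qed
  qed
  have fin: "finite ?F" using finite_subset[OF sub] finite_support by simp
  have sums: "(\<Sum>d\<in>?F. cf (restr {m. int m = d + int k} z) n) = (if int n - int k \<in> ?F then cf z n else 0)" for k z n
  proof -
    have "(\<Sum>d\<in>?F. cf (restr {m. int m = d + int k} z) n) = (\<Sum>d\<in>?F. if d = int n - int k then cf z n else 0)"
      by (intro sum.cong) auto
    then show ?thesis using fin by (simp del: PM_simps)
  qed
  show ?thesis
  proof (rule ex1I[of _ ?v])
    have "(\<Sum>d\<in>?F. fst (prj d p)) = fst p"
    proof (rule cf_ext)
      fix n
      have "cf (\<Sum>d\<in>?F. fst (prj d p)) n = (\<Sum>d\<in>?F. cf (restr {m. int m = d + int dl} (fst p)) n)"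
        unfolding cf_sum by (rule sum.cong[OF refl]) (simp only: prj_def fst_conv snd_conv)
      also have "\<dots> = (if int n - int dl \<in> ?F then cf (fst p) n else 0)" by (rule sums)
      also have "\<dots> = cf (fst p) n"
      proof (cases "cf (fst p) n = 0")
        case False
        then show ?thesis using nz[OF False] by (simp only: if_True)
      qed simp
      finally show "cf (\<Sum>d\<in>?F. fst (prj d p)) n = cf (fst p) n" .
    qed
    moreover have "(\<Sum>d\<in>?F. snd (prj d p)) = snd p"
    proof (rule cf_ext)
      fix n
      have "cf (\<Sum>d\<in>?F. snd (prj d p)) n = (\<Sum>d\<in>?F. cf (restr {m. int m = d + int yy} (snd p)) n)"
        unfolding cf_sum by (rule sum.cong[OF refl]) (simp only: prj_def fst_conv snd_conv)
      also have "\<dots> = (if int n - int yy \<in> ?F then cf (snd p) n else 0)" by (rule sums)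
      also have "\<dots> = cf (snd p) n"
      proof (cases "cf (snd p) n = 0")
        case False
        then show ?thesis using nz2[OF False] by (simp only: if_True)
      qed simp
      finally show "cf (\<Sum>d\<in>?F. snd (prj d p)) n = cf (snd p) n" .
    qed
    ultimately have "x = (\<Oplus>\<^bsub>PM\<^esub>d\<in>?F. ?v d)"
      using finsum_enc[OF fin, of "\<lambda>d. prj d p"] prj_in_C[OF p(2)] p(1) by simp
    then show "(\<forall>d. ?v d \<in> DD d) \<and> finite ?F \<and> x = (\<Oplus>\<^bsub>PM\<^esub>d\<in>?F. ?v d)"
      using fin prj_in_CD[OF p(2)] by (auto simp: DD_def)
  next
    fix v assume v: "(\<forall>d. v d \<in> DD d) \<and> finite {d. v d \<noteq> \<zero>\<^bsub>PM\<^esub>} \<and>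
        x = (\<Oplus>\<^bsub>PM\<^esub>d\<in>{d. v d \<noteq> \<zero>\<^bsub>PM\<^esub>}. v d)"
    let ?S = "{d. v d \<noteq> \<zero>\<^bsub>PM\<^esub>}"
    have finS: "finite ?S" using v by blast
    have "v d \<in> DD d" for d using v by blast
    then have "\<forall>d. \<exists>q. v d = enc q \<and> q \<in> CD d" unfolding DD_def by blast
    then obtain f where f: "\<And>d. v d = enc (f d)" "\<And>d. f d \<in> CD d" by metis
    have fC: "f d \<in> C" for d using f(2) by (simp add: CD_def)
    have "x = (\<Oplus>\<^bsub>PM\<^esub>d\<in>?S. enc (f d))" using v f(1) by simp
    also have "\<dots> = enc (\<Sum>d\<in>?S. fst (f d), \<Sum>d\<in>?S. snd (f d))" by (rule finsum_enc[OF finS fC])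
    finally have pe: "p = (\<Sum>d\<in>?S. fst (f d), \<Sum>d\<in>?S. snd (f d))" using p(1) by simp
    have f0: "f d = (0, 0)" if "d \<notin> ?S" for d using that f(1)[of d] by simp
    have one: "(\<Sum>d\<in>?S. cf (g (f d)) n) = cf (g (f (int n - int k))) n"
      if g: "\<And>d n. cf (g (f d)) n \<noteq> 0 \<Longrightarrow> int n = d + int k" and g0: "g (0, 0) = 0" for g k n
    proof -
      have "(\<Sum>d\<in>?S. cf (g (f d)) n) = (\<Sum>d\<in>?S. if d = int n - int k then cf (g (f (int n - int k))) n else 0)"
        using g by (intro sum.cong) force+
      also have "\<dots> = (if int n - int k \<in> ?S then cf (g (f (int n - int k))) n else 0)" using finS by simp
      also have "\<dots> = cf (g (f (int n - int k))) n" using f0[of "int n - int k"] g0 by auto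
      finally show ?thesis .
    qed
    have c1: "cf (fst p) n = cf (fst (f (int n - int dl))) n" for n
      unfolding pe fst_conv cf_sum by (rule one) (use f(2) in \<open>auto simp: CD_def\<close>)
    have c2: "cf (snd p) n = cf (snd (f (int n - int yy))) n" for n
      unfolding pe snd_conv cf_sum by (rule one) (use f(2) in \<open>auto simp: CD_def\<close>)
    have "f d = prj d p" for d
    proof (rule prod_eqI)
      have m: "int n = d + int dl" if "cf (fst (f d)) n \<noteq> 0" for n using f(2)[of d] that by (auto simp: CD_def)
      show "fst (f d) = fst (prj d p)"
        unfolding prj_def fst_conv
      proof (rule cf_ext)
        fix n
        show "cf (fst (f d)) n = cf (restr {n. int n = d + int dl} (fst p)) n"
          using m[of n] c1[of n] by (cases "int n = d + int dl") auto
      qed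
      have m: "int n = d + int yy" if "cf (snd (f d)) n \<noteq> 0" for n using f(2)[of d] that by (auto simp: CD_def)
      show "snd (f d) = snd (prj d p)"
        unfolding prj_def snd_conv
      proof (rule cf_ext)
        fix n
        show "cf (snd (f d)) n = cf (restr {n. int n = d + int yy} (snd p)) n"
          using m[of n] c2[of n] by (cases "int n = d + int yy") auto
      qed
    qed
    then show "v = ?v" using f(1) by auto
  qed
qed

lemma mon_smult_DD:
  assumes s: "s \<in> G" and x: "x \<in> DD d" shows "mon c s \<odot>\<^bsub>PM\<^esub> x \<in> DD (d + int s)"
proof -
  obtain p where p: "x = enc p" "p \<in> CD d" using x by (auto simp: DD_def)
  have pC: "p \<in> C" using p by (simp add: CD_def)
  have "(mon c s * fst p, mon c s * snd p) \<in> CD (d + int s)"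
    using C_smult[OF pC mon_in_RS[OF s]] p(2)
    by (auto simp: CD_def cf_mon_mult of_nat_diff split: if_splits)
  then show ?thesis using p(1) by (cases p) (auto simp: DD_def)
qed

lemma gg_homogeneous: "gg ` {..<3} \<subseteq> homogeneous_elements DD"
proof -
  have "(td, ty) \<in> CD 0" "(1, 0) \<in> CD (- int dl)" "(0, 1) \<in> CD (- int yy)"
    using CI[of 1 0 0] CI[of 0 1 0] CI[of 0 0 1] by (auto simp: CD_def cf_mon cf_1 split: if_splits)
  then have "gg 0 \<in> DD 0" "gg 1 \<in> DD (- int dl)" "gg 2 \<in> DD (- int yy)"
    by (auto simp: gg_def DD_def)
  then show ?thesis unfolding lessThan_3 homogeneous_elements_def by blast
qed

end

section \<open>Numerical semigroups\<close>

context
  fixes A :: "nat set"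
  assumes A: "minimal_semigroup_generators A"
begin

lemma finite_gens: "finite A" and Gcd_gens: "Gcd A = 1" and gens_irredundant: "\<And>a. a \<in> A \<Longrightarrow> a \<notin> semigroup_gen (A - {a})"
  using A by (auto simp: minimal_semigroup_generators_def)

lemma zero_in_semigroup_gen: "0 \<in> semigroup_gen B"
  unfolding semigroup_gen_def by (intro CollectI exI[of _ "\<lambda>_. 0"]) simp

lemma zero_notin_gens: "0 \<notin> A"
  using gens_irredundant zero_in_semigroup_gen by blast

lemma semigroup_gen_add: "m \<in> semigroup_gen A \<Longrightarrow> n \<in> semigroup_gen A \<Longrightarrow> m + n \<in> semigroup_gen A"
proof -
  assume "m \<in> semigroup_gen A" "n \<in> semigroup_gen A"
  then obtain c d where cd: "m = (\<Sum>a\<in>A. c a * a)" "n = (\<Sum>a\<in>A. d a * a)" by (auto simp: semigroup_gen_def)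
  then have "m + n = (\<Sum>a\<in>A. (c a + d a) * a)" by (simp add: sum.distrib algebra_simps)
  then show ?thesis unfolding semigroup_gen_def by (intro CollectI exI[of _ "\<lambda>a. c a + d a"]) simp
qed

lemma semigroup_gen_mult: "m \<in> semigroup_gen A \<Longrightarrow> k * m \<in> semigroup_gen A"
  by (induction k) (auto intro: semigroup_gen_add zero_in_semigroup_gen)

lemma gens_subset: "A \<subseteq> semigroup_gen A"
proof
  fix a assume a: "a \<in> A"
  have "a = (\<Sum>b\<in>A. (if b = a then 1 else 0) * b)"
  proof -
    have "(\<Sum>b\<in>A. (if b = a then 1 else 0) * b) = (\<Sum>b\<in>A. if b = a then a else 0)" by (intro sum.cong) auto
    then show ?thesis using a finite_gens by simp
  qed
  then show "a \<in> semigroup_gen A" unfolding semigroup_gen_def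
    by (intro CollectI exI[of _ "\<lambda>b. if b = a then 1 else 0"]) simp
qed

lemma semigroup_gen_dec:
  assumes "s \<in> semigroup_gen A" "0 < s"
  shows "\<exists>a\<in>A. a \<le> s \<and> s - a \<in> semigroup_gen A"
proof -
  obtain c where c: "s = (\<Sum>a\<in>A. c a * a)" using assms(1) by (auto simp: semigroup_gen_def)
  have "\<exists>a\<in>A. c a * a \<noteq> 0"
  proof (rule ccontr)
    assume "\<not> ?thesis"
    then have "(\<Sum>a\<in>A. c a * a) = 0" by (intro sum.neutral) blast
    with c assms(2) show False by linarith
  qed
  then obtain a where a: "a \<in> A" "c a \<noteq> 0" by auto
  have s: "s = c a * a + (\<Sum>b\<in>A - {a}. c b * b)"
    unfolding c by (rule sum.remove[OF finite_gens a(1)])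
  let ?d = "c(a := c a - 1)"
  have "(\<Sum>b\<in>A. ?d b * b) = ?d a * a + (\<Sum>b\<in>A - {a}. ?d b * b)"
    by (rule sum.remove[OF finite_gens a(1)])
  also have "(\<Sum>b\<in>A - {a}. ?d b * b) = (\<Sum>b\<in>A - {a}. c b * b)" by (intro sum.cong) auto
  finally have "(\<Sum>b\<in>A. ?d b * b) + a = s" using s a(2) by (cases "c a") auto
  then have "s - a = (\<Sum>b\<in>A. ?d b * b)" "a \<le> s" by auto
  then show ?thesis using a(1) unfolding semigroup_gen_def by blast
qed

text \<open>The least positive difference \<open>d\<close> of two elements of the semigroup divides every generator, because
the remainder modulo \<open>d\<close> is again such a difference. As the generators have no common
divisor, \<open>d = 1\<close>.\<close>

lemma consecutive_ex: "\<exists>m\<in>semigroup_gen A. Suc m \<in> semigroup_gen A"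
proof -
  let ?G = "semigroup_gen A"
  define P where "P = (\<lambda>d. 0 < d \<and> (\<exists>y\<in>?G. y + d \<in> ?G))"
  obtain a0 where a0: "a0 \<in> A"
    using Gcd_gens by (metis Gcd_empty equals0I zero_neq_one)
  then have "P a0" using zero_notin_gens gens_subset zero_in_semigroup_gen
    by (auto simp: P_def intro!: bexI[of _ 0] gr0I)
  define d where "d = (LEAST d. P d)"
  have Pd: "P d" unfolding d_def by (rule LeastI) fact
  then obtain y where y: "y \<in> ?G" "y + d \<in> ?G" "0 < d" by (auto simp: P_def)
  have "d dvd a" if a: "a \<in> A" for a
  proof (rule ccontr)
    assume "\<not> d dvd a"
    then have pos: "0 < a mod d" by (simp add: dvd_eq_mod_eq_0)
    let ?q = "a div d"
    have eq: "?q * (y + d) + a mod d = a + ?q * y" by (simp add: algebra_simps)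
    have "P (a mod d)" unfolding P_def
    proof (intro conjI pos bexI)
      show "?q * (y + d) + a mod d \<in> ?G"
        unfolding eq using a gens_subset y(1) by (blast intro: semigroup_gen_add semigroup_gen_mult)
      show "?q * (y + d) \<in> ?G" by (rule semigroup_gen_mult[OF y(2)])
    qed
    moreover have "a mod d < d" using y(3) by simp
    ultimately show False using not_less_Least[of "a mod d" P] by (simp add: d_def)
  qed
  then have "d dvd Gcd A" by (rule Gcd_greatest)
  then have "d = 1" using Gcd_gens by simp
  then show ?thesis using y by (intro bexI[of _ y]) auto
qed

text \<open>With quotient \<open>q\<close> and remainder \<open>r \<le> q\<close> on division by \<open>m\<close>, one has
\<open>n = (q - r) m + r (m + 1)\<close>.\<close>

lemma semigroup_gen_cofinite: "\<exists>c. \<forall>n\<ge>c. n \<in> semigroup_gen A"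
proof -
  let ?G = "semigroup_gen A"
  obtain m where m: "m \<in> ?G" "Suc m \<in> ?G" using consecutive_ex by blast
  show ?thesis
  proof (cases "m = 0")
    case True
    then have "n \<in> ?G" for n using semigroup_gen_mult[OF m(2), of n] by simp
    then show ?thesis by blast
  next
    case False
    have "n \<in> ?G" if n: "n \<ge> m * m" for n
    proof -
      let ?q = "n div m" and ?r = "n mod m"
      have "?r < m" using False by simp
      moreover have "m \<le> ?q" using n False by (metis div_le_mono nonzero_mult_div_cancel_right)
      ultimately have le: "?r \<le> ?q" by simp
      have "n = ?q * m + ?r" by simp
      also have "\<dots> = (?q - ?r) * m + ?r * Suc m" using le by (simp add: diff_mult_distrib)
      finally have "n = (?q - ?r) * m + ?r * Suc m" .
      then show ?thesis using semigroup_gen_add semigroup_gen_mult m by metis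
    qed
    then show ?thesis by blast
  qed
qed

end

definition conductor_number :: "nat set \<Rightarrow> nat" where
  "conductor_number G = (LEAST c. \<forall>n\<ge>c. n \<in> G)"

lemma semigroup_ringI:
  fixes cf :: "'a::idom \<Rightarrow> nat \<Rightarrow> 'k::field" and mon :: "'k \<Rightarrow> nat \<Rightarrow> 'a"
  assumes ex: "exponent_ring cf mon" and A: "minimal_semigroup_generators A"
  shows "semigroup_ring cf mon (semigroup_gen A) (conductor_number (semigroup_gen A))"
proof -
  let ?G = "semigroup_gen A"
  interpret exponent_ring cf mon by (rule ex)
  have c: "n \<in> ?G" if "n \<ge> conductor_number ?G" for n
    using LeastI_ex[OF semigroup_gen_cofinite[OF A]] that unfolding conductor_number_def by blast
  show ?thesis
  proof
    show "0 \<in> ?G" by (rule zero_in_semigroup_gen[OF A])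
    show "m + n \<in> ?G" if "m \<in> ?G" "n \<in> ?G" for m n using semigroup_gen_add[OF A that] .
    show "n \<in> ?G" if "conductor_number ?G \<le> n" for n using c that .
    assume pos: "0 < conductor_number ?G"
    show "conductor_number ?G - 1 \<notin> ?G"
    proof
      assume h: "conductor_number ?G - 1 \<in> ?G"
      have "\<forall>n\<ge>conductor_number ?G - 1. n \<in> ?G"
      proof (intro allI impI)
        fix n assume "conductor_number ?G - 1 \<le> n"
        then show "n \<in> ?G" using h c[of n] by (cases "n = conductor_number ?G - 1") auto
      qed
      then have "conductor_number ?G \<le> conductor_number ?G - 1"
        unfolding conductor_number_def by (rule Least_le)
      then show False using pos by simp
    qed
  qed
qed

lemma inj_pair_ex:
  assumes "infinite (UNIV :: 'a set)" "inj (f :: 'a \<Rightarrow> 'm)"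
  shows "\<exists>h :: 'a \<times> 'a \<Rightarrow> 'm. inj h"
proof -
  obtain b where "bij_betw b ((UNIV :: 'a set) \<times> (UNIV :: 'a set)) (UNIV :: 'a set)"
    using card_of_Times_same_infinite[OF assms(1)] card_of_ordIso by blast
  then have "inj b" by (simp add: bij_betw_def)
  then have "inj (f \<circ> b)" using assms(2) by (rule inj_compose[rotated])
  then show ?thesis by blast
qed

section \<open>The equivalent conditions\<close>

context semigroup_ring
begin

lemma infinite_V: "infinite (UNIV :: 'a set)"
proof
  assume "finite (UNIV :: 'a set)"
  then have "finite (range (mon 1))" by (rule rev_finite_subset) simp
  moreover have "inj (mon 1)"
  proof (rule injI)
    fix m n assume "mon 1 m = mon 1 n"
    then have "cf (mon 1 m) m = cf (mon 1 n) m" by simp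
    then show "m = n" by (simp add: cf_mon split: if_splits)
  qed
  ultimately have "finite (UNIV :: nat set)" by (rule finite_imageD)
  then show False using infinite_UNIV_nat by blast
qed

lemma min_positive_ex:
  obtains e where "e \<in> G" "0 < e" "\<And>s. s \<in> G \<Longrightarrow> 0 < s \<Longrightarrow> e \<le> s"
proof -
  let ?P = "\<lambda>s. s \<in> G \<and> 0 < s"
  have "?P (Suc con)" using con_in_G by simp
  then have "?P (LEAST s. ?P s)" by (rule LeastI)
  then show ?thesis using that[of "LEAST s. ?P s"] Least_le[of ?P] by blast
qed

lemma small_or_conductor:
  assumes "hs_multiplicity R mm \<le> 2 \<or> conductor RS = to_fract ` mm"
  shows "mm \<subseteq> ge con \<or> 2 \<in> G"
proof -
  obtain e where e: "e \<in> G" "0 < e" "\<And>s. s \<in> G \<Longrightarrow> 0 < s \<Longrightarrow> e \<le> s" by (rule min_positive_ex) blast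
  consider "e = 1" | "e = 2" | "ge con = mm"
    using assms hs_multiplicity_eq[OF e] e(2) unfolding conductor_eq_iff by fastforce
  then show ?thesis
  proof cases
    case 1
    then have "2 \<in> G" using add_in_G[of 1 1] e(1) by (simp add: numeral_2_eq_2)
    then show ?thesis ..
  qed (use e in auto)
qed

text \<open>If the conductor is not the maximal ideal, then some positive element of \<open>G\<close> is less than \<open>con\<close>. The
least one differs from \<open>con - 1\<close>, which is not in \<open>G\<close>.\<close>

lemma pole_ex:
  assumes "\<not> (hs_multiplicity R mm \<le> 2 \<or> conductor RS = to_fract ` mm)" and "inj (f :: 'a \<Rightarrow> 'm)"
  shows "\<exists>e u. \<exists>enc :: 'a \<times> 'a \<Rightarrow> 'm. pole_module cf mon G con e u enc"
proof -
  obtain e where e: "e \<in> G" "0 < e" "\<And>s. s \<in> G \<Longrightarrow> 0 < s \<Longrightarrow> e \<le> s" by (rule min_positive_ex) blast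
  have e3: "3 \<le> e" and ne: "ge con \<noteq> mm"
    using assms(1) hs_multiplicity_eq[OF e] unfolding conductor_eq_iff by auto
  have "0 < con" using con_in_G[of 1] e(3)[of 1] e3 by (cases con) auto
  then have "ge con \<subseteq> mm" using ge_con_subset by (auto simp: mm_def ge_def)
  then obtain x where x: "x \<in> mm" "x \<notin> ge con" using ne by blast
  then obtain s where s: "s < con" "cf x s \<noteq> 0" by (auto simp: ge_def)
  then have "s \<in> G" "0 < s" using x(1) by (auto simp: mm_def RS_def intro!: gr0I)
  then have "e < con" using e(3)[of s] s(1) by simp
  moreover have "e \<noteq> con - 1" using con_least[OF \<open>0 < con\<close>] e(1) by auto
  ultimately have less: "Suc e < con" by simp
  obtain u where u: "u \<in> G" "e < u" "u - e \<notin> G" "u < con - 1 \<or> con - 1 < u \<and> u - (con - 1) \<notin> G"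
    using pole_exponents_ex[OF e(1) e3 e(3) less] by blast
  obtain enc :: "'a \<times> 'a \<Rightarrow> 'm" where "inj enc" using inj_pair_ex[OF infinite_V assms(2)] by blast
  then have "pole_module cf mon G con e u enc"
    using e u less by unfold_locales auto
  then show ?thesis by blast
qed

lemma trace_subset_of_homs_in_mm:
  assumes mod: "Module.module R M" and tf: "torsion_free R M" and fg: "finitely_generated R M"
    and homs: "\<And>f x. f \<in> module_hom R M (self_module R) \<Longrightarrow> x \<in> carrier M \<Longrightarrow> f x \<in> mm"
    and g: "generates R M n g"
    and not_free: "carrier M \<noteq> {\<zero>\<^bsub>M\<^esub>} \<Longrightarrow>
        (\<And>v i. v \<in> {..<n} \<rightarrow> RS \<Longrightarrow> lc M n g v = \<zero>\<^bsub>M\<^esub> \<Longrightarrow> i < n \<Longrightarrow> v i = 0) \<Longrightarrow> False"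
    and ring: "mm \<subseteq> ge con \<or> 2 \<in> G"
  shows "trace_ideal R M \<subseteq> trace_ideal R (syzygy R M n g)"
proof (cases "carrier M = {\<zero>\<^bsub>M\<^esub>}")
  case True
  then show ?thesis by (rule trace_zero_module[OF mod _ ideal_trace])
next
  case False
  then obtain v i where v: "v \<in> {..<n} \<rightarrow> RS" "lc M n g v = \<zero>\<^bsub>M\<^esub>" "i < n" "v i \<noteq> 0"
    using not_free by blast
  show ?thesis by (rule trace_subset_syzygy_trace[OF mod tf fg _ g v ring]) (rule homs)
qed

lemma local_condition:
  assumes unit: "\<And>u. u \<in> RS \<Longrightarrow> cf u 0 \<noteq> 0 \<Longrightarrow> \<exists>w\<in>RS. u * w = 1"
    and cond3: "hs_multiplicity R mm \<le> 2 \<or> conductor RS = to_fract ` mm"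
    and M: "Module.module R M" "finitely_generated R M" "torsion_free R M" "\<not> has_nonzero_free_summand R M"
  shows "trace_in_syzygy_trace R K mm M"
  unfolding trace_in_syzygy_trace_def
proof (intro allI impI)
  fix g assume g: "generates R M (mu R K mm M) g"
  show "trace_ideal R M \<subseteq> trace_ideal R (syzygy R M (mu R K mm M) g)"
  proof (rule trace_subset_of_homs_in_mm[OF M(1,3,2) _ g _ small_or_conductor[OF cond3]])
    show "f x \<in> mm" if "f \<in> module_hom R M (self_module R)" "x \<in> carrier M" for f x
      using local_free_summand[OF M(1) unit that] M(4) by blast
    assume nz: "carrier M \<noteq> {\<zero>\<^bsub>M\<^esub>}"
      and rel: "\<And>v i. v \<in> {..<mu R K mm M} \<rightarrow> RS \<Longrightarrow> lc M (mu R K mm M) g v = \<zero>\<^bsub>M\<^esub> \<Longrightarrow>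
        i < mu R K mm M \<Longrightarrow> v i = 0"
    have fb: "is_internal_direct_sum R M (carrier M) {\<zero>\<^bsub>M\<^esub>}"
      "is_basis_of R M (carrier M) (g ` {..<mu R K mm M})"
      by (rule free_family_basis[OF M(1) g], rule rel, assumption+)+
    show False using fb nz M(4) unfolding has_nonzero_free_summand_def by blast
  qed
qed

end

context graded_semigroup_ring
begin

lemma graded_condition:
  assumes cond3: "hs_multiplicity R mm \<le> 2 \<or> conductor RS = to_fract ` mm"
    and M: "Module.module R M" "finitely_generated R M" "torsion_free R M" "\<not> has_nonzero_graded_free_summand R M D"
    and D: "\<And>d. subgroup (D d) (add_monoid M)"
      "\<And>x. x \<in> carrier M \<Longrightarrow> \<exists>!u. (\<forall>d. u d \<in> D d) \<and> finite {d. u d \<noteq> \<zero>\<^bsub>M\<^esub>} \<and>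
        x = (\<Oplus>\<^bsub>M\<^esub>d\<in>{d. u d \<noteq> \<zero>\<^bsub>M\<^esub>}. u d)"
      "\<And>s c d x. s \<in> G \<Longrightarrow> x \<in> D d \<Longrightarrow> mon c s \<odot>\<^bsub>M\<^esub> x \<in> D (d + int s)"
  shows "graded_trace_in_syzygy_trace R K mm M D"
  unfolding graded_trace_in_syzygy_trace_def
proof (intro allI impI, elim conjE)
  fix g assume g: "generates R M (mu R K mm M) g"
    and gH: "g ` {..<mu R K mm M} \<subseteq> homogeneous_elements D"
  show "trace_ideal R M \<subseteq> trace_ideal R (syzygy R M (mu R K mm M) g)"
  proof (rule trace_subset_of_homs_in_mm[OF M(1,3,2) _ g _ small_or_conductor[OF cond3]])
    show "f x \<in> mm" if "f \<in> module_hom R M (self_module R)" "x \<in> carrier M" for f x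
      using graded_free_summand[OF M(1) D that] M(4) by blast
    assume nz: "carrier M \<noteq> {\<zero>\<^bsub>M\<^esub>}"
      and rel: "\<And>v i. v \<in> {..<mu R K mm M} \<rightarrow> RS \<Longrightarrow> lc M (mu R K mm M) g v = \<zero>\<^bsub>M\<^esub> \<Longrightarrow>
        i < mu R K mm M \<Longrightarrow> v i = 0"
    interpret module R M by (rule M(1))
    have HM: "homogeneous_elements D \<subseteq> carrier M"
      using subgroup.subset[OF D(1)] by (auto simp: homogeneous_elements_def)
    have zH: "\<zero>\<^bsub>M\<^esub> \<in> homogeneous_elements D"
      using subgroup.one_closed[OF D(1)] by (auto simp: homogeneous_elements_def)
    have s: "submodule R (carrier M) M" "submodule R {\<zero>\<^bsub>M\<^esub>} M" by unfold_locales auto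
    have "span (carrier M \<inter> homogeneous_elements D) = carrier M"
    proof
      show "span (carrier M \<inter> homogeneous_elements D) \<subseteq> carrier M" by (rule span_is_subset2) blast
      have "span (g ` {..<mu R K mm M}) \<subseteq> span (carrier M \<inter> homogeneous_elements D)"
        using gH HM by (intro span_is_monotone) blast
      then show "carrier M \<subseteq> span (carrier M \<inter> homogeneous_elements D)" using g by (simp add: generates_def)
    qed
    then have 1: "is_graded_submodule R M D (carrier M)" using s(1) by (simp add: is_graded_submodule_def)
    have "{\<zero>\<^bsub>M\<^esub>} \<inter> homogeneous_elements D = {\<zero>\<^bsub>M\<^esub>}" using zH by blast
    moreover have "span {\<zero>\<^bsub>M\<^esub>} = {\<zero>\<^bsub>M\<^esub>}"
      using span_is_subset[OF subset_refl s(2)] in_own_span[of "{\<zero>\<^bsub>M\<^esub>}"] by auto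
    ultimately have 2: "is_graded_submodule R M D {\<zero>\<^bsub>M\<^esub>}" using s(2) by (simp add: is_graded_submodule_def)
    have fb: "is_internal_direct_sum R M (carrier M) {\<zero>\<^bsub>M\<^esub>}"
      "is_basis_of R M (carrier M) (g ` {..<mu R K mm M})"
      by (rule free_family_basis[OF M(1) g], rule rel, assumption+)+
    show False using fb nz M(4) 1 2 gH
      unfolding has_nonzero_graded_free_summand_def by blast
  qed
qed

end

section \<open>The two cases of the theorem\<close>

text \<open>The coefficients of the inverse are determined recursively, and each step only adds exponents of
\<open>f\<close>.\<close>

lemma fps_unit_in_semigroup_ring:
  fixes f :: "'k::field fps"
  assumes S: "semigroup_ring fps_nth (\<lambda>c s. fps_const c * fps_X ^ s :: 'k fps) G con"
    and f: "f \<in> semigroup_ring.RS fps_nth G" "fps_nth f 0 \<noteq> 0"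
  shows "\<exists>w\<in>semigroup_ring.RS fps_nth G. f * w = 1"
proof -
  interpret S: semigroup_ring fps_nth "\<lambda>c s. fps_const c * fps_X ^ s :: 'k fps" G con by (rule S)
  let ?w = "inverse f"
  have fw: "f * ?w = 1" using f(2) by (simp add: inverse_mult_eq_1')
  have "fps_nth ?w n \<noteq> 0 \<Longrightarrow> n \<in> G" for n
  proof (induction n rule: less_induct)
    case (less n)
    show ?case
    proof (cases "n = 0")
      case False
      have "(\<Sum>i\<le>n. fps_nth f i * fps_nth ?w (n - i)) = 0"
        using fw False by (metis Fps.cf_1 Fps.cf_mult)
      then have "fps_nth f 0 * fps_nth ?w n + (\<Sum>i\<in>{..n} - {0}. fps_nth f i * fps_nth ?w (n - i)) = 0"
        by (subst (asm) sum.remove[of _ 0]) auto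
      then have "(\<Sum>i\<in>{..n} - {0}. fps_nth f i * fps_nth ?w (n - i)) \<noteq> 0"
        using f(2) less.prems by auto
      then obtain i where i: "i \<in> {..n} - {0}" "fps_nth f i * fps_nth ?w (n - i) \<noteq> 0"
        by (rule sum.not_neutral_contains_not_neutral)
      then have "n - i \<in> G" using less.IH[of "n - i"] by auto
      moreover have "i \<in> G" using i(2) f(1) by (auto simp: S.RS_def)
      ultimately show ?thesis using S.add_in_G[of i "n - i"] i(1) by auto
    qed simp
  qed
  then have "?w \<in> S.RS" by (simp add: S.RS_def)
  with fw show ?thesis by blast
qed

lemma complete_case:
  assumes A: "minimal_semigroup_generators A" and large: "large_enough TYPE('k::field fps) TYPE('m)"
  defines "R \<equiv> nsr_fps A :: 'k fps ring" and "\<mm> \<equiv> max_ideal_fps A :: 'k fps set"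
  defines "cond1 \<equiv> (\<forall>M :: ('k fps, 'm) module.
            Module.module R M \<and> finitely_generated R M \<and> torsion_free R M \<and>
            \<not> has_nonzero_free_summand R M
            \<longrightarrow> trace_in_syzygy_trace R coeff_field_fps \<mm> M)"
    and "cond2 \<equiv> (\<forall>M :: ('k fps, 'm) module.
            Module.module R M \<and> finitely_generated R M \<and> torsion_free R M \<and>
            \<not> has_nonzero_free_summand R M \<and>
            int (module_rank R M) = int (mu R coeff_field_fps \<mm> M) - 1
            \<longrightarrow> trace_in_syzygy_trace R coeff_field_fps \<mm> M)"
    and "cond3 \<equiv> (hs_multiplicity R \<mm> \<le> 2 \<or> conductor (carrier R) = to_fract ` \<mm>)"
  shows "(cond1 \<longleftrightarrow> cond2) \<and> (cond2 \<longleftrightarrow> cond3)"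
proof -
  let ?G = "semigroup_gen A"
  interpret S: semigroup_ring fps_nth "\<lambda>c s. fps_const c * fps_X ^ s :: 'k fps" ?G "conductor_number ?G"
    by (rule semigroup_ringI[OF Fps.exponent_ring_axioms A])
  have R: "R = S.R" by (simp add: R_def nsr_fps_def S.RS_def)
  have K: "coeff_field_fps = S.K" by (simp add: coeff_field_fps_def)
  have "\<mm> = genideal S.R ((\<lambda>s. fps_const 1 * fps_X ^ s) ` A)"
    unfolding \<mm>_def max_ideal_fps_def R_def[symmetric] R by simp
  also have "\<dots> = S.mm"
    using finite_gens[OF A] gens_subset[OF A] zero_notin_gens[OF A] semigroup_gen_dec[OF A]
    by (intro S.genideal_eq_mm) auto
  finally have m: "\<mm> = S.mm" .
  have "cond3 \<longrightarrow> cond1"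
    unfolding cond1_def cond3_def R K m
    using S.local_condition[OF fps_unit_in_semigroup_ring[OF S.semigroup_ring_axioms]] by auto
  moreover have "cond1 \<longrightarrow> cond2" unfolding cond1_def cond2_def by blast
  moreover have "cond2 \<longrightarrow> cond3"
  proof (rule impI, rule ccontr)
    assume c2: cond2 and c3: "\<not> cond3"
    obtain f :: "'k fps \<Rightarrow> 'm" where "inj f" using large by (auto simp: large_enough_def)
    then obtain e u and enc :: "'k fps \<times> 'k fps \<Rightarrow> 'm"
      where P: "pole_module fps_nth (\<lambda>c s. fps_const c * fps_X ^ s :: 'k fps) ?G (conductor_number ?G) e u enc"
      using S.pole_ex[of f] c3 unfolding cond3_def R m by auto
    interpret P: pole_module fps_nth "\<lambda>c s. fps_const c * fps_X ^ s :: 'k fps" ?G "conductor_number ?G" e u enc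
      by (rule P)
    have rank: "int (module_rank S.R P.PM) = int (mu S.R S.K S.mm P.PM) - 1"
      unfolding P.rank_PM P.mu_PM by simp
    have "trace_in_syzygy_trace S.R S.K S.mm P.PM"
      using c2 P.module_PM P.finitely_generated_PM P.torsion_free_PM P.no_free_summand_PM rank
      unfolding cond2_def R K m by blast
    then show False
      using P.generates_gg P.trace_not_subset unfolding trace_in_syzygy_trace_def P.mu_PM by blast
  qed
  ultimately show ?thesis by blast
qed

lemma graded_case:
  assumes A: "minimal_semigroup_generators A" and large: "large_enough TYPE('k::field poly) TYPE('n)"
  defines "R \<equiv> nsr_poly A :: 'k poly ring" and "\<mm> \<equiv> max_ideal_poly A :: 'k poly set"
  defines "cond1 \<equiv> (\<forall>(M :: ('k poly, 'n) module) D.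
            Module.module R M \<and> is_grading A M D \<and> finitely_generated R M \<and> torsion_free R M \<and>
            \<not> has_nonzero_graded_free_summand R M D
            \<longrightarrow> graded_trace_in_syzygy_trace R coeff_field_poly \<mm> M D)"
    and "cond2 \<equiv> (\<forall>(M :: ('k poly, 'n) module) D.
            Module.module R M \<and> is_grading A M D \<and> finitely_generated R M \<and> torsion_free R M \<and>
            \<not> has_nonzero_graded_free_summand R M D \<and>
            int (module_rank R M) = int (mu R coeff_field_poly \<mm> M) - 1
            \<longrightarrow> graded_trace_in_syzygy_trace R coeff_field_poly \<mm> M D)"
    and "cond3 \<equiv> (hs_multiplicity R \<mm> \<le> 2 \<or> conductor (carrier R) = to_fract ` \<mm>)"
  shows "(cond1 \<longleftrightarrow> cond2) \<and> (cond2 \<longleftrightarrow> cond3)"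
proof -
  let ?G = "semigroup_gen A"
  interpret S: semigroup_ring coeff "monom :: 'k \<Rightarrow> nat \<Rightarrow> 'k poly" ?G "conductor_number ?G"
    by (rule semigroup_ringI[OF Poly.exponent_ring_axioms A])
  interpret S: graded_semigroup_ring coeff "monom :: 'k \<Rightarrow> nat \<Rightarrow> 'k poly" ?G "conductor_number ?G"
    by unfold_locales (use MOST_coeff_eq_0 in \<open>simp add: MOST_iff_cofinite eventually_cofinite\<close>)
  have R: "R = S.R" by (simp add: R_def nsr_poly_def S.RS_def)
  have K: "coeff_field_poly = S.K" by (simp add: coeff_field_poly_def monom_0)
  have "\<mm> = genideal S.R (monom 1 ` A)"
    unfolding \<mm>_def max_ideal_poly_def R_def[symmetric] R by simp
  also have "\<dots> = S.mm"
    using finite_gens[OF A] gens_subset[OF A] zero_notin_gens[OF A] semigroup_gen_dec[OF A]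
    by (intro S.genideal_eq_mm) auto
  finally have m: "\<mm> = S.mm" .
  have "cond1" if c3: cond3
    unfolding cond1_def R K m
  proof (intro allI impI, elim conjE)
    fix M :: "('k poly, 'n) module" and D
    assume M: "Module.module S.R M" "is_grading A M D" "finitely_generated S.R M" "torsion_free S.R M"
      "\<not> has_nonzero_graded_free_summand S.R M D"
    show "graded_trace_in_syzygy_trace S.R S.K S.mm M D"
    proof (rule S.graded_condition[OF _ M(1,3,4,5)])
      show "hs_multiplicity S.R S.mm \<le> 2 \<or> conductor S.RS = to_fract ` S.mm"
        using c3 unfolding cond3_def R m by simp
    qed (use M(2) in \<open>unfold is_grading_def, blast+\<close>)
  qed
  moreover have "cond1 \<longrightarrow> cond2" unfolding cond1_def cond2_def by blast
  moreover have "cond2 \<longrightarrow> cond3"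
  proof (rule impI, rule ccontr)
    assume c2: cond2 and c3: "\<not> cond3"
    obtain f :: "'k poly \<Rightarrow> 'n" where "inj f" using large by (auto simp: large_enough_def)
    then obtain e u and enc :: "'k poly \<times> 'k poly \<Rightarrow> 'n"
      where P: "pole_module coeff (monom :: 'k \<Rightarrow> nat \<Rightarrow> 'k poly) ?G (conductor_number ?G) e u enc"
      using S.pole_ex[of f] c3 unfolding cond3_def R m by auto
    interpret P: pole_module coeff "monom :: 'k \<Rightarrow> nat \<Rightarrow> 'k poly" ?G "conductor_number ?G" e u enc
      by (rule P)
    interpret P: graded_pole_module coeff "monom :: 'k \<Rightarrow> nat \<Rightarrow> 'k poly" ?G "conductor_number ?G" e u enc
      by unfold_locales
    have gr: "is_grading A P.PM P.DD"
      unfolding is_grading_def using P.subgroup_DD P.decomposition_PM P.mon_smult_DD by blast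
    have rank: "int (module_rank S.R P.PM) = int (mu S.R S.K S.mm P.PM) - 1"
      unfolding P.rank_PM P.mu_PM by simp
    have "\<not> has_nonzero_graded_free_summand S.R P.PM P.DD"
      using P.no_free_summand_PM
      unfolding has_nonzero_graded_free_summand_def has_nonzero_free_summand_def by blast
    then have "graded_trace_in_syzygy_trace S.R S.K S.mm P.PM P.DD"
      using c2 P.module_PM P.finitely_generated_PM P.torsion_free_PM gr rank
      unfolding cond2_def R K m by blast
    then show False
      using P.generates_gg P.gg_homogeneous P.trace_not_subset
      unfolding graded_trace_in_syzygy_trace_def P.mu_PM by blast
  qed
  ultimately show ?thesis by blast
qed

theorem theorem1p2:
  fixes A :: "nat set"
  assumes "minimal_semigroup_generators A"
    and "large_enough TYPE('k::field fps) TYPE('m)"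
    and "large_enough TYPE('k poly) TYPE('n)"
  shows
    "(let R = nsr_fps A :: 'k fps ring; K = coeff_field_fps; \<mm> = max_ideal_fps A;
          cond1 = (\<forall>M :: ('k fps, 'm) module.
            Module.module R M \<and> finitely_generated R M \<and> torsion_free R M \<and>
            \<not> has_nonzero_free_summand R M
            \<longrightarrow> trace_in_syzygy_trace R K \<mm> M);
          cond2 = (\<forall>M :: ('k fps, 'm) module.
            Module.module R M \<and> finitely_generated R M \<and> torsion_free R M \<and>
            \<not> has_nonzero_free_summand R M \<and>
            int (module_rank R M) = int (mu R K \<mm> M) - 1
            \<longrightarrow> trace_in_syzygy_trace R K \<mm> M);
          cond3 = (hs_multiplicity R \<mm> \<le> 2 \<or> conductor (carrier R) = to_fract ` \<mm>)
      in (cond1 \<longleftrightarrow> cond2) \<and> (cond2 \<longleftrightarrow> cond3))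
     \<and>
     (let R = nsr_poly A :: 'k poly ring; K = coeff_field_poly; \<mm> = max_ideal_poly A;
          cond1 = (\<forall>(M :: ('k poly, 'n) module) D.
            Module.module R M \<and> is_grading A M D \<and> finitely_generated R M \<and> torsion_free R M \<and>
            \<not> has_nonzero_graded_free_summand R M D
            \<longrightarrow> graded_trace_in_syzygy_trace R K \<mm> M D);
          cond2 = (\<forall>(M :: ('k poly, 'n) module) D.
            Module.module R M \<and> is_grading A M D \<and> finitely_generated R M \<and> torsion_free R M \<and>
            \<not> has_nonzero_graded_free_summand R M D \<and>
            int (module_rank R M) = int (mu R K \<mm> M) - 1
            \<longrightarrow> graded_trace_in_syzygy_trace R K \<mm> M D);
          cond3 = (hs_multiplicity R \<mm> \<le> 2 \<or> conductor (carrier R) = to_fract ` \<mm>)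
      in (cond1 \<longleftrightarrow> cond2) \<and> (cond2 \<longleftrightarrow> cond3))"
  unfolding Let_def using complete_case[OF assms(1,2)] graded_case[OF assms(1,3)] by (rule conjI)

end
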